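(* Assume the setting below and let $\lambda\in\mathbb C\setminus\sigma_{\mathrm{ess}}(\mathcal L)$. Then $\lambda\in\sigma_{\mathrm{pt}}(\mathcal L)$ if and only if $\mathcal I+\mathcal K(\lambda)$ is not invertible on $L^2(\mathbb R,\mathbb C^4)$.
   Context: Setting. Fix real parameters $D,\beta,\delta,\alpha,\epsilon,\gamma,\mu,\nu$ with $\beta\ge 0$ and $(D,\beta)\neq(0,0)$. Let $\mathbf B=\begin{bmatrix}\beta&-D/2\\ D/2&\beta\end{bmatrix}$, $\mathbf N_0=\begin{bmatrix}\delta&-\alpha\\ \alpha&\delta\end{bmatrix}$, $\mathbf N_1=\begin{bmatrix}\epsilon&-\gamma\\ \gamma&\epsilon\end{bmatrix}$, $\mathbf N_2=\begin{bmatrix}\mu&-\nu\\ \nu&\mu\end{bmatrix}$. Let $\psi:\mathbb R\to\mathbb C$ be a stationary pulse of the cubic–quintic complex Ginzburg–Landau equation $i\Psi_t+\frac D2\Psi_{xx}+\gamma|\Psi|^2\Psi+\nu|\Psi|^4\Psi=i\delta\Psi+i\epsilon|\Psi|^2\Psi+i\beta\Psi_{xx}+i\mu|\Psi|^4\Psi$ (i.e. $\Psi(t,x)=e^{-i\alpha t}\psi(x)$ solves it), write $\boldsymbol\psi=[\operatorname{Re}\psi\ \operatorname{Im}\psi]^T$, $|\boldsymbol\psi|=\|\boldsymbol\psi(x)\|_2$, and assume $|\boldsymbol\psi(x)|\to0$ as $|x|\to\infty$. Let $\mathbf M(x)=\mathbf N_1|\boldsymbol\psi|^2+\mathbf N_2|\boldsymbol\psi|^4+(2\mathbf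 N_1+4\mathbf N_2|\boldsymbol\psi|^2)\boldsymbol\psi\boldsymbol\psi^T$ and $\mathcal L=\mathbf B\partial_x^2+\mathbf N_0+\mathbf M(x)$ on $H^2(\mathbb R,\mathbb C^2)\subset L^2(\mathbb R,\mathbb C^2)$ (the linearization about $\psi$). $\sigma_{\mathrm{pt}}(\mathcal L)=\{\lambda:\ker(\mathcal L-\lambda)\ne\{0\}\}$, and $\sigma_{\mathrm{ess}}(\mathcal L)=\{(\delta\pm i\alpha)-s^2(\beta\pm iD/2):s\in\mathbb R\}$. For $\lambda\notin\sigma_{\mathrm{ess}}(\mathcal L)$ let $\mathbf A_\infty(\lambda)=\begin{bmatrix}\mathbf 0&\mathbf I\\ \mathbf B^{-1}(\lambda\mathbf I-\mathbf N_0)&\mathbf 0\end{bmatrix}$ (which then has no purely imaginary eigenvalues) and $\mathbf Q(\lambda)$ the spectral projection onto its stable subspace (generalized eigenvectors for eigenvalues with negative real part). Let $\mathbf M(x)=\mathbf V(x)|\mathbf M(x)|$ be a polar decomposition ($|\mathbf M|=(\mathbf M^*\mathbf M)^{1/2}$, $\mathbf V$ unitary), and set $\mathbf R_\ell(x)=\begin{bmatrix}\mathbf 0&\mathbf 0\\ -\mathbf B^{-1}\mathbf V(x)|\mathbf M(x)|^{1/2}&\mathbf 0\end{bmatrix}$ (which equals $-\mathbf B^{-1}\mathbf M|\mathbf M|^{-1/2}$ in the lower-left block when $\mathbf M$ is invertible) and $\mathbf R_r(x)=\begin{bmatrix}|\mathbf M(x)|^{1/2}&\mathbf 0\\ \mathbf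 0&\mathbf 0\end{bmatrix}$. The (symmetrized) Birman–Schwinger operator is $\mathcal K(\lambda)=\mathbf R_r\,\mathcal G_A(\lambda)\,\mathbf R_\ell$, where $\mathcal G_A(\lambda)=(-\partial_x+\mathbf A_\infty(\lambda))^{-1}$ is the integral operator on $L^2(\mathbb R,\mathbb C^4)$ with kernel $\mathbf G_A(x-y)$, $\mathbf G_A(x)=-e^{\mathbf A_\infty x}\mathbf Q$ for $x\ge0$ and $\mathbf G_A(x)=e^{\mathbf A_\infty x}(\mathbf I-\mathbf Q)$ for $x<0$. *)

theory Defs
  imports "HOL-Analysis.Analysis"
begin

text \<open>Real 2x2 matrices are embedded into complex 2x2 matrices; C^4 is modelled as
  C^2 x C^2 (first and second block component); the Euclidean norm on C^4 is the
  product norm.\<close>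

definition mat2 :: "real \<Rightarrow> real \<Rightarrow> real \<Rightarrow> real \<Rightarrow> complex^2^2" where
  "mat2 a b c d = vector [vector [complex_of_real a, complex_of_real b],
                          vector [complex_of_real c, complex_of_real d]]"

definition cadj :: "complex^2^2 \<Rightarrow> complex^2^2" where
  "cadj A = (\<chi> i j. cnj (A $ j $ i))"

definition hermitian_psd :: "complex^2^2 \<Rightarrow> bool" where
  "hermitian_psd S \<longleftrightarrow> cadj S = S \<and>
     (\<forall>v::complex^2. 0 \<le> Re (\<Sum>i\<in>UNIV. cnj (v $ i) * (S *v v) $ i))"

definition msqrt :: "complex^2^2 \<Rightarrow> complex^2^2" where
  "msqrt A = (THE S. hermitian_psd S \<and> S ** S = A)"

definition mabs :: "complex^2^2 \<Rightarrow> complex^2^2" where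
  "mabs M = msqrt (cadj M ** M)"

definition unitary2 :: "complex^2^2 \<Rightarrow> bool" where
  "unitary2 V \<longleftrightarrow> cadj V ** V = mat 1"

definition cscale4 :: "complex \<Rightarrow> ((complex^2) \<times> (complex^2)) \<Rightarrow> ((complex^2) \<times> (complex^2))" where
  "cscale4 c v = (c *s fst v, c *s snd v)"

definition gen_eigvec ::
  "(((complex^2) \<times> (complex^2)) \<Rightarrow> ((complex^2) \<times> (complex^2))) \<Rightarrow> complex \<Rightarrow> ((complex^2) \<times> (complex^2)) \<Rightarrow> bool" where
  "gen_eigvec A \<mu> v \<longleftrightarrow> (\<exists>k::nat. ((\<lambda>w. A w - cscale4 \<mu> w) ^^ k) v = 0)"

definition stable_sub where
  "stable_sub A = span {v. \<exists>\<mu>. Re \<mu> < 0 \<and> gen_eigvec A \<mu> v}"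

definition unstable_sub where
  "unstable_sub A = span {v. \<exists>\<mu>. Re \<mu> > 0 \<and> gen_eigvec A \<mu> v}"

definition stable_proj ::
  "(((complex^2) \<times> (complex^2)) \<Rightarrow> ((complex^2) \<times> (complex^2))) \<Rightarrow> (((complex^2) \<times> (complex^2)) \<Rightarrow> ((complex^2) \<times> (complex^2)))" where
  "stable_proj A = (THE P. linear P \<and> (\<forall>v\<in>stable_sub A. P v = v) \<and> (\<forall>v\<in>unstable_sub A. P v = 0))"

definition mexp ::
  "(((complex^2) \<times> (complex^2)) \<Rightarrow> ((complex^2) \<times> (complex^2))) \<Rightarrow> real \<Rightarrow> ((complex^2) \<times> (complex^2)) \<Rightarrow> ((complex^2) \<times> (complex^2))" where
  "mexp A t v = (\<Sum>n. (t ^ n / fact n) *\<^sub>R (A ^^ n) v)"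

definition Bm :: "real \<Rightarrow> real \<Rightarrow> complex^2^2" where
  "Bm D \<beta> = mat2 \<beta> (- D / 2) (D / 2) \<beta>"

definition Nm :: "real \<Rightarrow> real \<Rightarrow> complex^2^2" where
  "Nm a b = mat2 a (- b) b a"

definition Mpot :: "real \<Rightarrow> real \<Rightarrow> real \<Rightarrow> real \<Rightarrow> (real \<Rightarrow> complex) \<Rightarrow> real \<Rightarrow> complex^2^2" where
  "Mpot \<epsilon> \<gamma> \<mu> \<nu> \<psi> x =
     (let p = vector [complex_of_real (Re (\<psi> x)), complex_of_real (Im (\<psi> x))] :: complex^2;
          r = (cmod (\<psi> x))\<^sup>2;
          ppT = (\<chi> i j. p $ i * p $ j) :: complex^2^2
      in r *\<^sub>R Nm \<epsilon> \<gamma> + (r ^ 2) *\<^sub>R Nm \<mu> \<nu> + (2 *\<^sub>R Nm \<epsilon> \<gamma> + (4 * r) *\<^sub>R Nm \<mu> \<nu>) ** ppT)"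

definition Ainf :: "real \<Rightarrow> real \<Rightarrow> real \<Rightarrow> real \<Rightarrow> complex \<Rightarrow>
    ((complex^2) \<times> (complex^2)) \<Rightarrow> ((complex^2) \<times> (complex^2))" where
  "Ainf D \<beta> \<delta> \<alpha> lam v =
     (snd v, matrix_inv (Bm D \<beta>) *v (lam *s fst v - Nm \<delta> \<alpha> *v fst v))"

text \<open>Kernel \<open>G_A(x)\<close> of \<open>(-\<partial>_x + A_\<infinity>(lam))^{-1}\<close>, applied to a vector.\<close>
definition GA :: "real \<Rightarrow> real \<Rightarrow> real \<Rightarrow> real \<Rightarrow> complex \<Rightarrow> real \<Rightarrow>
    ((complex^2) \<times> (complex^2)) \<Rightarrow> ((complex^2) \<times> (complex^2))" where
  "GA D \<beta> \<delta> \<alpha> lam x v =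
     (let A = Ainf D \<beta> \<delta> \<alpha> lam; Q = stable_proj A in
      if 0 \<le> x then - mexp A x (Q v) else mexp A x (v - Q v))"

definition Rl :: "real \<Rightarrow> real \<Rightarrow> (real \<Rightarrow> complex^2^2) \<Rightarrow> (real \<Rightarrow> complex^2^2) \<Rightarrow> real \<Rightarrow>
    ((complex^2) \<times> (complex^2)) \<Rightarrow> ((complex^2) \<times> (complex^2))" where
  "Rl D \<beta> V M y v = (0, - ((matrix_inv (Bm D \<beta>) ** V y ** msqrt (mabs (M y))) *v fst v))"

definition Rr :: "(real \<Rightarrow> complex^2^2) \<Rightarrow> real \<Rightarrow>
    ((complex^2) \<times> (complex^2)) \<Rightarrow> ((complex^2) \<times> (complex^2))" where
  "Rr M x v = (msqrt (mabs (M x)) *v fst v, 0)"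

definition BS_op :: "real \<Rightarrow> real \<Rightarrow> real \<Rightarrow> real \<Rightarrow> (real \<Rightarrow> complex^2^2) \<Rightarrow>
    (real \<Rightarrow> complex^2^2) \<Rightarrow> complex \<Rightarrow> (real \<Rightarrow> (complex^2) \<times> (complex^2)) \<Rightarrow> real \<Rightarrow> (complex^2) \<times> (complex^2)" where
  "BS_op D \<beta> \<delta> \<alpha> M V lam f x =
     Rr M x (LINT y|lborel. GA D \<beta> \<delta> \<alpha> lam (x - y) (Rl D \<beta> V M y (f y)))"

definition sq_int :: "(real \<Rightarrow> 'a::{banach, second_countable_topology}) \<Rightarrow> bool" where
  "sq_int f \<longleftrightarrow> f \<in> borel_measurable lborel \<and> integrable lborel (\<lambda>x. (norm (f x))\<^sup>2)"

text \<open>Invertibility of a linear operator \<open>T\<close> on \<open>L^2(\<real>,C^4)\<close> (functions modulo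
  a.e. equality): bijectivity (a bounded inverse is then automatic).\<close>
definition L2_invertible ::
  "((real \<Rightarrow> (complex^2) \<times> (complex^2)) \<Rightarrow> (real \<Rightarrow> (complex^2) \<times> (complex^2))) \<Rightarrow> bool" where
  "L2_invertible T \<longleftrightarrow>
     (\<forall>f. sq_int f \<longrightarrow> (AE x in lborel. T f x = 0) \<longrightarrow> (AE x in lborel. f x = 0)) \<and>
     (\<forall>g. sq_int g \<longrightarrow> (\<exists>f. sq_int f \<and> (AE x in lborel. T f x = g x)))"

definition test_fun :: "(real \<Rightarrow> real) \<Rightarrow> bool" where
  "test_fun \<phi> \<longleftrightarrow> (\<forall>n x. ((deriv ^^ n) \<phi>) differentiable (at x)) \<and>
                    (\<exists>R. \<forall>x. R < \<bar>x\<bar> \<longrightarrow> \<phi> x = 0)"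

definition weak_deriv :: "(real \<Rightarrow> complex^2) \<Rightarrow> (real \<Rightarrow> complex^2) \<Rightarrow> bool" where
  "weak_deriv u v \<longleftrightarrow>
     (\<forall>\<phi>. test_fun \<phi> \<longrightarrow>
        (LINT x|lborel. deriv \<phi> x *\<^sub>R u x) = - (LINT x|lborel. \<phi> x *\<^sub>R v x))"

text \<open>Point spectrum of \<open>\<L> = B \<partial>_x^2 + N_0 + M(x)\<close> on \<open>H^2(\<real>,C^2)\<close>:
  a nonzero \<open>u \<in> H^2\<close> (with weak derivatives \<open>u1, u2\<close> in \<open>L^2\<close>) with \<open>\<L> u = lam u\<close> a.e.\<close>
definition in_point_spectrum :: "real \<Rightarrow> real \<Rightarrow> real \<Rightarrow> real \<Rightarrow> (real \<Rightarrow> complex^2^2) \<Rightarrow>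
    complex \<Rightarrow> bool" where
  "in_point_spectrum D \<beta> \<delta> \<alpha> M lam \<longleftrightarrow>
     (\<exists>u u1 u2. sq_int u \<and> sq_int u1 \<and> sq_int u2 \<and> weak_deriv u u1 \<and> weak_deriv u1 u2 \<and>
        \<not> (AE x in lborel. u x = 0) \<and>
        (AE x in lborel. Bm D \<beta> *v u2 x + Nm \<delta> \<alpha> *v u x + M x *v u x = lam *s u x))"

definition ess_spectrum :: "real \<Rightarrow> real \<Rightarrow> real \<Rightarrow> real \<Rightarrow> complex set" where
  "ess_spectrum D \<beta> \<delta> \<alpha> =
     {(\<delta> + \<i> * \<alpha>) - (s\<^sup>2) * (\<beta> + \<i> * D / 2) | s::real. True} \<union>
     {(\<delta> - \<i> * \<alpha>) - (s\<^sup>2) * (\<beta> - \<i> * D / 2) | s::real. True}"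

end

theory Submission
  imports Defs
begin

text \<open>The matrices \<open>B\<close>, \<open>N\<^sub>0\<close> commute and are diagonal in the coordinates \<open>v\<^sub>1 \<plusminus> \<i> v\<^sub>2\<close>, so off the
  essential spectrum the upper right block of \<open>G\<^sub>A\<close> is the kernel \<open>exp (- S \<bar>x\<bar>) / (2 S)\<close> with
  \<open>S\<^sup>2 = B\<^sup>-\<^sup>1 (lam - N\<^sub>0)\<close> and \<open>Re S > 0\<close>. Writing \<open>w\<close> for its convolution with
  \<open>B\<^sup>-\<^sup>1 V \<bar>M\<bar>\<^sup>1\<^sup>/\<^sup>2 f\<^sub>1\<close>, the equation \<open>f + K f = g\<close> becomes \<open>w = w\<^sub>0 + G * (B\<^sup>-\<^sup>1 M w)\<close>, that is,
  \<open>(\<L> - lam) w = V \<bar>M\<bar>\<^sup>1\<^sup>/\<^sup>2 g\<^sub>1\<close>. As \<open>M\<close> vanishes at infinity, \<open>w \<mapsto> G * (B\<^sup>-\<^sup>1 M w)\<close> is a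
  contraction plus an operator of finite rank on bounded continuous functions; there the Fredholm
  alternative holds, and it transfers to \<open>L\<^sup>2\<close> because a bounded solution with square integrable
  \<open>w\<^sub>0\<close> is square integrable. Conversely, mollifying shows that a weak \<open>H\<^sup>2\<close> eigenfunction equals
  the convolution almost everywhere, by uniqueness of bounded solutions of \<open>w'' = S\<^sup>2 w\<close>.\<close>

subsection \<open>Contractions plus finite rank, and the exponential kernel\<close>

text \<open>The obstacle is that a Fredholm alternative is wanted on L^2 without the spectral theory
  of compact operators. In the uniform norm it becomes elementary: the kernel is Lipschitz, so
  moving \<open>y\<close> to a grid point of mesh \<open>1 / m\<close> costs O(1 / m) uniformly in
  \<open>x\<close>. The price is a change of spaces, and the passage from \<open>f\<close> to
  \<open>w\<close> pays it: \<open>w\<close> is bounded and continuous whenever \<open>f\<close> is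
  in L^2, and for a solution \<open>f\<close> is recovered from \<open>w\<close> and
  \<open>g\<close>. Since \<open>L2_invertible\<close> asks for bijectivity only, no bound on an
  inverse has to be carried along.

  The block structure cuts C^4 down to C^2: \<open>Rl\<close> reads only the first component and
  \<open>Rr\<close> keeps only the first one, so that I + K is the identity on second components. Of
  the four blocks of the Green kernel just the upper right one survives, but the lower right one
  must still be shown integrable, because the integral is taken over pairs.

  The factor \<open>V\<close> is a pointwise choice and may fail to be measurable; it enters only
  through its product with the square root of |M|, and explicit formulas for 2x2 roots show that
  this product is measurable.\<close>

text \<open>With the contraction \<open>A = T - F\<close> and \<open>R\<close> the inverse of
  \<open>I - A\<close>, the equation \<open>x = y + T x\<close> becomes \<open>h x = R y\<close> for
  \<open>h = I - R F\<close>. Injectivity of \<open>I - T\<close> makes \<open>h\<close> injective;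
  \<open>h\<close> maps the finite-dimensional span of the image of \<open>S\<close> under
  \<open>R\<close> into itself, hence onto itself, and this corrects the first guess
  \<open>R y\<close>.\<close>

lemma surj_of_inj_contraction_plus_finite_rank:
  fixes T F :: "'a::banach \<Rightarrow> 'a"
  assumes T: "linear T" and F: "linear F"
    and fin: "finite S" and range: "range F \<subseteq> span S"
    and q: "q < 1" and contr: "\<And>x. norm (T x - F x) \<le> q * norm x"
    and inj: "\<And>x. x = T x \<Longrightarrow> x = 0"
  shows "\<exists>x. x = y + T x"
proof -
  interpret T: linear T by fact
  interpret F: linear F by fact
  have q0: "0 \<le> q" if "(x::'a) \<noteq> 0" for x
    using order_trans[OF norm_ge_zero contr[of x]] that by (simp add: zero_le_mult_iff)
  define A where "A x = T x - F x" for x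
  have A: "linear A" unfolding A_def by (intro linear_compose_sub T F)
  interpret A: linear A by fact
  have contrA: "norm (A x - A y) \<le> q * norm (x - y)" for x y
    using contr[of "x - y"] by (metis A.diff A_def)
  have ex: "\<exists>!x. y + A x = x" for y
  \<comment> \<open>The fixed point theorem needs \<open>0 \<le> q\<close>, which the estimate
    forces only if some vector is nonzero.\<close>
  proof (cases "\<exists>x::'a. x \<noteq> 0")
    case True
    then show ?thesis
      using q0 q contr
      by (intro banach_fix_type[of q]) (auto simp: dist_norm contrA)
  next
    case False
    then have all0: "x = 0" for x :: 'a by blast
    show ?thesis by (rule ex1I[of _ 0]) (rule trans[OF all0 all0[symmetric]])+
  qed
  define R where "R y = (THE x. y + A x = x)" for y
  have R: "y + A (R y) = R y" for y unfolding R_def using theI'[OF ex[of y]] .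
  have Runq: "y + A x = x \<Longrightarrow> x = R y" for x y using ex[of y] R[of y] by blast
  have linR: "linear R"
  proof (rule linearI)
    fix a b :: 'a and r :: real
    have "a + b + A (R a + R b) = R a + R b" using R[of a] R[of b] by (simp add: A.add algebra_simps)
    then show "R (a + b) = R a + R b" using Runq by metis
    have "r *\<^sub>R a + A (r *\<^sub>R R a) = r *\<^sub>R R a" using R[of a] by (metis A.scaleR scaleR_add_right)
    then show "R (r *\<^sub>R a) = r *\<^sub>R R a" using Runq by metis
  qed
  interpret R: linear R by fact
  define h where "h z = z - R (F z)" for z
  have linh: "linear h" unfolding h_def using linear_compose[OF F linR]
    by (intro linear_compose_sub linear_ident) (simp add: o_def)
  interpret h: linear h by fact
  have h0: "h z = 0 \<Longrightarrow> z = 0" for z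
    using R[of "F z"] by (intro inj) (simp add: h_def A_def)
  then have injh: "inj h" using h.inj_iff_eq_0 by blast
  obtain B where B: "B \<subseteq> R ` S" "independent B" "R ` S \<subseteq> span B"
    using maximal_independent_subset[of "R ` S"] by blast
  have finB: "finite B" using B(1) fin finite_subset by blast
  have RF: "R (F z) \<in> span B" for z
  proof -
    have "R (F z) \<in> R ` span S" using range by auto
    also have "\<dots> = span (R ` S)" by (rule linear_span_image[OF linR, symmetric])
    also have "\<dots> \<subseteq> span B" using B(3) by (simp add: span_minimal)
    finally show ?thesis .
  qed
  have hB: "h ` B \<subseteq> span B"
    using span_diff[OF span_base RF] by (auto simp: h_def)
  have ind: "independent (h ` B)"
    by (rule linear_independent_injective_image[OF linh B(2)]) (rule inj_on_subset[OF injh subset_UNIV])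
  obtain t where t: "card t = card B" "finite t" "h ` B \<subseteq> t" "t \<subseteq> h ` B \<union> B" "h ` B \<subseteq> span t"
    using exchange_lemma[OF finB ind hB] by blast
  have "card (h ` B) = card B" by (intro card_image inj_on_subset[OF injh subset_UNIV])
  then have "h ` B = t" using t(1-3) by (intro card_subset_eq) auto
  \<comment> \<open>Finite dimension enters here: the image of \<open>B\<close> is independent and
    has as many elements as \<open>B\<close>, so a vector of \<open>B\<close> outside its span would
    exceed the dimension.\<close>
  have BB: "B \<subseteq> span (h ` B)"
  proof (rule ccontr)
    assume "\<not> ?thesis"
    then obtain b where b: "b \<in> B" "b \<notin> span (h ` B)" by blast
    then have "independent (insert b (h ` B))" using ind by (simp add: independent_insert)
    moreover have "insert b (h ` B) \<subseteq> span B" using hB b by (auto intro: span_base)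
    ultimately have "card (insert b (h ` B)) \<le> card B"
      using independent_span_bound[OF finB] by blast
    moreover have "b \<notin> h ` B" using b(2) span_base[of b "h ` B"] by argo
    ultimately show False using \<open>card (h ` B) = card B\<close> finB by simp
  qed
  \<comment> \<open>Trying \<open>R y\<close> as a solution of \<open>h x = R y\<close> leaves the
    error \<open>R (F (R y))\<close>; it lies where \<open>h\<close> is onto, so some
    \<open>z\<close> removes it.\<close>
  have "R (F (R y)) \<in> span (h ` B)" using RF span_minimal[OF BB subspace_span] by blast
  then obtain z where z: "R (F (R y)) = h z" unfolding linear_span_image[OF linh] by blast
  have hz: "h (R y + z) = R y" using z by (simp add: h.add) (simp add: h_def)
  show ?thesis
  proof (intro exI[of _ "R y + z"])
    have *: "R y + z = R (y + F (R y + z))" using hz by (simp add: h_def R.add algebra_simps)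
    show "R y + z = y + T (R y + z)"
      using R[of "y + F (R y + z)"] unfolding *[symmetric] by (simp add: A_def algebra_simps)
  qed
qed

section \<open>Integrals of the exponential kernel and square integrable functions\<close>

lemma nn_integral_exp_abs:
  fixes \<tau> x :: real
  assumes "\<tau> > 0"
  shows "(\<integral>\<^sup>+y. ennreal (exp (- \<tau> * \<bar>x - y\<bar>)) \<partial>lborel) = ennreal (2 / \<tau>)"
proof -
  have half: "(\<integral>\<^sup>+y. ennreal (exp (- \<tau> * y)) * indicator {0..} y \<partial>lborel) = ennreal (0 - (- exp (- \<tau> * 0) / \<tau>))"
  proof (rule nn_integral_FTC_atLeast)
    show "((\<lambda>y. - exp (- \<tau> * y) / \<tau>) has_real_derivative exp (- \<tau> * y)) (at y)" for y
      using assms by (auto intro!: derivative_eq_intros)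
    show "((\<lambda>y. - exp (- \<tau> * y) / \<tau>) \<longlongrightarrow> 0) at_top"
    proof -
      have "((\<lambda>y. exp (- (\<tau> * y))) \<longlongrightarrow> 0) at_top"
        using assms
        by (intro filterlim_compose[OF exp_at_bot] filterlim_compose[OF filterlim_uminus_at_bot_at_top]
            filterlim_tendsto_pos_mult_at_top[OF tendsto_const] filterlim_ident)
      then have "((\<lambda>y. - exp (- (\<tau> * y)) / \<tau>) \<longlongrightarrow> - 0 / \<tau>) at_top"
        using assms by (intro tendsto_intros) auto
      then show ?thesis by simp
    qed
  qed auto
  have a: "(\<integral>\<^sup>+y. ennreal (exp (- \<tau> * \<bar>x - y\<bar>)) * indicator {x..} y \<partial>lborel) = ennreal (1 / \<tau>)"
    using half by (subst nn_integral_real_affine[where t=x and c=1])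
      (auto simp: indicator_def intro!: nn_integral_cong cong: nn_integral_cong
         elim!: trans[rotated])
  have b: "(\<integral>\<^sup>+y. ennreal (exp (- \<tau> * \<bar>x - y\<bar>)) * indicator {..<x} y \<partial>lborel) = ennreal (1 / \<tau>)"
  proof -
    have "(\<integral>\<^sup>+y. ennreal (exp (- \<tau> * \<bar>x - y\<bar>)) * indicator {..<x} y \<partial>lborel) =
          (\<integral>\<^sup>+y. ennreal (exp (- \<tau> * y)) * indicator {0<..} y \<partial>lborel)"
      by (subst nn_integral_real_affine[where t=x and c="-1"])
        (auto simp: indicator_def intro!: nn_integral_cong)
    also have "\<dots> = (\<integral>\<^sup>+y. ennreal (exp (- \<tau> * y)) * indicator {0..} y \<partial>lborel)"
      using AE_lborel_singleton[of "0::real"]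
      by (intro nn_integral_cong_AE, eventually_elim) (auto simp: indicator_def)
    finally show ?thesis using half by simp
  qed
  have "(\<integral>\<^sup>+y. ennreal (exp (- \<tau> * \<bar>x - y\<bar>)) \<partial>lborel) =
     (\<integral>\<^sup>+y. ennreal (exp (- \<tau> * \<bar>x - y\<bar>)) * indicator {x..} y
         + ennreal (exp (- \<tau> * \<bar>x - y\<bar>)) * indicator {..<x} y \<partial>lborel)"
    by (intro nn_integral_cong) (auto simp: indicator_def)
  also have "\<dots> = ennreal (1 / \<tau>) + ennreal (1 / \<tau>)"
    using a b by (subst nn_integral_add) auto
  also have "\<dots> = ennreal (2 / \<tau>)" using assms by (simp add: ennreal_plus[symmetric] del: ennreal_plus)
  finally show ?thesis .
qed

lemma integrable_exp_abs:
  fixes \<tau> x :: real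
  assumes "\<tau> > 0"
  shows "integrable lborel (\<lambda>y. exp (- \<tau> * \<bar>x - y\<bar>))"
  using nn_integral_exp_abs[OF assms] by (intro integrableI_nonneg) auto

lemma integral_exp_abs:
  fixes \<tau> x :: real
  assumes "\<tau> > 0"
  shows "(LINT y|lborel. exp (- \<tau> * \<bar>x - y\<bar>)) = 2 / \<tau>"
  using nn_integral_exp_abs[OF assms] assms by (subst integral_eq_nn_integral) auto

text \<open>Young's inequality for an L^1 kernel acting on L^2. The kernel is the square of
  \<open>e\<close>; Cauchy-Schwarz for fixed \<open>x\<close> gives one factor
  \<open>2 / \<tau>\<close> and Tonelli the other. Working in \<open>ennreal\<close> permits its use
  before finiteness is known.\<close>

lemma young_exp_kernel_nn:
  fixes \<phi> :: "real \<Rightarrow> ennreal" and \<tau> :: real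
  assumes [measurable]: "\<phi> \<in> borel_measurable borel" and \<tau>: "\<tau> > 0"
  shows "(\<integral>\<^sup>+x. (\<integral>\<^sup>+y. ennreal (exp (- \<tau> * \<bar>x - y\<bar>)) * \<phi> y \<partial>lborel)\<^sup>2 \<partial>lborel)
     \<le> ennreal ((2 / \<tau>)\<^sup>2) * (\<integral>\<^sup>+y. (\<phi> y)\<^sup>2 \<partial>lborel)"
proof -
  define e where "e x y = exp (- (\<tau> / 2) * \<bar>x - y\<bar>)" for x y :: real
  have ee: "ennreal (e x y) * ennreal (e x y) = ennreal (exp (- \<tau> * \<bar>x - y\<bar>))" for x y
    by (simp add: e_def ennreal_mult[symmetric] exp_add[symmetric])
  have [measurable]: "case_prod e \<in> borel_measurable (borel \<Otimes>\<^sub>M borel)"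
    unfolding e_def by measurable
  have "(\<integral>\<^sup>+y. ennreal (exp (- \<tau> * \<bar>x - y\<bar>)) * \<phi> y \<partial>lborel)\<^sup>2
      \<le> ennreal (2 / \<tau>) * (\<integral>\<^sup>+y. ennreal (exp (- \<tau> * \<bar>x - y\<bar>)) * (\<phi> y)\<^sup>2 \<partial>lborel)" for x
  proof -
    have "(\<integral>\<^sup>+y. ennreal (exp (- \<tau> * \<bar>x - y\<bar>)) * \<phi> y \<partial>lborel)\<^sup>2 =
          (\<integral>\<^sup>+y. ennreal (e x y) * (ennreal (e x y) * \<phi> y) \<partial>lborel)\<^sup>2"
      by (simp add: ee mult.assoc[symmetric])
    also have "\<dots> \<le> (\<integral>\<^sup>+y. (ennreal (e x y))\<^sup>2 \<partial>lborel) * (\<integral>\<^sup>+y. (ennreal (e x y) * \<phi> y)\<^sup>2 \<partial>lborel)"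
      by (rule Cauchy_Schwarz_nn_integral) measurable
    also have "(\<integral>\<^sup>+y. (ennreal (e x y))\<^sup>2 \<partial>lborel) = ennreal (2 / \<tau>)"
      unfolding power2_eq_square ee by (rule nn_integral_exp_abs[OF \<tau>])
    also have "(\<integral>\<^sup>+y. (ennreal (e x y) * \<phi> y)\<^sup>2 \<partial>lborel) = (\<integral>\<^sup>+y. ennreal (exp (- \<tau> * \<bar>x - y\<bar>)) * (\<phi> y)\<^sup>2 \<partial>lborel)"
      by (intro nn_integral_cong) (simp only: power2_eq_square ee[symmetric] ac_simps)
    finally show ?thesis .
  qed
  then have "(\<integral>\<^sup>+x. (\<integral>\<^sup>+y. ennreal (exp (- \<tau> * \<bar>x - y\<bar>)) * \<phi> y \<partial>lborel)\<^sup>2 \<partial>lborel)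
     \<le> (\<integral>\<^sup>+x. ennreal (2 / \<tau>) * (\<integral>\<^sup>+y. ennreal (exp (- \<tau> * \<bar>x - y\<bar>)) * (\<phi> y)\<^sup>2 \<partial>lborel) \<partial>lborel)"
    by (intro nn_integral_mono) auto
  also have "\<dots> = ennreal (2 / \<tau>) * (\<integral>\<^sup>+x. (\<integral>\<^sup>+y. ennreal (exp (- \<tau> * \<bar>x - y\<bar>)) * (\<phi> y)\<^sup>2 \<partial>lborel) \<partial>lborel)"
    by (intro nn_integral_cmult) measurable
  also have "(\<integral>\<^sup>+x. (\<integral>\<^sup>+y. ennreal (exp (- \<tau> * \<bar>x - y\<bar>)) * (\<phi> y)\<^sup>2 \<partial>lborel) \<partial>lborel)
     = (\<integral>\<^sup>+y. (\<integral>\<^sup>+x. ennreal (exp (- \<tau> * \<bar>x - y\<bar>)) * (\<phi> y)\<^sup>2 \<partial>lborel) \<partial>lborel)"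
    by (intro lborel_pair.Fubini'[symmetric]) measurable
  also have "\<dots> = (\<integral>\<^sup>+y. ennreal (2 / \<tau>) * (\<phi> y)\<^sup>2 \<partial>lborel)"
    using nn_integral_exp_abs[OF \<tau>] by (intro nn_integral_cong) (simp add: nn_integral_multc abs_minus_commute)
  also have "\<dots> = ennreal (2 / \<tau>) * (\<integral>\<^sup>+y. (\<phi> y)\<^sup>2 \<partial>lborel)"
    by (intro nn_integral_cmult) measurable
  also have "ennreal (2 / \<tau>) * (ennreal (2 / \<tau>) * (\<integral>\<^sup>+y. (\<phi> y)\<^sup>2 \<partial>lborel)) = ennreal ((2 / \<tau>)\<^sup>2) * (\<integral>\<^sup>+y. (\<phi> y)\<^sup>2 \<partial>lborel)"
    using \<tau> by (simp only: power2_eq_square ennreal_mult zero_le_divide_iff mult.assoc less_imp_le zero_le_numeral HOL.simp_thms)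
  finally show ?thesis .
qed

lemma sq_int_iff_nn:
  "sq_int f \<longleftrightarrow> f \<in> borel_measurable borel \<and> (\<integral>\<^sup>+x. (ennreal (norm (f x)))\<^sup>2 \<partial>lborel) < \<infinity>"
  unfolding sq_int_def by (auto simp: integrable_iff_bounded ennreal_power)

lemma ennreal_square_add_le:
  fixes a b :: ennreal
  shows "(a + b)\<^sup>2 \<le> 2 * a\<^sup>2 + 2 * b\<^sup>2"
proof (cases a; cases b)
  fix r s :: real assume rs: "0 \<le> r" "a = ennreal r" "0 \<le> s" "b = ennreal s"
  have "(r + s)\<^sup>2 \<le> 2 * r\<^sup>2 + 2 * s\<^sup>2" using zero_le_power2[of "r - s"] by (simp add: power2_eq_square algebra_simps)
  then have "ennreal ((r + s)\<^sup>2) \<le> ennreal (2 * r\<^sup>2 + 2 * s\<^sup>2)" by (rule ennreal_leI)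
  then show ?thesis using rs
    by (simp add: ennreal_plus ennreal_mult ennreal_power[symmetric])
qed (auto simp: power2_eq_square ennreal_mult_top ennreal_top_mult)

lemma sq_int_add:
  fixes f g :: "real \<Rightarrow> 'a::{banach, second_countable_topology}"
  assumes "sq_int f" "sq_int g"
  shows "sq_int (\<lambda>x. f x + g x)"
proof -
  have [measurable]: "f \<in> borel_measurable borel" "g \<in> borel_measurable borel"
    using assms by (auto simp: sq_int_def)
  have "(\<integral>\<^sup>+x. (ennreal (norm (f x + g x)))\<^sup>2 \<partial>lborel)
      \<le> (\<integral>\<^sup>+x. 2 * (ennreal (norm (f x)))\<^sup>2 + 2 * (ennreal (norm (g x)))\<^sup>2 \<partial>lborel)"
  proof (intro nn_integral_mono)
    fix x
    have "ennreal (norm (f x + g x)) \<le> ennreal (norm (f x)) + ennreal (norm (g x))"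
      by (simp add: ennreal_plus[symmetric] norm_triangle_ineq del: ennreal_plus)
    then have "(ennreal (norm (f x + g x)))\<^sup>2 \<le> (ennreal (norm (f x)) + ennreal (norm (g x)))\<^sup>2"
      by (intro power_mono) auto
    also note ennreal_square_add_le
    finally show "(ennreal (norm (f x + g x)))\<^sup>2 \<le> 2 * (ennreal (norm (f x)))\<^sup>2 + 2 * (ennreal (norm (g x)))\<^sup>2" .
  qed
  also have "\<dots> = 2 * (\<integral>\<^sup>+x. (ennreal (norm (f x)))\<^sup>2 \<partial>lborel) + 2 * (\<integral>\<^sup>+x. (ennreal (norm (g x)))\<^sup>2 \<partial>lborel)"
    by (subst nn_integral_add) (auto simp: nn_integral_cmult)
  also have "\<dots> < \<infinity>" using assms by (auto simp: sq_int_iff_nn ennreal_mult_less_top)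
  finally show ?thesis by (simp add: sq_int_iff_nn)
qed

lemma sq_int_bound:
  fixes f :: "real \<Rightarrow> 'a::{banach, second_countable_topology}" and g :: "real \<Rightarrow> 'b::{banach, second_countable_topology}"
  assumes "sq_int g" and [measurable]: "f \<in> borel_measurable borel" and "\<And>x. norm (f x) \<le> K * norm (g x)"
  shows "sq_int f"
proof -
  have "integrable lborel (\<lambda>x. K\<^sup>2 * (norm (g x))\<^sup>2)" using assms(1) by (auto simp: sq_int_def)
  then have "integrable lborel (\<lambda>x. (norm (f x))\<^sup>2)"
  proof (rule Bochner_Integration.integrable_bound)
    show "AE x in lborel. norm ((norm (f x))\<^sup>2) \<le> norm (K\<^sup>2 * (norm (g x))\<^sup>2)"
      using power_mono[OF assms(3) norm_ge_zero, of _ 2] by (simp add: power_mult_distrib)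
  qed measurable
  then show ?thesis by (simp add: sq_int_def)
qed

text \<open>A common home for bounded and for square integrable inputs: it is what makes convolution
  with a kernel of decay rate \<sigma> converge absolutely, at every point once it does at
  0.\<close>

definition exp_integrable :: "real \<Rightarrow> (real \<Rightarrow> 'a::{banach, second_countable_topology}) \<Rightarrow> bool" where
  "exp_integrable \<sigma> h \<longleftrightarrow> h \<in> borel_measurable borel \<and> integrable lborel (\<lambda>y. exp (- \<sigma> * \<bar>y\<bar>) * norm (h y))"

abbreviation exp_conv :: "real \<Rightarrow> (real \<Rightarrow> 'a::real_normed_vector) \<Rightarrow> real \<Rightarrow> real" where
  "exp_conv \<sigma> h x \<equiv> LINT y|lborel. exp (- \<sigma> * \<bar>x - y\<bar>) * norm (h y)"

lemma exp_integrable_translate: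
  assumes "exp_integrable \<sigma> h" "\<sigma> \<ge> 0"
  shows "integrable lborel (\<lambda>y. exp (- \<sigma> * \<bar>x - y\<bar>) * norm (h y))"
proof (rule Bochner_Integration.integrable_bound)
  show "integrable lborel (\<lambda>y. exp (\<sigma> * \<bar>x\<bar>) * (exp (- \<sigma> * \<bar>y\<bar>) * norm (h y)))"
    using assms by (auto simp: exp_integrable_def)
  have [measurable]: "h \<in> borel_measurable borel" using assms by (simp add: exp_integrable_def)
  show "(\<lambda>y. exp (- \<sigma> * \<bar>x - y\<bar>) * norm (h y)) \<in> borel_measurable lborel" by measurable
  show "AE y in lborel. norm (exp (- \<sigma> * \<bar>x - y\<bar>) * norm (h y)) \<le> norm (exp (\<sigma> * \<bar>x\<bar>) * (exp (- \<sigma> * \<bar>y\<bar>) * norm (h y)))"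
  proof (rule AE_I2)
    fix y
    have "- \<sigma> * \<bar>x - y\<bar> \<le> \<sigma> * \<bar>x\<bar> + - \<sigma> * \<bar>y\<bar>"
      using mult_left_mono[OF _ assms(2), of "\<bar>y\<bar>" "\<bar>x - y\<bar> + \<bar>x\<bar>"] by (simp add: algebra_simps)
    then have "exp (- \<sigma> * \<bar>x - y\<bar>) \<le> exp (\<sigma> * \<bar>x\<bar>) * exp (- \<sigma> * \<bar>y\<bar>)" by (simp add: exp_add[symmetric])
    then have "exp (- \<sigma> * \<bar>x - y\<bar>) * norm (h y) \<le> exp (\<sigma> * \<bar>x\<bar>) * exp (- \<sigma> * \<bar>y\<bar>) * norm (h y)"
      by (rule mult_right_mono) simp
    then show "norm (exp (- \<sigma> * \<bar>x - y\<bar>) * norm (h y)) \<le> norm (exp (\<sigma> * \<bar>x\<bar>) * (exp (- \<sigma> * \<bar>y\<bar>) * norm (h y)))"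
      by (simp add: abs_mult)
  qed
qed

lemma exp_integrable_bounded:
  assumes [measurable]: "h \<in> borel_measurable borel" and "\<And>y. norm (h y) \<le> B" "\<sigma> > 0"
  shows "exp_integrable \<sigma> h"
    and "(exp_conv \<sigma> h x) \<le> B * (2 / \<sigma>)"
proof -
  have 1: "integrable lborel (\<lambda>y. exp (- \<sigma> * \<bar>0 - y\<bar>) * B)"
    using integrable_exp_abs[OF assms(3)] by (rule integrable_mult_left)
  have B: "0 \<le> B" using order_trans[OF norm_ge_zero assms(2)] .
  have "integrable lborel (\<lambda>y. exp (- \<sigma> * \<bar>y\<bar>) * norm (h y))"
    by (rule Bochner_Integration.integrable_bound[OF 1])
      (use B assms in \<open>auto simp: abs_mult intro!: mult_left_mono AE_I2\<close>)
  then show h: "exp_integrable \<sigma> h" by (simp add: exp_integrable_def)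
  have "(exp_conv \<sigma> h x) \<le> (LINT y|lborel. exp (- \<sigma> * \<bar>x - y\<bar>) * B)"
    using exp_integrable_translate[OF h] integrable_exp_abs[OF assms(3)] assms
    by (intro integral_mono mult_left_mono integrable_mult_left) auto
  also have "\<dots> = B * (2 / \<sigma>)" using integral_exp_abs[OF assms(3), of x] by simp
  finally show "(exp_conv \<sigma> h x) \<le> B * (2 / \<sigma>)" .
qed

text \<open>From \<open>a * b \<le> a^2 + b^2\<close> pointwise, with \<open>1 / \<sigma>\<close>
  the integral of the squared exponential. Cruder than Cauchy-Schwarz, but a bound uniform in
  \<open>x\<close> is all that is wanted.\<close>

lemma exp_integrable_sq_int:
  assumes h: "sq_int h" and \<sigma>: "\<sigma> > 0"
  shows "exp_integrable \<sigma> h"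
    and "(exp_conv \<sigma> h x) \<le> 1 / \<sigma> + (LINT y|lborel. (norm (h y))\<^sup>2)"
proof -
  have [measurable]: "h \<in> borel_measurable borel" using h by (simp add: sq_int_def)
  have i: "integrable lborel (\<lambda>y. exp (- (2 * \<sigma>) * \<bar>x - y\<bar>) + (norm (h y))\<^sup>2)" for x
    using integrable_exp_abs[of "2 * \<sigma>" x] h \<sigma> by (auto simp: sq_int_def intro!: Bochner_Integration.integrable_add)
  have le: "exp (- \<sigma> * \<bar>x - y\<bar>) * norm (h y) \<le> exp (- (2 * \<sigma>) * \<bar>x - y\<bar>) + (norm (h y))\<^sup>2" for x y
  proof -
    have "exp (- \<sigma> * \<bar>x - y\<bar>) * norm (h y) \<le> (exp (- \<sigma> * \<bar>x - y\<bar>))\<^sup>2 + (norm (h y))\<^sup>2"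
      using sum_squares_bound[of "exp (- \<sigma> * \<bar>x - y\<bar>)" "norm (h y)"]
        mult_nonneg_nonneg[OF exp_ge_zero[of "- \<sigma> * \<bar>x - y\<bar>"] norm_ge_zero[of "h y"]] by linarith
    then show ?thesis by (simp add: exp_double[symmetric] mult.assoc)
  qed
  have j: "integrable lborel (\<lambda>y. exp (- \<sigma> * \<bar>x - y\<bar>) * norm (h y))" for x
    by (rule Bochner_Integration.integrable_bound[OF i[of x]])
      (use le in \<open>auto intro!: AE_I2 order_trans[OF le abs_ge_self]\<close>)
  then show "exp_integrable \<sigma> h" using j[of 0] by (simp add: exp_integrable_def)
  have "(exp_conv \<sigma> h x) \<le> (LINT y|lborel. exp (- (2 * \<sigma>) * \<bar>x - y\<bar>) + (norm (h y))\<^sup>2)"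
    by (intro integral_mono j i le)
  also have "\<dots> = 1 / \<sigma> + (LINT y|lborel. (norm (h y))\<^sup>2)"
    using integrable_exp_abs[of "2 * \<sigma>" x] integral_exp_abs[of "2 * \<sigma>" x] h \<sigma>
    by (subst Bochner_Integration.integral_add) (auto simp: sq_int_def)
  finally show "(exp_conv \<sigma> h x) \<le> 1 / \<sigma> + (LINT y|lborel. (norm (h y))\<^sup>2)" .
qed

lemma nn_integral_exp_kernel:
  assumes "exp_integrable \<sigma> h" "\<sigma> \<ge> 0"
  shows "ennreal (exp_conv \<sigma> h x) =
    (\<integral>\<^sup>+y. ennreal (exp (- \<sigma> * \<bar>x - y\<bar>)) * ennreal (norm (h y)) \<partial>lborel)"
  using exp_integrable_translate[OF assms, of x]
  by (subst nn_integral_eq_integral[symmetric]) (auto simp: ennreal_mult)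

lemma sq_int_exp_kernel_bound:
  fixes f :: "real \<Rightarrow> 'b::{banach, second_countable_topology}"
  assumes h: "sq_int h" and \<sigma>: "\<sigma> > 0" and [measurable]: "f \<in> borel_measurable borel"
    and f: "\<And>x. norm (f x) \<le> C * (exp_conv \<sigma> h x)"
  shows "sq_int f"
proof -
  have [measurable]: "h \<in> borel_measurable borel" using h by (simp add: sq_int_def)
  let ?I = "\<lambda>x. (\<integral>\<^sup>+y. ennreal (exp (- \<sigma> * \<bar>x - y\<bar>)) * ennreal (norm (h y)) \<partial>lborel)"
  have "ennreal (norm (f x)) \<le> ennreal \<bar>C\<bar> * ?I x" for x
  proof -
    have nn: "0 \<le> (exp_conv \<sigma> h x)" by simp
    have "norm (f x) \<le> \<bar>C\<bar> * (exp_conv \<sigma> h x)"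
      using f[of x] mult_right_mono[OF abs_ge_self nn, of C] by linarith
    then have "ennreal (norm (f x)) \<le> ennreal (\<bar>C\<bar> * (exp_conv \<sigma> h x))"
      by (rule ennreal_leI)
    also have "\<dots> = ennreal \<bar>C\<bar> * ?I x"
      using \<sigma> nn by (subst ennreal_mult) (auto simp only: nn_integral_exp_kernel[OF exp_integrable_sq_int(1)[OF h \<sigma>]] abs_ge_zero less_imp_le)
    finally show ?thesis .
  qed
  then have "(\<integral>\<^sup>+x. (ennreal (norm (f x)))\<^sup>2 \<partial>lborel) \<le> (\<integral>\<^sup>+x. (ennreal \<bar>C\<bar>)\<^sup>2 * (?I x)\<^sup>2 \<partial>lborel)"
    unfolding power_mult_distrib[symmetric] by (intro nn_integral_mono power_mono) auto
  also have "\<dots> = (ennreal \<bar>C\<bar>)\<^sup>2 * (\<integral>\<^sup>+x. (?I x)\<^sup>2 \<partial>lborel)"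
    by (intro nn_integral_cmult) measurable
  also have "\<dots> \<le> (ennreal \<bar>C\<bar>)\<^sup>2 * (ennreal ((2 / \<sigma>)\<^sup>2) * (\<integral>\<^sup>+y. (ennreal (norm (h y)))\<^sup>2 \<partial>lborel))"
    by (intro mult_left_mono young_exp_kernel_nn \<sigma>) auto
  also have "\<dots> < \<infinity>" using h by (auto simp: sq_int_iff_nn ennreal_mult_less_top ennreal_power)
  finally show ?thesis by (simp add: sq_int_iff_nn)
qed

text \<open>Upgrades boundedness to square integrability. \<open>4 / \<sigma>\<close> dominates the
  Young constant \<open>2 / (\<sigma> - \<eta>)\<close> of every weight with
  \<open>\<eta> \<le> \<sigma> / 2\<close>; after squaring, the condition on \<kappa> leaves the
  factor \<open>2 * (1 / 2)^2 = 1 / 2\<close> to be absorbed.\<close>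

lemma sq_int_of_exp_kernel_self_bound:
  fixes w :: "real \<Rightarrow> 'a::{banach, second_countable_topology}" and \<phi> :: "real \<Rightarrow> 'b::{banach, second_countable_topology}"
  assumes [measurable]: "w \<in> borel_measurable borel" and B: "\<And>x. norm (w x) \<le> B"
    and \<phi>: "sq_int \<phi>" and \<sigma>: "\<sigma> > 0" and \<kappa>: "0 \<le> \<kappa>" "\<kappa> * (4 / \<sigma>) \<le> 1 / 2"
    and le: "\<And>x. norm (w x) \<le> norm (\<phi> x) + \<kappa> * (exp_conv \<sigma> w x)"
  shows "sq_int w"
proof -
  have [measurable]: "\<phi> \<in> borel_measurable borel" using \<phi> by (simp add: sq_int_def)
  define \<Phi> where "\<Phi> = (\<integral>\<^sup>+x. (ennreal (norm (\<phi> x)))\<^sup>2 \<partial>lborel)"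
  have \<Phi>: "\<Phi> < \<infinity>" using \<phi> by (simp add: sq_int_iff_nn \<Phi>_def)
  have w: "exp_integrable \<sigma> w" using B \<sigma> by (intro exp_integrable_bounded) auto
  \<comment> \<open>With the weight \<open>exp (- \<eta> \<bar>x\<bar>)\<close> all norms are finite, so the self-bound can be absorbed;
    the resulting estimate is uniform in \<open>\<eta>\<close>.\<close>
  define a where "a \<eta> x = ennreal (exp (- \<eta> * \<bar>x\<bar>) * norm (w x))" for \<eta> x
  have [measurable]: "a \<eta> \<in> borel_measurable borel" for \<eta> unfolding a_def by measurable
  have main: "(\<integral>\<^sup>+x. (a \<eta> x)\<^sup>2 \<partial>lborel) \<le> 4 * \<Phi>" if \<eta>: "0 < \<eta>" "\<eta> \<le> \<sigma> / 2" for \<eta>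
  proof -
    let ?I = "\<lambda>x. (\<integral>\<^sup>+y. ennreal (exp (- (\<sigma> - \<eta>) * \<bar>x - y\<bar>)) * a \<eta> y \<partial>lborel)"
    have "a \<eta> x \<le> ennreal (norm (\<phi> x)) + ennreal \<kappa> * ?I x" for x
    proof -
      have nn: "0 \<le> (exp_conv \<sigma> w x)" by simp
      have e1: "exp (- \<eta> * \<bar>x\<bar>) \<le> 1" using \<eta> by simp
      have "exp (- \<eta> * \<bar>x\<bar>) * norm (w x) \<le> exp (- \<eta> * \<bar>x\<bar>) * (norm (\<phi> x) + \<kappa> * (exp_conv \<sigma> w x))"
        using le by (intro mult_left_mono) auto
      also have "\<dots> \<le> norm (\<phi> x) + exp (- \<eta> * \<bar>x\<bar>) * (\<kappa> * (exp_conv \<sigma> w x))"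
        using mult_right_mono[OF e1, of "norm (\<phi> x)"] by (simp add: distrib_left)
      finally have "a \<eta> x \<le> ennreal (norm (\<phi> x) + \<kappa> * (exp (- \<eta> * \<bar>x\<bar>) * (exp_conv \<sigma> w x)))"
        unfolding a_def by (intro ennreal_leI) (simp only: ac_simps)
      also have "\<dots> = ennreal (norm (\<phi> x)) + ennreal \<kappa> * (ennreal (exp (- \<eta> * \<bar>x\<bar>)) * ennreal (exp_conv \<sigma> w x))"
        using \<kappa>(1) nn by (simp add: ennreal_mult)
      also have "ennreal (exp (- \<eta> * \<bar>x\<bar>)) * ennreal (exp_conv \<sigma> w x)
          = (\<integral>\<^sup>+y. ennreal (exp (- \<eta> * \<bar>x\<bar>)) * (ennreal (exp (- \<sigma> * \<bar>x - y\<bar>)) * ennreal (norm (w y))) \<partial>lborel)"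
        unfolding nn_integral_exp_kernel[OF w less_imp_le[OF \<sigma>]]
        by (rule nn_integral_cmult[symmetric]) measurable
      also have "\<dots> \<le> ?I x"
      proof (intro nn_integral_mono)
        fix y
        \<comment> \<open>The triangle inequality moves the weight from \<open>x\<close> to
          \<open>y\<close> and lowers the decay rate of the kernel from \<sigma> to
          \<open>\<sigma> - \<eta>\<close>.\<close>
        have "- \<eta> * \<bar>x\<bar> + - \<sigma> * \<bar>x - y\<bar> \<le> - (\<sigma> - \<eta>) * \<bar>x - y\<bar> + - \<eta> * \<bar>y\<bar>"
          using mult_left_mono[OF _ less_imp_le[OF \<eta>(1)], of "\<bar>y\<bar>" "\<bar>x - y\<bar> + \<bar>x\<bar>"] by (simp add: algebra_simps)
        then have "exp (- \<eta> * \<bar>x\<bar>) * exp (- \<sigma> * \<bar>x - y\<bar>) \<le> exp (- (\<sigma> - \<eta>) * \<bar>x - y\<bar>) * exp (- \<eta> * \<bar>y\<bar>)"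
          by (simp add: exp_add[symmetric])
        then have "(exp (- \<eta> * \<bar>x\<bar>) * exp (- \<sigma> * \<bar>x - y\<bar>)) * norm (w y) \<le> (exp (- (\<sigma> - \<eta>) * \<bar>x - y\<bar>) * exp (- \<eta> * \<bar>y\<bar>)) * norm (w y)"
          by (rule mult_right_mono) simp
        then show "ennreal (exp (- \<eta> * \<bar>x\<bar>)) * (ennreal (exp (- \<sigma> * \<bar>x - y\<bar>)) * ennreal (norm (w y)))
            \<le> ennreal (exp (- (\<sigma> - \<eta>) * \<bar>x - y\<bar>)) * a \<eta> y"
          unfolding a_def by (simp add: ennreal_mult[symmetric] mult.assoc)
      qed
      finally show ?thesis by (simp add: mult_left_mono)
    qed
    then have "(\<integral>\<^sup>+x. (a \<eta> x)\<^sup>2 \<partial>lborel) \<le> (\<integral>\<^sup>+x. 2 * (ennreal (norm (\<phi> x)))\<^sup>2 + 2 * ((ennreal \<kappa>)\<^sup>2 * (?I x)\<^sup>2) \<partial>lborel)"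
      unfolding power_mult_distrib[symmetric]
      by (intro nn_integral_mono order_trans[OF power_mono ennreal_square_add_le]) auto
    also have "\<dots> = 2 * \<Phi> + 2 * ((ennreal \<kappa>)\<^sup>2 * (\<integral>\<^sup>+x. (?I x)\<^sup>2 \<partial>lborel))"
      unfolding \<Phi>_def by (subst nn_integral_add) (auto simp: nn_integral_cmult)
    also have "\<dots> \<le> 2 * \<Phi> + 2 * ((ennreal \<kappa>)\<^sup>2 * (ennreal ((2 / (\<sigma> - \<eta>))\<^sup>2) * (\<integral>\<^sup>+x. (a \<eta> x)\<^sup>2 \<partial>lborel)))"
      using \<eta> \<sigma> by (intro add_left_mono mult_left_mono young_exp_kernel_nn) auto
    also have "\<dots> = 2 * \<Phi> + ennreal (2 * (\<kappa> * (2 / (\<sigma> - \<eta>)))\<^sup>2) * (\<integral>\<^sup>+x. (a \<eta> x)\<^sup>2 \<partial>lborel)"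
    proof -
      have "ennreal (2 * (\<kappa> * X)\<^sup>2) = 2 * ((ennreal \<kappa>)\<^sup>2 * ennreal (X\<^sup>2))" for X
        using \<kappa> by (simp add: ennreal_mult ennreal_power power_mult_distrib)
      then show ?thesis by (simp only: mult.assoc)
    qed
    also have "\<dots> \<le> 2 * \<Phi> + ennreal (1 / 2) * (\<integral>\<^sup>+x. (a \<eta> x)\<^sup>2 \<partial>lborel)"
    proof -
      have "2 / (\<sigma> - \<eta>) \<le> 4 / \<sigma>" using \<eta> \<sigma> by (simp add: field_simps)
      then have "\<kappa> * (2 / (\<sigma> - \<eta>)) \<le> 1 / 2" using \<kappa> by (meson mult_left_mono order_trans)
      moreover have "0 \<le> \<kappa> * (2 / (\<sigma> - \<eta>))" using \<kappa> \<eta> \<sigma> by simp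
      ultimately have "2 * (\<kappa> * (2 / (\<sigma> - \<eta>)))\<^sup>2 \<le> 1 / 2"
        using power_mono[of "\<kappa> * (2 / (\<sigma> - \<eta>))" "1/2" 2] by (simp add: power2_eq_square)
      then show ?thesis by (intro add_left_mono mult_right_mono ennreal_leI) auto
    qed
    finally have ineq: "(\<integral>\<^sup>+x. (a \<eta> x)\<^sup>2 \<partial>lborel) \<le> 2 * \<Phi> + ennreal (1 / 2) * (\<integral>\<^sup>+x. (a \<eta> x)\<^sup>2 \<partial>lborel)" .
    have "(\<integral>\<^sup>+x. (a \<eta> x)\<^sup>2 \<partial>lborel) \<le> (\<integral>\<^sup>+x. ennreal (B\<^sup>2) * ennreal (exp (- (2 * \<eta>) * \<bar>0 - x\<bar>)) \<partial>lborel)"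
    proof (intro nn_integral_mono)
      fix x
      have "(exp (- \<eta> * \<bar>x\<bar>) * norm (w x))\<^sup>2 \<le> (exp (- \<eta> * \<bar>x\<bar>) * B)\<^sup>2"
        using B by (intro power_mono mult_left_mono) auto
      also have "\<dots> = B\<^sup>2 * exp (- (2 * \<eta>) * \<bar>0 - x\<bar>)" by (simp add: power_mult_distrib exp_double[symmetric] mult.assoc)
      finally show "(a \<eta> x)\<^sup>2 \<le> ennreal (B\<^sup>2) * ennreal (exp (- (2 * \<eta>) * \<bar>0 - x\<bar>))"
        by (simp add: a_def ennreal_power ennreal_mult[symmetric] del: ennreal_mult)
    qed
    also have "\<dots> < \<infinity>" using nn_integral_exp_abs[of "2 * \<eta>" 0] \<eta> by (subst nn_integral_cmult) (auto simp: ennreal_mult_less_top)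
    \<comment> \<open>Boundedness of \<open>w\<close> makes the weighted norm finite, so it is a
      real number \<open>r\<close> and half of it may be subtracted from both sides.\<close>
    finally obtain r where r: "0 \<le> r" "(\<integral>\<^sup>+x. (a \<eta> x)\<^sup>2 \<partial>lborel) = ennreal r"
      by (metis ennreal_cases infinity_ennreal_def less_irrefl)
    obtain p where p: "0 \<le> p" "\<Phi> = ennreal p" using \<Phi> by (metis ennreal_cases infinity_ennreal_def less_irrefl)
    have "ennreal r \<le> ennreal (2 * p + 1 / 2 * r)"
    proof -
      have "ennreal (2 * p + 1 / 2 * r) = ennreal (2 * p) + ennreal (1 / 2 * r)"
        using r p by (intro ennreal_plus) auto
      also have "ennreal (1 / 2 * r) = ennreal (1 / 2) * ennreal r" using r by (intro ennreal_mult) auto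
      also have "ennreal (2 * p) = 2 * ennreal p" using p by (simp add: ennreal_mult)
      finally show ?thesis using ineq r p by simp
    qed
    then have "r \<le> 4 * p" using r p by (subst (asm) ennreal_le_iff) auto
    then have "ennreal r \<le> ennreal (4 * p)" by (rule ennreal_leI)
    then show ?thesis using r p by (simp add: ennreal_mult)
  qed
  define \<eta> where "\<eta> n = (\<sigma> / 2) / real (Suc n)" for n
  have \<eta>: "0 < \<eta> n" "\<eta> n \<le> \<sigma> / 2" for n
    using \<sigma> by (auto simp: \<eta>_def divide_simps)
  have \<eta>0: "\<eta> \<longlonglongrightarrow> 0" unfolding \<eta>_def using LIMSEQ_Suc[OF lim_const_over_n] by blast
  have lim: "(\<lambda>n. (a (\<eta> n) x)\<^sup>2) \<longlonglongrightarrow> (ennreal (norm (w x)))\<^sup>2" for x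
  proof -
    have "(\<lambda>n. (exp (- \<eta> n * \<bar>x\<bar>) * norm (w x))\<^sup>2) \<longlonglongrightarrow> (exp (- 0 * \<bar>x\<bar>) * norm (w x))\<^sup>2"
      by (intro tendsto_intros \<eta>0)
    then have "(\<lambda>n. ennreal ((exp (- \<eta> n * \<bar>x\<bar>) * norm (w x))\<^sup>2)) \<longlonglongrightarrow> ennreal ((exp (- 0 * \<bar>x\<bar>) * norm (w x))\<^sup>2)"
      by (rule tendsto_ennrealI)
    then show ?thesis by (simp add: a_def ennreal_power)
  qed
  have "(\<integral>\<^sup>+x. (ennreal (norm (w x)))\<^sup>2 \<partial>lborel) = (\<integral>\<^sup>+x. liminf (\<lambda>n. (a (\<eta> n) x)\<^sup>2) \<partial>lborel)"
    by (intro nn_integral_cong lim_imp_Liminf[symmetric] lim trivial_limit_sequentially)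
  \<comment> \<open>Fatou's lemma removes the weight, since the bound \<open>4 * \<Phi>\<close> does
    not depend on \<open>n\<close>.\<close>
  also have "\<dots> \<le> liminf (\<lambda>n. (\<integral>\<^sup>+x. (a (\<eta> n) x)\<^sup>2 \<partial>lborel))"
    by (intro nn_integral_liminf) measurable
  also have "\<dots> \<le> liminf (\<lambda>n::nat. 4 * \<Phi>)" using main[OF \<eta>] by (intro Liminf_mono) auto
  also have "\<dots> = 4 * \<Phi>" by (simp add: Liminf_const)
  also have "\<dots> < \<infinity>" using \<Phi> by (simp add: ennreal_mult_less_top)
  finally show ?thesis by (simp add: sq_int_iff_nn)
qed

subsection \<open>Convolution with exponentially decaying kernels\<close>

lemma borel_measurable_continuous_pair:
  fixes F :: "real \<Rightarrow> 'a::euclidean_space \<Rightarrow> 'b::topological_space"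
  assumes "continuous_on UNIV (\<lambda>p. F (fst p) (snd p))"
    and "f \<in> borel_measurable M" "h \<in> borel_measurable M"
  shows "(\<lambda>y. F (f y) (h y)) \<in> borel_measurable M"
  using borel_measurable_continuous_Pair[OF assms(2,3), of F] assms(1) by (simp add: case_prod_beta')

text \<open>Operator-valued because of its two uses: the resolvent kernel, diagonal in suitable
  coordinates, and a scalar bump times the identity. A Lipschitz condition stands in for
  differentiability since the resolvent kernel has a corner at 0; it gives continuity of
  convolutions and later controls the discretisation.\<close>

locale exp_kernel =
  fixes G :: "real \<Rightarrow> 'a::euclidean_space \<Rightarrow> 'a" and C \<sigma> L :: real
  assumes lin: "linear (G x)"
    and bound: "norm (G x v) \<le> C * exp (- \<sigma> * \<bar>x\<bar>) * norm v"
    and lipschitz: "norm (G x v - G y v) \<le> L * \<bar>x - y\<bar> * norm v"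
    and \<sigma>_pos: "\<sigma> > 0" and C_nonneg: "C \<ge> 0" and L_nonneg: "L \<ge> 0"
begin

definition conv :: "(real \<Rightarrow> 'a) \<Rightarrow> real \<Rightarrow> 'a" where
  "conv h x = (LINT y|lborel. G (x - y) (h y))"

lemma continuous_G: "continuous_on UNIV (\<lambda>p. G (fst p) (snd p))"
proof (intro continuous_at_imp_continuous_on ballI)
  fix p :: "real \<times> 'a"
  obtain a b where p: "p = (a, b)" by fastforce
  have "((\<lambda>q. L * \<bar>fst q - a\<bar> * norm (snd q) + C * norm (snd q - b)) \<longlongrightarrow>
        L * \<bar>fst p - a\<bar> * norm (snd p) + C * norm (snd p - b)) (at p)"
    by (intro tendsto_intros)
  then have lim: "((\<lambda>q. L * \<bar>fst q - a\<bar> * norm (snd q) + C * norm (snd q - b)) \<longlongrightarrow> 0) (at p)"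
    by (simp add: p)
  have "norm (G (fst q) (snd q) - G a b) \<le> L * \<bar>fst q - a\<bar> * norm (snd q) + C * norm (snd q - b)" for q
  proof -
    have "G (fst q) (snd q) - G a b = (G (fst q) (snd q) - G a (snd q)) + G a (snd q - b)"
      by (simp add: linear_diff[OF lin])
    moreover have "norm (G a (snd q - b)) \<le> C * norm (snd q - b)"
    proof -
      have "C * exp (- \<sigma> * \<bar>a\<bar>) \<le> C" using C_nonneg \<sigma>_pos by (simp add: mult_left_le)
      then have "C * exp (- \<sigma> * \<bar>a\<bar>) * norm (snd q - b) \<le> C * norm (snd q - b)" by (rule mult_right_mono) simp
      then show ?thesis using bound[of a "snd q - b"] by linarith
    qed
    ultimately show ?thesis using lipschitz[of "fst q" "snd q" a] norm_triangle_ineq by smt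
  qed
  then have "((\<lambda>q. G (fst q) (snd q) - G a b) \<longlongrightarrow> 0) (at p)"
    by (intro Lim_null_comparison[OF _ lim] always_eventually allI)
  then show "isCont (\<lambda>q. G (fst q) (snd q)) p"
    unfolding isCont_def p by (simp add: LIM_zero_iff)
qed

lemma measurable_G [measurable (raw)]:
  assumes "f \<in> borel_measurable M" "h \<in> borel_measurable M"
  shows "(\<lambda>y. G (f y) (h y)) \<in> borel_measurable M"
  using borel_measurable_continuous_pair[OF continuous_G assms] .

lemma integrable_conv:
  assumes "exp_integrable \<sigma> h"
  shows "integrable lborel (\<lambda>y. G (x - y) (h y))"
proof (rule Bochner_Integration.integrable_bound)
  show "integrable lborel (\<lambda>y. C * (exp (- \<sigma> * \<bar>x - y\<bar>) * norm (h y)))"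
    using exp_integrable_translate[OF assms] \<sigma>_pos by simp
  have [measurable]: "h \<in> borel_measurable borel" using assms by (simp add: exp_integrable_def)
  show "(\<lambda>y. G (x - y) (h y)) \<in> borel_measurable lborel" by measurable
  show "AE y in lborel. norm (G (x - y) (h y)) \<le> norm (C * (exp (- \<sigma> * \<bar>x - y\<bar>) * norm (h y)))"
    using bound C_nonneg by (intro AE_I2) (simp add: abs_mult mult.assoc)
qed

lemma norm_conv_le:
  assumes "exp_integrable \<sigma> h"
  shows "norm (conv h x) \<le> C * (exp_conv \<sigma> h x)"
proof -
  have "norm (conv h x) \<le> (LINT y|lborel. norm (G (x - y) (h y)))"
    unfolding conv_def by (rule integral_norm_bound)
  also have "\<dots> \<le> (LINT y|lborel. C * (exp (- \<sigma> * \<bar>x - y\<bar>) * norm (h y)))"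
    using exp_integrable_translate[OF assms] \<sigma>_pos bound
    by (intro integral_mono integrable_norm integrable_conv assms integrable_mult_right) (auto simp: mult.assoc)
  finally show ?thesis by simp
qed

lemma continuous_conv:
  assumes h: "exp_integrable \<sigma> h"
  shows "continuous_on UNIV (conv h)"
proof (intro continuous_at_imp_continuous_on ballI)
  fix a :: real
  have [measurable]: "h \<in> borel_measurable borel" using h by (simp add: exp_integrable_def)
  show "isCont (conv h) a"
    unfolding continuous_at_sequentially
  proof (intro allI impI)
    fix X :: "nat \<Rightarrow> real" assume X: "X \<longlonglongrightarrow> a"
    obtain R where R: "\<And>n. \<bar>X n\<bar> \<le> R"
      using convergent_imp_Bseq[OF convergentI[OF X]] by (auto simp: Bseq_def)
    \<comment> \<open>One majorant for all \<open>n\<close>: a shift by at most \<open>R\<close>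
      costs the factor \<open>exp (\<sigma> * R)\<close>.\<close>
    let ?W = "\<lambda>y. C * exp (\<sigma> * R) * (exp (- \<sigma> * \<bar>y\<bar>) * norm (h y))"
    show "(conv h \<circ> X) \<longlonglongrightarrow> conv h a"
      unfolding o_def conv_def
    proof (rule integral_dominated_convergence[where w = ?W])
      show "integrable lborel ?W" using h by (simp add: exp_integrable_def)
      show "AE y in lborel. (\<lambda>n. G (X n - y) (h y)) \<longlonglongrightarrow> G (a - y) (h y)"
      proof (rule AE_I2)
        fix y
        have "(\<lambda>n. (X n - y, h y)) \<longlonglongrightarrow> (a - y, h y)" by (intro tendsto_intros X)
        moreover have "isCont (\<lambda>p. G (fst p) (snd p)) (a - y, h y)"
          using continuous_G by (simp add: continuous_on_eq_continuous_at)
        ultimately show "(\<lambda>n. G (X n - y) (h y)) \<longlonglongrightarrow> G (a - y) (h y)"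
          using isCont_tendsto_compose by fastforce
      qed
      show "AE y in lborel. norm (G (X n - y) (h y)) \<le> ?W y" for n
      proof (rule AE_I2)
        fix y
        have "- \<sigma> * \<bar>X n - y\<bar> \<le> \<sigma> * R + - \<sigma> * \<bar>y\<bar>"
          using mult_left_mono[OF _ less_imp_le[OF \<sigma>_pos], of "\<bar>y\<bar>" "\<bar>X n - y\<bar> + R"] R[of n]
          by (simp add: algebra_simps)
        then have "exp (- \<sigma> * \<bar>X n - y\<bar>) \<le> exp (\<sigma> * R) * exp (- \<sigma> * \<bar>y\<bar>)" by (simp add: exp_add[symmetric])
        then have "C * exp (- \<sigma> * \<bar>X n - y\<bar>) * norm (h y) \<le> C * (exp (\<sigma> * R) * exp (- \<sigma> * \<bar>y\<bar>)) * norm (h y)"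
          using C_nonneg by (intro mult_right_mono mult_left_mono) auto
        then show "norm (G (X n - y) (h y)) \<le> ?W y"
          using bound[of "X n - y" "h y"] by (simp add: mult.assoc)
      qed
    qed measurable
  qed
qed

lemma sq_int_conv:
  assumes "sq_int h"
  shows "sq_int (conv h)"
proof (rule sq_int_exp_kernel_bound[OF assms \<sigma>_pos])
  have h: "exp_integrable \<sigma> h" using exp_integrable_sq_int[OF assms \<sigma>_pos] by simp
  show "conv h \<in> borel_measurable borel" using continuous_conv[OF h] by (rule borel_measurable_continuous_onI)
  show "norm (conv h x) \<le> C * (exp_conv \<sigma> h x)" for x
    by (rule norm_conv_le[OF h])
qed

lemma bounded_conv_sq_int:
  assumes "sq_int h"
  shows "bounded (range (conv h))"
proof -
  have h: "exp_integrable \<sigma> h" using exp_integrable_sq_int[OF assms \<sigma>_pos] by simp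
  have "norm (conv h x) \<le> C * (1 / \<sigma> + (LINT y|lborel. (norm (h y))\<^sup>2))" for x
    using norm_conv_le[OF h, of x] mult_left_mono[OF exp_integrable_sq_int(2)[OF assms \<sigma>_pos] C_nonneg, of x]
    by linarith
  then show ?thesis by (auto simp: bounded_iff)
qed

lemma norm_conv_bounded:
  assumes "h \<in> borel_measurable borel" "\<And>y. norm (h y) \<le> B"
  shows "norm (conv h x) \<le> C * (B * (2 / \<sigma>))"
  using norm_conv_le[OF exp_integrable_bounded(1)[OF assms \<sigma>_pos], of x]
    mult_left_mono[OF exp_integrable_bounded(2)[OF assms \<sigma>_pos] C_nonneg, of x] by linarith

lemma conv_add:
  assumes "exp_integrable \<sigma> h" "exp_integrable \<sigma> k"
  shows "conv (\<lambda>y. h y + k y) x = conv h x + conv k x"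
  unfolding conv_def linear_add[OF lin] by (intro Bochner_Integration.integral_add integrable_conv assms)

lemma conv_scaleR: "conv (\<lambda>y. r *\<^sub>R h y) x = r *\<^sub>R conv h x"
  unfolding conv_def linear_scale[OF lin] by simp

lemma conv_cong_AE:
  assumes "AE y in lborel. h y = k y" "h \<in> borel_measurable borel" "k \<in> borel_measurable borel"
  shows "conv h x = conv k x"
  unfolding conv_def using assms by (intro integral_cong_AE) auto

end

text \<open>A multiplication operator vanishing at infinity; \<open>h \<mapsto> conv (\<lambda>y. P y (h y))\<close> is then a
  compact operator on bounded continuous functions.\<close>

locale exp_kernel_potential = exp_kernel +
  fixes P :: "real \<Rightarrow> 'a \<Rightarrow> 'a" and K :: real
  assumes lin_P: "linear (P y)"
    and continuous_P: "continuous_on UNIV (\<lambda>p. P (fst p) (snd p))"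
    and bound_P: "norm (P y v) \<le> K * norm v"
    and decay_P: "\<kappa> > 0 \<Longrightarrow> \<exists>R. \<forall>y v. R < \<bar>y\<bar> \<longrightarrow> norm (P y v) \<le> \<kappa> * norm v"
begin

lemma measurable_P [measurable (raw)]:
  assumes "f \<in> borel_measurable M" "h \<in> borel_measurable M"
  shows "(\<lambda>y. P (f y) (h y)) \<in> borel_measurable M"
  using borel_measurable_continuous_pair[OF continuous_P assms] .

lemma K_nonneg: "K \<ge> 0"
proof -
  obtain b :: 'a where "b \<in> Basis" by (rule SOME_Basis[THEN that])
  then show ?thesis using order_trans[OF norm_ge_zero bound_P[of _ b]] by simp
qed

text \<open>Where \<open>P\<close> is not small, on a compact interval, its contribution is bounded
  with compact support and joins the square integrable data. Elsewhere \<open>P\<close> has norm at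
  most \<kappa>, and the self-bound criterion absorbs it.\<close>

lemma sq_int_of_fixed_point:
  assumes [measurable]: "w \<in> borel_measurable borel" and B: "\<And>x. norm (w x) \<le> B"
    and w0: "sq_int w0" and eq: "\<And>x. w x = w0 x + conv (\<lambda>y. P y (w y)) x"
  shows "sq_int w"
proof -
  \<comment> \<open>Makes \<open>C * \<kappa> * (4 / \<sigma>)\<close> equal to
    \<open>C / (2 * (C + 1))\<close>, which is below \<open>1 / 2\<close>; adding 1 avoids division
    by zero when \<open>C = 0\<close>.\<close>
  define \<kappa> where "\<kappa> = \<sigma> / (8 * (C + 1))"
  have \<kappa>: "\<kappa> > 0" using \<sigma>_pos C_nonneg by (simp add: \<kappa>_def)
  obtain R where R: "\<And>y v. R < \<bar>y\<bar> \<Longrightarrow> norm (P y v) \<le> \<kappa> * norm v" using decay_P[OF \<kappa>] by blast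
  have B0: "0 \<le> B" using order_trans[OF norm_ge_zero B] .
  define h where "h y = indicator {-R..R} y *\<^sub>R (K *\<^sub>R w y)" for y
  have [measurable]: "h \<in> borel_measurable borel" unfolding h_def by measurable
  have h: "exp_integrable \<sigma> h"
    by (rule exp_integrable_bounded[where B = "K * B"])
      (use \<sigma>_pos B B0 K_nonneg in \<open>auto simp: h_def indicator_def intro: mult_left_mono\<close>)
  have "sq_int h"
  proof -
    have "integrable lborel (\<lambda>y. indicator {-R..R} y *\<^sub>R (K * B)\<^sup>2)"
      by (intro integrable_real_indicator integrable_scaleR_left) (auto simp: emeasure_lborel_Icc_eq)
    then have "integrable lborel (\<lambda>y. (norm (h y))\<^sup>2)"
      by (rule Bochner_Integration.integrable_bound)
        (use B B0 K_nonneg in \<open>auto simp: h_def indicator_def intro!: AE_I2 power_mono mult_left_mono\<close>)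
    then show ?thesis by (simp add: sq_int_def)
  qed
  define \<psi> where "\<psi> x = C * (exp_conv \<sigma> h x)" for x
  have \<psi>0: "0 \<le> \<psi> x" for x using C_nonneg by (simp add: \<psi>_def)
  have [measurable]: "\<psi> \<in> borel_measurable borel" unfolding \<psi>_def by measurable
  have \<psi>: "sq_int \<psi>"
    by (rule sq_int_exp_kernel_bound[OF \<open>sq_int h\<close> \<sigma>_pos, of _ C])
      (use \<psi>0 in \<open>auto simp: \<psi>_def\<close>)
  define \<phi> where "\<phi> x = norm (w0 x) + \<psi> x" for x
  have \<phi>: "sq_int \<phi>" unfolding \<phi>_def
  proof (intro sq_int_add \<psi>)
    show "sq_int (\<lambda>x. norm (w0 x))" using w0 by (auto simp: sq_int_def)
  qed
  have Pw: "exp_integrable \<sigma> (\<lambda>y. P y (w y))"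
    by (rule exp_integrable_bounded[where B = "K * B"])
      (use \<sigma>_pos in \<open>auto intro: order_trans[OF bound_P mult_left_mono[OF B K_nonneg]]\<close>)
  have iw: "exp_integrable \<sigma> w" using B \<sigma>_pos by (intro exp_integrable_bounded) auto
  show ?thesis
  proof (rule sq_int_of_exp_kernel_self_bound[OF _ B \<phi> \<sigma>_pos, where \<kappa> = "C * \<kappa>"])
    show "0 \<le> C * \<kappa>" using \<kappa> C_nonneg by simp
    show "C * \<kappa> * (4 / \<sigma>) \<le> 1 / 2" using \<sigma>_pos C_nonneg by (simp add: \<kappa>_def field_simps)
    fix x
    have PR: "norm (P y (w y)) \<le> norm (h y) + \<kappa> * norm (w y)" for y
    proof (cases "\<bar>y\<bar> \<le> R")
      case True
      then show ?thesis using bound_P[of y "w y"] K_nonneg \<kappa> by (simp add: h_def indicator_def abs_le_iff add_increasing2)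
    next
      case False
      then show ?thesis using R[of y "w y"] by (simp add: add_increasing)
    qed
    have "(LINT y|lborel. exp (- \<sigma> * \<bar>x - y\<bar>) * norm (P y (w y)))
        \<le> (LINT y|lborel. exp (- \<sigma> * \<bar>x - y\<bar>) * norm (h y) + \<kappa> * (exp (- \<sigma> * \<bar>x - y\<bar>) * norm (w y)))"
    proof (rule integral_mono)
      fix y
      show "exp (- \<sigma> * \<bar>x - y\<bar>) * norm (P y (w y)) \<le> exp (- \<sigma> * \<bar>x - y\<bar>) * norm (h y) + \<kappa> * (exp (- \<sigma> * \<bar>x - y\<bar>) * norm (w y))"
        using mult_left_mono[OF PR, of "exp (- \<sigma> * \<bar>x - y\<bar>)"] by (simp add: algebra_simps)
    qed (use \<sigma>_pos exp_integrable_translate[OF h] exp_integrable_translate[OF Pw] exp_integrable_translate[OF iw] in auto)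
    also have "\<dots> = (exp_conv \<sigma> h x) + \<kappa> * (exp_conv \<sigma> w x)"
      using \<sigma>_pos exp_integrable_translate[OF h, of x] exp_integrable_translate[OF iw, of x]
      by (subst Bochner_Integration.integral_add) auto
    finally have "norm (conv (\<lambda>y. P y (w y)) x) \<le> \<psi> x + C * \<kappa> * (exp_conv \<sigma> w x)"
      using norm_conv_le[OF Pw, of x] mult_left_mono[OF _ C_nonneg] unfolding \<psi>_def
      by (smt (verit) distrib_left mult.assoc)
    moreover have "norm (w x) \<le> norm (w0 x) + norm (conv (\<lambda>y. P y (w y)) x)"
      using eq[of x] norm_triangle_ineq by metis
    ultimately show "norm (w x) \<le> norm (\<phi> x) + C * \<kappa> * (exp_conv \<sigma> w x)"
      using \<psi>0[of x] by (simp add: \<phi>_def)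
  qed measurable
qed

end

text \<open>Completeness in the uniform norm is what lets the contraction argument run on bounded
  continuous functions.\<close>

instance bcontfun :: (metric_space, banach) banach ..

context exp_kernel_potential
begin

lemma exp_integrable_P:
  assumes "w \<in> borel_measurable borel" "\<And>x. norm (w x) \<le> B"
  shows "exp_integrable \<sigma> (\<lambda>y. P y (w y))"
  by (rule exp_integrable_bounded[where B = "K * B"])
    (use \<sigma>_pos assms in \<open>auto intro: order_trans[OF bound_P mult_left_mono[OF assms(2) K_nonneg]]\<close>)

text \<open>Off a compact interval \<open>P\<close> is small, and on it replacing \<open>y\<close> by \<open>\<lfloor>m * y\<rfloor> / m\<close> in the kernel leaves
  a finite-rank operator.\<close>

lemma conv_P_diff_finite_rank_le:
  fixes R \<kappa> B :: real and m :: nat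
  assumes R: "\<And>y v. R < \<bar>y\<bar> \<Longrightarrow> norm (P y v) \<le> \<kappa> * norm v"
    and "0 \<le> R" "0 < m" "0 \<le> \<kappa>"
    and [measurable]: "w \<in> borel_measurable borel" and B: "\<And>x. norm (w x) \<le> B"
  defines "A \<equiv> \<lambda>j. {y. \<lfloor>m * y\<rfloor> = j \<and> \<bar>y\<bar> \<le> R}"
  shows "norm (conv (\<lambda>y. P y (w y)) x -
      (\<Sum>j\<in>{\<lfloor>- (m * R)\<rfloor>..\<lfloor>m * R\<rfloor>}. G (x - j / m) (LINT y|lborel. indicator (A j) y *\<^sub>R P y (w y))))
    \<le> (2 * R * (L / m * K) + C * \<kappa> * (2 / \<sigma>)) * B"
proof -
  let ?J = "{\<lfloor>- (m * R)\<rfloor>..\<lfloor>m * R\<rfloor>}"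
  have B0: "0 \<le> B" using order_trans[OF norm_ge_zero B] .
  have Pw: "exp_integrable \<sigma> (\<lambda>y. P y (w y))" by (rule exp_integrable_P) (use B in auto)
  have [measurable]: "A j \<in> sets borel" for j unfolding A_def by measurable
  have PwB: "norm (P y (w y)) \<le> K * B" for y
    using order_trans[OF bound_P mult_left_mono[OF B K_nonneg]] .
  have iA: "integrable lborel (\<lambda>y. indicator (A j) y *\<^sub>R P y (w y))" for j
  proof (rule Bochner_Integration.integrable_bound)
    show "integrable lborel (\<lambda>y. indicator {-R..R} y *\<^sub>R (K * B))"
      by (intro integrable_real_indicator integrable_scaleR_left) (auto simp: emeasure_lborel_Icc_eq)
    show "AE y in lborel. norm (indicator (A j) y *\<^sub>R P y (w y)) \<le> norm (indicator {-R..R} y *\<^sub>R (K * B))"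
      using PwB B0 K_nonneg by (intro AE_I2) (auto simp: indicator_def A_def)
  qed measurable
  have blG: "bounded_linear (G z)" for z using lin by (simp add: linear_conv_bounded_linear)
  have G_int: "G z (LINT y|lborel. indicator (A j) y *\<^sub>R P y (w y)) = (LINT y|lborel. indicator (A j) y *\<^sub>R G z (P y (w y)))" for z j
    using integral_bounded_linear[OF blG iA, symmetric] by (simp add: linear_scale[OF lin])
  have iGA: "integrable lborel (\<lambda>y. indicator (A j) y *\<^sub>R G z (P y (w y)))" for z j
    using integrable_bounded_linear[OF blG iA] by (simp add: linear_scale[OF lin])
  have eq: "conv (\<lambda>y. P y (w y)) x -
      (\<Sum>j\<in>?J. G (x - j / m) (LINT y|lborel. indicator (A j) y *\<^sub>R P y (w y))) =
     (LINT y|lborel. G (x - y) (P y (w y)) - (\<Sum>j\<in>?J. indicator (A j) y *\<^sub>R G (x - j / m) (P y (w y))))"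
    unfolding conv_def G_int
    by (simp only: Bochner_Integration.integral_diff[OF integrable_conv[OF Pw] Bochner_Integration.integrable_sum[OF iGA]]
        Bochner_Integration.integral_sum[OF iGA])
  \<comment> \<open>The first summand is the rounding error \<open>L / m\<close> times the size of
    \<open>P y (w y)\<close> on the interval of length \<open>2 * R\<close>; the second covers the
    outside, where no cell is active and \<open>P\<close> is small.\<close>
  have "norm (LINT y|lborel. G (x - y) (P y (w y)) - (\<Sum>j\<in>?J. indicator (A j) y *\<^sub>R G (x - j / m) (P y (w y))))
      \<le> (LINT y|lborel. indicator {-R..R} y *\<^sub>R (L / m * K * B) + C * exp (- \<sigma> * \<bar>x - y\<bar>) * (\<kappa> * B))"
  proof (rule order_trans[OF integral_norm_bound integral_mono])
    show "integrable lborel (\<lambda>y. norm (G (x - y) (P y (w y)) - (\<Sum>j\<in>?J. indicator (A j) y *\<^sub>R G (x - j / m) (P y (w y)))))"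
      by (intro integrable_norm Bochner_Integration.integrable_diff integrable_conv[OF Pw] Bochner_Integration.integrable_sum iGA)
    show "integrable lborel (\<lambda>y. indicator {-R..R} y *\<^sub>R (L / m * K * B) + C * exp (- \<sigma> * \<bar>x - y\<bar>) * (\<kappa> * B))"
      by (intro Bochner_Integration.integrable_add integrable_scaleR_left integrable_real_indicator
          integrable_mult_left integrable_mult_right integrable_exp_abs \<sigma>_pos) (auto simp: emeasure_lborel_Icc_eq)
    fix y
    show "norm (G (x - y) (P y (w y)) - (\<Sum>j\<in>?J. indicator (A j) y *\<^sub>R G (x - j / m) (P y (w y))))
        \<le> indicator {-R..R} y *\<^sub>R (L / m * K * B) + C * exp (- \<sigma> * \<bar>x - y\<bar>) * (\<kappa> * B)"
    proof (cases "\<bar>y\<bar> \<le> R")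
      case True
      have J: "\<lfloor>m * y\<rfloor> \<in> ?J"
        using True mult_left_mono[of y R "real m"] mult_left_mono[of "- R" y "real m"] by (auto intro!: floor_mono)
      \<comment> \<open>Exactly one cell contains \<open>y\<close>, so the sum collapses to the
        kernel taken at the grid point at or just below \<open>y\<close>.\<close>
      have "(\<Sum>j\<in>?J. indicator (A j) y *\<^sub>R G (x - j / m) (P y (w y))) =
            (\<Sum>j\<in>?J. if j = \<lfloor>m * y\<rfloor> then G (x - j / m) (P y (w y)) else 0)"
        using True by (intro sum.cong) (auto simp: A_def indicator_def)
      also have "\<dots> = G (x - \<lfloor>m * y\<rfloor> / m) (P y (w y))" using J by simp
      finally have "norm (G (x - y) (P y (w y)) - (\<Sum>j\<in>?J. indicator (A j) y *\<^sub>R G (x - j / m) (P y (w y))))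
          \<le> L * \<bar>(x - y) - (x - \<lfloor>m * y\<rfloor> / m)\<bar> * norm (P y (w y))"
        by (simp only: lipschitz)
      also have "\<dots> \<le> L * (1 / m) * (K * B)"
      proof (intro mult_mono mult_left_mono PwB L_nonneg)
        have "0 \<le> m * y - \<lfloor>m * y\<rfloor>" "m * y - \<lfloor>m * y\<rfloor> \<le> 1" by linarith+
        then have "0 \<le> (m * y - \<lfloor>m * y\<rfloor>) / m" "(m * y - \<lfloor>m * y\<rfloor>) / m \<le> 1 / m"
          using \<open>0 < m\<close> by (auto simp: divide_right_mono)
        moreover have "(m * y - \<lfloor>m * y\<rfloor>) / m = y - \<lfloor>m * y\<rfloor> / m" using \<open>0 < m\<close> by (simp add: field_simps)
        ultimately show "\<bar>(x - y) - (x - \<lfloor>m * y\<rfloor> / m)\<bar> \<le> 1 / m" by simp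
      qed (use L_nonneg in auto)
      also have "\<dots> \<le> indicator {-R..R} y *\<^sub>R (L / m * K * B) + C * exp (- \<sigma> * \<bar>x - y\<bar>) * (\<kappa> * B)"
        using True C_nonneg \<open>0 \<le> \<kappa>\<close> B0 by (simp add: abs_le_iff mult.assoc)
      finally show ?thesis .
    next
      case False
      then have "(\<Sum>j\<in>?J. indicator (A j) y *\<^sub>R G (x - j / m) (P y (w y))) = 0"
        by (intro sum.neutral) (auto simp: A_def)
      then have "norm (G (x - y) (P y (w y)) - (\<Sum>j\<in>?J. indicator (A j) y *\<^sub>R G (x - j / m) (P y (w y))))
          \<le> C * exp (- \<sigma> * \<bar>x - y\<bar>) * norm (P y (w y))" using bound by simp
      also have "C * exp (- \<sigma> * \<bar>x - y\<bar>) * norm (P y (w y)) \<le> C * exp (- \<sigma> * \<bar>x - y\<bar>) * (\<kappa> * B)"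
        using False R[of y "w y"] mult_left_mono[OF B \<open>0 \<le> \<kappa>\<close>, of y] C_nonneg by (intro mult_left_mono) auto
      finally have "norm (G (x - y) (P y (w y)) - (\<Sum>j\<in>?J. indicator (A j) y *\<^sub>R G (x - j / m) (P y (w y))))
          \<le> C * exp (- \<sigma> * \<bar>x - y\<bar>) * (\<kappa> * B)" .
      moreover have "indicator {-R..R} y = (0::real)" using False by (simp add: indicator_def abs_le_iff) argo
      ultimately show ?thesis by (simp only: scaleR_zero_left add_0)
    qed
  qed
  also have "\<dots> = (2 * R * (L / m * K) + C * \<kappa> * (2 / \<sigma>)) * B"
  proof -
    have 1: "(LINT y|lborel. C * exp (- \<sigma> * \<bar>x - y\<bar>) * (\<kappa> * B)) = C * (2 / \<sigma>) * (\<kappa> * B)"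
    proof -
      have "(LINT y|lborel. C * exp (- \<sigma> * \<bar>x - y\<bar>) * (\<kappa> * B)) = (LINT y|lborel. (C * (\<kappa> * B)) * exp (- \<sigma> * \<bar>x - y\<bar>))"
        by (rule Bochner_Integration.integral_cong[OF refl]) (simp only: ac_simps)
      also have "\<dots> = (C * (\<kappa> * B)) * (2 / \<sigma>)"
        by (subst integral_mult_right_zero) (simp only: integral_exp_abs[OF \<sigma>_pos])
      finally show ?thesis by (simp only: ac_simps)
    qed
    have 2: "(LINT y|lborel. indicator {-R..R} y *\<^sub>R (L / m * K * B)) = 2 * R * (L / m * K * B)"
      using \<open>0 \<le> R\<close> by simp
    have "(LINT y|lborel. indicator {-R..R} y *\<^sub>R (L / m * K * B) + C * exp (- \<sigma> * \<bar>x - y\<bar>) * (\<kappa> * B)) =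
        2 * R * (L / m * K * B) + C * (2 / \<sigma>) * (\<kappa> * B)"
      unfolding 1[symmetric] 2[symmetric]
      by (intro Bochner_Integration.integral_add integrable_scaleR_left integrable_real_indicator
          integrable_mult_left integrable_mult_right integrable_exp_abs \<sigma>_pos) (auto simp: emeasure_lborel_Icc_eq)
    also have "\<dots> = (2 * R * (L / m * K) + C * \<kappa> * (2 / \<sigma>)) * B" by (simp add: algebra_simps)
    finally show ?thesis .
  qed
  finally show ?thesis unfolding eq .
qed

text \<open>The abstract alternative for \<open>T w = conv (P w)\<close>. Its finite-rank part
  \<open>F\<close> takes values in the span of the finitely many functions
  \<open>x \<mapsto> G (x - j / m) e\<close> with \<open>e\<close> a basis vector, and
  \<open>T - F\<close> is the discretisation error just estimated.\<close>

lemma fredholm_alternative_bounded_continuous: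
  assumes inj: "\<And>w. continuous_on UNIV w \<Longrightarrow> bounded (range w) \<Longrightarrow> (\<And>x. w x = conv (\<lambda>y. P y (w y)) x) \<Longrightarrow> w = (\<lambda>_. 0)"
    and w0: "continuous_on UNIV w0" "bounded (range w0)"
  shows "\<exists>w. continuous_on UNIV w \<and> bounded (range w) \<and> (\<forall>x. w x = w0 x + conv (\<lambda>y. P y (w y)) x)"
proof -
  define \<kappa> where "\<kappa> = \<sigma> / (8 * (C + 1))"
  have \<kappa>: "\<kappa> > 0" using \<sigma>_pos C_nonneg by (simp add: \<kappa>_def)
  obtain R' where R': "\<And>y v. R' < \<bar>y\<bar> \<Longrightarrow> norm (P y v) \<le> \<kappa> * norm v" using decay_P[OF \<kappa>] by blast
  define R where "R = max R' 0"
  have R: "\<And>y v. R < \<bar>y\<bar> \<Longrightarrow> norm (P y v) \<le> \<kappa> * norm v" "0 \<le> R" using R' by (auto simp: R_def)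
  \<comment> \<open>A grid fine enough for \<open>2 * R * (L / m * K) \<le> 1 / 4\<close>; the
    choice of \<kappa> does the same for the tail, so \<open>q \<le> 1 / 2\<close>.\<close>
  obtain m' :: nat where m': "8 * R * L * K < real m'" using reals_Archimedean2 by blast
  define m where "m = Suc m'"
  have m: "0 < m" "8 * R * L * K \<le> m" using m' by (auto simp: m_def)
  define q where "q = 2 * R * (L / m * K) + C * \<kappa> * (2 / \<sigma>)"
  have "2 * R * (L / m * K) \<le> 1 / 4" using m by (simp add: field_simps)
  moreover have "C * \<kappa> * (2 / \<sigma>) \<le> 1 / 4" using C_nonneg \<sigma>_pos by (simp add: \<kappa>_def field_simps)
  ultimately have q: "q < 1" by (simp add: q_def)
  define A where "A j = {y::real. \<lfloor>m * y\<rfloor> = j \<and> \<bar>y\<bar> \<le> R}" for j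
  have [measurable]: "A j \<in> sets borel" for j unfolding A_def by measurable
  define J where "J = {\<lfloor>- (m * R)\<rfloor>..\<lfloor>m * R\<rfloor>}"
  have mw [measurable]: "apply_bcontfun w \<in> borel_measurable borel" for w :: "real \<Rightarrow>\<^sub>C 'a"
    by (intro borel_measurable_continuous_onI) auto
  have PwB: "norm (P y (apply_bcontfun w y)) \<le> K * norm w" for y w
    using order_trans[OF bound_P mult_left_mono[OF norm_bounded K_nonneg]] .
  have eP: "exp_integrable \<sigma> (\<lambda>y. P y (apply_bcontfun w y))" for w
    by (rule exp_integrable_P[OF _ norm_bounded]) measurable
  define T where "T w = Bcontfun (conv (\<lambda>y. P y (apply_bcontfun w y)))" for w :: "real \<Rightarrow>\<^sub>C 'a"
  have T: "apply_bcontfun (T w) = conv (\<lambda>y. P y (apply_bcontfun w y))" for w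
    unfolding T_def
    by (intro Bcontfun_inverse bcontfun_normI[OF continuous_conv[OF eP] norm_conv_bounded[OF _ PwB]]) measurable
  have linT: "linear T"
    by (intro linearI bcontfun_eqI)
      (auto simp: T linear_add[OF lin_P] linear_scale[OF lin_P] conv_add[OF eP eP] conv_scaleR)
  define g where "g j v = Bcontfun (\<lambda>x. G (x - real_of_int j / m) v)" for j v
  have g: "apply_bcontfun (g j v) = (\<lambda>x. G (x - real_of_int j / m) v)" for j v
    unfolding g_def
  proof (intro Bcontfun_inverse bcontfun_normI)
    show "continuous_on UNIV (\<lambda>x. G (x - real_of_int j / m) v)"
      by (rule continuous_on_compose2[OF continuous_G, of UNIV "\<lambda>x. (x - real_of_int j / m, v)", simplified])
        (intro continuous_intros)
    show "norm (G (x - real_of_int j / m) v) \<le> C * norm v" for x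
    proof (rule order_trans[OF bound])
      show "C * exp (- \<sigma> * \<bar>x - real_of_int j / m\<bar>) * norm v \<le> C * norm v"
        using C_nonneg \<sigma>_pos by (intro mult_right_mono) (auto simp: mult_left_le)
    qed
  qed
  have ling: "linear (g j)" for j
    by (intro linearI bcontfun_eqI) (auto simp: g linear_add[OF lin] linear_scale[OF lin])
  define c where "c j w = (LINT y|lborel. indicator (A j) y *\<^sub>R P y (apply_bcontfun w y))" for j w
  have iA: "integrable lborel (\<lambda>y. indicator (A j) y *\<^sub>R P y (apply_bcontfun w y))" for j w
  proof (rule Bochner_Integration.integrable_bound)
    show "integrable lborel (\<lambda>y. indicator {-R..R} y *\<^sub>R (K * norm w))"
      by (intro integrable_real_indicator integrable_scaleR_left) (auto simp: emeasure_lborel_Icc_eq)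
    show "AE y in lborel. norm (indicator (A j) y *\<^sub>R P y (apply_bcontfun w y)) \<le> norm (indicator {-R..R} y *\<^sub>R (K * norm w))"
      using PwB K_nonneg by (intro AE_I2) (auto simp: indicator_def A_def abs_mult)
  qed measurable
  have linc: "linear (c j)" for j
  proof (rule linearI)
    fix v w :: "real \<Rightarrow>\<^sub>C 'a" and r :: real
    show "c j (v + w) = c j v + c j w"
      by (simp add: c_def linear_add[OF lin_P] scaleR_add_right Bochner_Integration.integral_add[OF iA iA])
    have "indicator (A j) y *\<^sub>R P y (apply_bcontfun (r *\<^sub>R w) y) = r *\<^sub>R (indicator (A j) y *\<^sub>R P y (apply_bcontfun w y))" for y
      by (simp add: linear_scale[OF lin_P] mult.commute)
    then show "c j (r *\<^sub>R w) = r *\<^sub>R c j w" by (simp only: c_def integral_scaleR_right)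
  qed
  define F where "F w = (\<Sum>j\<in>J. g j (c j w))" for w
  have linF: "linear F" unfolding F_def
    using linear_compose[OF linc ling] by (intro linear_compose_sum) (auto simp: o_def)
  define S where "S = (\<Union>j\<in>J. g j ` Basis)"
  have "g j v \<in> span S" if "j \<in> J" for j v
  proof -
    have "g j v \<in> g j ` span Basis" by simp
    also have "\<dots> = span (g j ` Basis)" using linear_span_image[OF ling] by auto
    also have "\<dots> \<subseteq> span S" using that by (intro span_mono) (auto simp: S_def)
    finally show ?thesis .
  qed
  then have rangeF: "range F \<subseteq> span S" by (auto simp: F_def intro: span_sum)
  have finS: "finite S" by (auto simp: S_def J_def)
  have contr: "norm (T w - F w) \<le> q * norm w" for w
  proof (rule norm_bound)
    fix x
    have "apply_bcontfun (T w - F w) x = conv (\<lambda>y. P y (apply_bcontfun w y)) x - (\<Sum>j\<in>J. G (x - real_of_int j / m) (c j w))"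
    proof -
      have "apply_bcontfun (\<Sum>j\<in>J'. g j (c j w)) x = (\<Sum>j\<in>J'. G (x - real_of_int j / m) (c j w))" if "finite J'" for J'
        using that by (induction J') (auto simp: g)
      then show ?thesis by (simp add: T F_def J_def)
    qed
    then show "norm (apply_bcontfun (T w - F w) x) \<le> q * norm w"
      using conv_P_diff_finite_rank_le[OF R m(1) less_imp_le[OF \<kappa>] mw norm_bounded, of w x]
      unfolding c_def A_def J_def q_def by simp
  qed
  have injT: "w = 0" if "w = T w" for w
  proof (intro bcontfun_eqI)
    have "apply_bcontfun w = (\<lambda>_. 0)"
    proof (rule inj)
      show "apply_bcontfun w x = conv (\<lambda>y. P y (apply_bcontfun w y)) x" for x
        using that T by metis
    qed auto
    then show "apply_bcontfun w x = apply_bcontfun 0 x" for x by simp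
  qed
  obtain w0' where w0': "w0 = apply_bcontfun w0'" using w0 by (auto simp: bcontfun_def elim: bcontfunE[rotated])
  have "\<exists>w. w = w0' + T w"
    by (rule surj_of_inj_contraction_plus_finite_rank[OF linT linF finS rangeF q]) (fact contr, fact injT)
  then obtain w where "w = w0' + T w" by blast
  then have "apply_bcontfun w x = w0 x + conv (\<lambda>y. P y (apply_bcontfun w y)) x" for x
    using T w0' by (metis plus_bcontfun.rep_eq)
  then show ?thesis
    by (intro exI[of _ "apply_bcontfun w"] conjI continuous_on_apply_bcontfun bounded_apply_bcontfun allI)
qed

end

subsection \<open>Diagonalising coordinates and the resolvent kernel\<close>

text \<open>A matrix with rows \<open>(a, - b)\<close> and \<open>(b, a)\<close> multiplies the coordinates \<open>v\<^sub>1 + \<i> v\<^sub>2\<close> and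
  \<open>v\<^sub>1 - \<i> v\<^sub>2\<close> by \<open>a + \<i> b\<close> and \<open>a - \<i> b\<close>.\<close>

definition zplus :: "complex^2 \<Rightarrow> complex" where "zplus v = v $ 1 + \<i> * v $ 2"
definition zminus :: "complex^2 \<Rightarrow> complex" where "zminus v = v $ 1 - \<i> * v $ 2"
definition of_zpm :: "complex \<Rightarrow> complex \<Rightarrow> complex^2" where "of_zpm a b = vector [(a + b) / 2, (a - b) / (2 * \<i>)]"
definition diag_op :: "complex \<Rightarrow> complex \<Rightarrow> complex^2 \<Rightarrow> complex^2" where "diag_op c d v = of_zpm (c * zplus v) (d * zminus v)"

lemma zplus_of_zpm [simp]: "zplus (of_zpm a b) = a" and zminus_of_zpm [simp]: "zminus (of_zpm a b) = b"
  by (simp_all add: zplus_def zminus_def of_zpm_def field_simps)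

lemma of_zpm_zplus_zminus [simp]: "of_zpm (zplus v) (zminus v) = v"
  by (simp add: zplus_def zminus_def of_zpm_def vec_eq_iff forall_2)

lemma vec2_eqI: "zplus v = zplus w \<Longrightarrow> zminus v = zminus w \<Longrightarrow> v = w"
  by (metis of_zpm_zplus_zminus)

lemma vec2_eq_iff: "v = w \<longleftrightarrow> zplus v = zplus w \<and> zminus v = zminus w"
  using vec2_eqI by blast

lemma zplus_diag_op [simp]: "zplus (diag_op c d v) = c * zplus v" and zminus_diag_op [simp]: "zminus (diag_op c d v) = d * zminus v"
  by (simp_all add: diag_op_def)

lemma linear_zplus: "linear zplus" and linear_zminus: "linear zminus"
  by (intro linearI; simp add: zplus_def zminus_def algebra_simps)+

lemma bounded_linear_zplus: "bounded_linear zplus" and bounded_linear_zminus: "bounded_linear zminus"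
  using linear_zplus linear_zminus by (simp_all add: linear_conv_bounded_linear)

lemmas zplus_simps [simp] = linear_add[OF linear_zplus] linear_diff[OF linear_zplus] linear_neg[OF linear_zplus] linear_0[OF linear_zplus]
  linear_scale[OF linear_zplus]
lemmas zminus_simps [simp] = linear_add[OF linear_zminus] linear_diff[OF linear_zminus] linear_neg[OF linear_zminus] linear_0[OF linear_zminus]
  linear_scale[OF linear_zminus]

lemma zplus_smult [simp]: "zplus (c *s v) = c * zplus v" and zminus_smult [simp]: "zminus (c *s v) = c * zminus v"
  by (simp_all add: zplus_def zminus_def algebra_simps)

lemma bounded_linear_of_zpm: "bounded_linear (\<lambda>p. of_zpm (fst p) (snd p))"
  by (subst linear_conv_bounded_linear[symmetric]) (intro linearI vec2_eqI; simp)

lemma norm_vec2_le: "norm (v::complex^2) \<le> norm (v $ 1) + norm (v $ 2)"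
  by (simp add: norm_vec_def L2_set_def UNIV_2 sqrt_sum_squares_le_sum)

lemma norm_zplus_le: "norm (zplus v) \<le> 2 * norm v" and norm_zminus_le: "norm (zminus v) \<le> 2 * norm v"
proof -
  have "norm (v $ 1) \<le> norm v" and "norm (v $ 2) \<le> norm v" by (rule Finite_Cartesian_Product.norm_nth_le)+
  moreover have "norm (zplus v) \<le> norm (v $ 1) + norm (v $ 2)" "norm (zminus v) \<le> norm (v $ 1) + norm (v $ 2)"
    unfolding zplus_def zminus_def
    by (rule order_trans[OF norm_triangle_ineq] order_trans[OF norm_triangle_ineq4], simp add: norm_mult)+
  ultimately show "norm (zplus v) \<le> 2 * norm v" "norm (zminus v) \<le> 2 * norm v" by linarith+
qed

lemma norm_of_zpm_le: "norm (of_zpm a b) \<le> norm a + norm b"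
proof -
  have "norm (of_zpm a b) \<le> norm ((a + b) / 2) + norm ((a - b) / (2 * \<i>))"
    using norm_vec2_le[of "of_zpm a b"] by (simp add: of_zpm_def)
  also have "\<dots> = (norm (a + b) + norm (a - b)) / 2" by (simp add: norm_divide norm_mult)
  also have "\<dots> \<le> norm a + norm b" using norm_triangle_ineq[of a b] norm_triangle_ineq4[of a b] by simp
  finally show ?thesis .
qed

lemma norm_diag_op_le: "norm (diag_op c d v) \<le> 2 * (norm c + norm d) * norm v"
proof -
  have "norm (diag_op c d v) \<le> norm c * norm (zplus v) + norm d * norm (zminus v)"
    unfolding diag_op_def using norm_of_zpm_le[of "c * zplus v" "d * zminus v"] by (simp add: norm_mult)
  also have "\<dots> \<le> norm c * (2 * norm v) + norm d * (2 * norm v)"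
    by (intro add_mono mult_left_mono norm_zplus_le norm_zminus_le) auto
  finally show ?thesis by (simp add: algebra_simps)
qed

lemma linear_diag_op: "linear (diag_op c d)"
  by (intro linearI vec2_eqI) (simp_all add: algebra_simps)

lemma bounded_linear_diag_op: "bounded_linear (diag_op c d)"
  using linear_diag_op by (simp add: linear_conv_bounded_linear)

lemma diag_op_diff: "diag_op c d v - diag_op c' d' v = diag_op (c - c') (d - d') v"
  by (intro vec2_eqI) (simp_all add: algebra_simps)

lemma diag_op_diag_op [simp]: "diag_op c d (diag_op c' d' v) = diag_op (c * c') (d * d') v"
  by (intro vec2_eqI) simp_all

lemma diag_op_one [simp]: "diag_op 1 1 v = v"
  by (intro vec2_eqI) simp_all

section \<open>The scalar resolvent kernel, bounded solutions and derivatives of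
  convolutions\<close>

lemma norm_exp_diff_le:
  fixes s :: complex and a b :: real
  assumes "Re s > 0" "a \<ge> 0" "b \<ge> 0"
  shows "norm (exp (- s * a) - exp (- s * b)) \<le> norm s * \<bar>a - b\<bar>"
proof -
  have "norm (exp (- s * a) - exp (- s * b)) \<le> norm s * norm (a - b)"
  proof (rule differentiable_bound[where S = "{0..}" and f = "\<lambda>x. exp (- s * complex_of_real x)"
        and f' = "\<lambda>x h. h *\<^sub>R (- s * exp (- s * complex_of_real x))"])
    fix x :: real assume x: "x \<in> {0..}"
    have "((\<lambda>x. exp (- s * complex_of_real x)) has_vector_derivative - s * exp (- s * complex_of_real x)) (at x within {0..})"
      by (intro derivative_eq_intros has_vector_derivative_real_field | simp)+
    then show "((\<lambda>x. exp (- s * complex_of_real x)) has_derivative (\<lambda>h. h *\<^sub>R (- s * exp (- s * complex_of_real x)))) (at x within {0..})"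
      by (simp add: has_vector_derivative_def)
    have "norm (- s * exp (- s * complex_of_real x)) \<le> norm s"
      using x assms(1) by (simp add: norm_mult mult_left_le)
    then show "onorm (\<lambda>h. h *\<^sub>R (- s * exp (- s * complex_of_real x))) \<le> norm s"
      by (intro onorm_le) (metis mult.commute mult_left_mono norm_ge_zero norm_scaleR real_norm_def)
  qed (use assms in auto)
  then show ?thesis by simp
qed

text \<open>The convolution kernel of the inverse of \<open>s\<^sup>2 - \<partial>\<^sub>x\<^sup>2\<close> on the line.\<close>

definition gk :: "complex \<Rightarrow> real \<Rightarrow> complex" where "gk s x = exp (- s * \<bar>x\<bar>) / (2 * s)"

lemma norm_gk: "norm (gk s x) = exp (- Re s * \<bar>x\<bar>) / (2 * norm s)"
  by (simp add: gk_def norm_divide norm_mult)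

text \<open>The prefactor \<open>1 / (2 * s)\<close> cancels the Lipschitz constant
  \<open>norm s\<close> of the exponential, so the bound does not depend on \<open>s\<close>; the
  reverse triangle inequality carries it across the corner at 0.\<close>

lemma norm_gk_diff_le: "Re s > 0 \<Longrightarrow> norm (gk s x - gk s y) \<le> \<bar>x - y\<bar> / 2"
proof -
  assume s: "Re s > 0"
  then have s0: "norm s > 0" by auto
  have "norm (gk s x - gk s y) = norm (exp (- s * \<bar>x\<bar>) - exp (- s * \<bar>y\<bar>)) / (2 * norm s)"
    by (simp add: gk_def diff_divide_distrib[symmetric] norm_divide norm_mult)
  also have "\<dots> \<le> (norm s * \<bar>\<bar>x\<bar> - \<bar>y\<bar>\<bar>) / (2 * norm s)"
    using norm_exp_diff_le[OF s, of "\<bar>x\<bar>" "\<bar>y\<bar>"] by (intro divide_right_mono) auto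
  also have "\<dots> = \<bar>\<bar>x\<bar> - \<bar>y\<bar>\<bar> / 2" using s0 by simp
  also have "\<dots> \<le> \<bar>x - y\<bar> / 2" by simp
  finally show ?thesis .
qed

lemma ode_exponential:
  fixes q :: "real \<Rightarrow> complex"
  assumes q: "\<And>x. (q has_vector_derivative a * q x) (at x)" and B: "\<And>x. norm (q x) \<le> B" and a: "Re a \<noteq> 0"
  shows "q x = 0"
proof -
  have "((\<lambda>x. exp (- a * complex_of_real x) * q x) has_vector_derivative 0) (at x)" for x
  proof -
    have "((\<lambda>x. exp (- a * complex_of_real x)) has_vector_derivative - a * exp (- a * complex_of_real x)) (at x)"
      by (intro derivative_eq_intros has_vector_derivative_real_field | simp)+
    from has_vector_derivative_mult[OF this q[of x]] show ?thesis by (simp add: algebra_simps)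
  qed
  then obtain c where c: "\<And>x. exp (- a * complex_of_real x) * q x = c"
    using has_vector_derivative_zero_constant[of UNIV "\<lambda>x. exp (- a * complex_of_real x) * q x"] by auto
  have qc: "q x = exp (a * complex_of_real x) * c" for x
    using c[of x] by (metis exp_minus_inverse mult.assoc mult.left_neutral mult_minus_left mult.commute)
  have "c = 0"
  proof (rule ccontr)
    assume c0: "c \<noteq> 0"
    have B0: "0 \<le> B" using order_trans[OF norm_ge_zero B] .
    \<comment> \<open>The point where the explicit solution has modulus \<open>B + 1\<close>; it
      lies on the growing side for either sign of \<open>Re a\<close>.\<close>
    define x where "x = ln ((B + 1) / norm c) / Re a"
    have "norm (q x) = exp (Re a * x) * norm c" by (simp add: qc norm_mult)
    also have "\<dots> = B + 1" using a c0 B0 by (simp add: x_def)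
    finally show False using B[of x] by simp
  qed
  then show ?thesis using qc by simp
qed

text \<open>The operator factors into first order ones: \<open>q = w' + s * w\<close> satisfies
  \<open>q' = s * q\<close>, so a bounded \<open>q\<close> vanishes, and then
  \<open>w' = - s * w\<close> forces \<open>w\<close> to vanish too.\<close>

lemma ode_second_order_bounded_unique:
  fixes w w1 :: "real \<Rightarrow> complex"
  assumes w: "\<And>x. (w has_vector_derivative w1 x) (at x)" and w1: "\<And>x. (w1 has_vector_derivative s\<^sup>2 * w x) (at x)"
    and B: "\<And>x. norm (w x) \<le> B" "\<And>x. norm (w1 x) \<le> B" and s: "Re s > 0"
  shows "w x = 0"
proof -
  define q where "q x = w1 x + s * w x" for x
  have "q x = 0" for x
  proof (rule ode_exponential[where a = s and B = "B + norm s * B"])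
    show "(q has_vector_derivative s * q x) (at x)" for x
      unfolding q_def
      using has_vector_derivative_add[OF w1[of x] has_vector_derivative_mult_right[OF w[of x], of s]]
      by (simp add: power2_eq_square algebra_simps)
    show "norm (q x) \<le> B + norm s * B" for x
      unfolding q_def by (intro order_trans[OF norm_triangle_ineq] add_mono B) (simp add: norm_mult mult_left_mono B)
  qed (use s in auto)
  then have "w1 x = - s * w x" for x by (simp add: q_def add_eq_0_iff2)
  then show ?thesis using w B s by (intro ode_exponential[where a = "- s" and B = B]) auto
qed

lemma integral_atMost_has_vector_derivative:
  fixes f :: "real \<Rightarrow> 'a::euclidean_space"
  assumes f: "continuous_on UNIV f" and int: "\<And>x. integrable lborel (\<lambda>y. indicator {..x} y *\<^sub>R f y)"
  shows "((\<lambda>x. LINT y|lborel. indicator {..x} y *\<^sub>R f y) has_vector_derivative f x) (at x)"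
proof -
  define J where "J x = (LINT y|lborel. indicator {..x} y *\<^sub>R f y)" for x
  \<comment> \<open>A base point left of \<open>x\<close> splits off a constant, and near
    \<open>x\<close> only an integral over a compact interval varies.\<close>
  define a where "a = x - 1"
  have iI: "integrable lborel (\<lambda>y. indicator {a..z} y *\<^sub>R f y)" for z
    by (rule borel_integrable_compact) (auto intro: continuous_on_subset[OF f])
  have J: "J z = J a + integral {a..z} f" if "a \<le> z" for z
  proof -
    have "J z = (LINT y|lborel. indicator {..a} y *\<^sub>R f y + indicator {a..z} y *\<^sub>R f y)"
      unfolding J_def
    proof (rule integral_cong_AE)
      show "AE y in lborel. indicator {..z} y *\<^sub>R f y = indicator {..a} y *\<^sub>R f y + indicator {a..z} y *\<^sub>R f y"
        using AE_lborel_singleton[of a] by eventually_elim (use that in \<open>auto simp: indicator_def\<close>)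
    qed (use int iI in auto)
    also have "\<dots> = J a + (LINT y|lborel. indicator {a..z} y *\<^sub>R f y)"
      unfolding J_def by (rule Bochner_Integration.integral_add[OF int iI])
    also have "(LINT y|lborel. indicator {a..z} y *\<^sub>R f y) = integral {a..z} f"
      using set_borel_integral_eq_integral(2)[of "{a..z}" f] iI
      by (simp add: set_lebesgue_integral_def set_integrable_def)
    finally show ?thesis .
  qed
  have "((\<lambda>z. integral {a..z} f) has_vector_derivative f x) (at x within {a..x + 1})"
    by (rule integral_has_vector_derivative) (auto simp: a_def intro: continuous_on_subset[OF f])
  then have "((\<lambda>z. integral {a..z} f) has_vector_derivative f x) (at x)"
    by (subst (asm) at_within_interior) (auto simp: a_def)
  then have "((\<lambda>z. J a + integral {a..z} f) has_vector_derivative f x) (at x)"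
    using has_vector_derivative_add[OF has_vector_derivative_const] by fastforce
  then have "(J has_vector_derivative f x) (at x)"
  proof (rule has_vector_derivative_transform_within_open[where S = "{a<..}"])
    show "x \<in> {a<..}" by (simp add: a_def)
    show "J a + integral {a..z} f = J z" if "z \<in> {a<..}" for z using J[of z] that by simp
  qed simp
  then show ?thesis unfolding J_def .
qed

text \<open>The part of the convolution coming from the left of \<open>x\<close>, without the factor
  \<open>1 / (2 * s)\<close>. The corner of the kernel at 0 forbids differentiating under the
  integral; on each half the kernel is smooth, and the right half is this one after
  reflection.\<close>

definition half_conv :: "complex \<Rightarrow> (real \<Rightarrow> complex) \<Rightarrow> real \<Rightarrow> complex" where
  "half_conv s h x = (LINT y|lborel. indicator {..x} y *\<^sub>R (exp (- s * (x - y)) * h y))"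

lemma half_conv_integrable:
  assumes "exp_integrable \<sigma> h" "0 \<le> \<sigma>" "\<sigma> \<le> Re s"
  shows "integrable lborel (\<lambda>y. indicator {..x} y *\<^sub>R (exp (- s * complex_of_real (x - y)) * h y))" (is ?I)
    and "norm (half_conv s h x) \<le> (exp_conv \<sigma> h x)"
proof -
  have [measurable]: "h \<in> borel_measurable borel" using assms by (simp add: exp_integrable_def)
  have le: "norm (indicator {..x} y *\<^sub>R (exp (- s * complex_of_real (x - y)) * h y)) \<le> exp (- \<sigma> * \<bar>x - y\<bar>) * norm (h y)" for y
    using mult_right_mono[OF assms(3), of "x - y"]
    by (auto simp: indicator_def norm_mult intro!: mult_right_mono)
  show int: ?I
    by (rule Bochner_Integration.integrable_bound[OF exp_integrable_translate[OF assms(1,2), of x]])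
      (use le in \<open>auto intro!: AE_I2 order_trans[OF le abs_ge_self]\<close>)
  show "norm (half_conv s h x) \<le> (exp_conv \<sigma> h x)"
    unfolding half_conv_def
    by (rule order_trans[OF integral_norm_bound integral_mono[OF integrable_norm[OF int] exp_integrable_translate[OF assms(1,2), of x] le]])
qed

lemma half_conv_has_vector_derivative:
  assumes h: "continuous_on UNIV h" "\<And>y. norm (h y) \<le> B" and s: "Re s > 0"
  shows "(half_conv s h has_vector_derivative - s * half_conv s h x + h x) (at x)"
proof -
  have e: "exp_integrable (Re s) h"
    using h s by (intro exp_integrable_bounded borel_measurable_continuous_onI) auto
  \<comment> \<open>Factoring \<open>exp (- s * x)\<close> out of the integral leaves
    \<open>x\<close> in the upper limit only.\<close>
  define J where "J x = (LINT y|lborel. indicator {..x} y *\<^sub>R (exp (s * complex_of_real y) * h y))" for x :: real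
  have eq: "exp (- s * complex_of_real (x - y)) * z = exp (- s * complex_of_real x) * (exp (s * complex_of_real y) * z)" for x y z
  proof -
    have "- s * complex_of_real (x - y) = - s * complex_of_real x + s * complex_of_real y" by (simp add: algebra_simps)
    then show ?thesis by (simp only: exp_add mult.assoc)
  qed
  have eqJ: "half_conv s h x = exp (- s * complex_of_real x) * J x" for x
    unfolding half_conv_def J_def eq mult_scaleR_right[symmetric] by (rule integral_mult_right_zero)
  have int: "integrable lborel (\<lambda>y. indicator {..x} y *\<^sub>R (exp (s * complex_of_real y) * h y))" for x :: real
  proof -
    have "exp (s * complex_of_real x) * (indicator {..x} y *\<^sub>R (exp (- s * complex_of_real (x - y)) * h y)) =
        indicator {..x} y *\<^sub>R (exp (s * complex_of_real y) * h y)" for y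
      unfolding eq by (simp add: exp_minus)
    then show ?thesis
      using integrable_mult_right[OF half_conv_integrable(1)[OF e less_imp_le[OF s] order_refl, of x], of "exp (s * complex_of_real x)"]
      by (simp only:)
  qed
  have "(J has_vector_derivative exp (s * complex_of_real x) * h x) (at x)"
    unfolding J_def by (rule integral_atMost_has_vector_derivative[OF _ int]) (intro continuous_intros h)
  moreover have "((\<lambda>x. exp (- s * complex_of_real x)) has_vector_derivative - s * exp (- s * complex_of_real x)) (at x)"
    by (intro derivative_eq_intros has_vector_derivative_real_field | simp)+
  ultimately have *: "((\<lambda>x. exp (- s * complex_of_real x) * J x) has_vector_derivative
      exp (- s * complex_of_real x) * (exp (s * complex_of_real x) * h x) + - s * exp (- s * complex_of_real x) * J x) (at x)"
    by (rule has_vector_derivative_mult[rotated])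
  show ?thesis
  proof -
    have "exp (- s * complex_of_real x) * (exp (s * complex_of_real x) * h x) = h x"
      by (simp add: exp_minus field_simps)
    then show ?thesis
      using * unfolding eqJ[abs_def] by (simp only: mult.assoc add.commute)
  qed
qed

lemma exp_integrable_reflect:
  assumes "exp_integrable \<sigma> h"
  shows "exp_integrable \<sigma> (\<lambda>y. h (- y))"
  using assms lborel_integrable_real_affine[of "\<lambda>y. exp (- \<sigma> * \<bar>y\<bar>) * norm (h y)" "-1" 0]
  by (auto simp: exp_integrable_def)

lemma gk_conv_eq_half_conv:
  assumes h: "exp_integrable \<sigma> h" "0 \<le> \<sigma>" "\<sigma> \<le> Re s"
  shows "(LINT y|lborel. gk s (x - y) * h y) = (half_conv s h x + half_conv s (\<lambda>y. h (- y)) (- x)) / (2 * s)"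
proof -
  have [measurable]: "h \<in> borel_measurable borel" using h by (simp add: exp_integrable_def)
  have "half_conv s (\<lambda>y. h (- y)) (- x) = (LINT y|lborel. indicator {x..} y *\<^sub>R (exp (- s * complex_of_real (y - x)) * h y))"
    unfolding half_conv_def
    by (subst lborel_integral_real_affine[where c = "-1" and t = 0]) (auto simp: indicator_def intro!: Bochner_Integration.integral_cong)
  moreover have i: "integrable lborel (\<lambda>y. indicator {x..} y *\<^sub>R (exp (- s * complex_of_real (y - x)) * h y))"
    using lborel_integrable_real_affine[OF half_conv_integrable(1)[OF exp_integrable_reflect[OF h(1)] h(2,3), of "- x"], of "-1" 0]
    by (rule Bochner_Integration.integrable_cong[OF refl, THEN iffD1, rotated]) (auto simp: indicator_def)
  \<comment> \<open>Both closed half lines contain \<open>y = x\<close>, where the two integrands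
    may disagree; a single point is null.\<close>
  moreover have "(LINT y|lborel. gk s (x - y) * h y) = (LINT y|lborel. (indicator {..x} y *\<^sub>R (exp (- s * complex_of_real (x - y)) * h y)
      + indicator {x..} y *\<^sub>R (exp (- s * complex_of_real (y - x)) * h y)) / (2 * s))"
  proof (rule integral_cong_AE)
    show "(\<lambda>y. gk s (x - y) * h y) \<in> borel_measurable lborel" unfolding gk_def by measurable
    show "AE y in lborel. gk s (x - y) * h y = (indicator {..x} y *\<^sub>R (exp (- s * complex_of_real (x - y)) * h y)
      + indicator {x..} y *\<^sub>R (exp (- s * complex_of_real (y - x)) * h y)) / (2 * s)"
      using AE_lborel_singleton[of x] by eventually_elim (auto simp: indicator_def gk_def)
  qed measurable
  ultimately show ?thesis
    using half_conv_integrable(1)[OF h, of x] by (simp add: half_conv_def)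
qed

text \<open>Differentiating the halves produces \<open>h x\<close> with opposite signs: in the sum
  these cancel, which leaves this formula, while in the difference they add up and give the source
  \<open>- h x\<close> of the second derivative.\<close>

definition gk_conv_deriv :: "complex \<Rightarrow> (real \<Rightarrow> complex) \<Rightarrow> real \<Rightarrow> complex" where
  "gk_conv_deriv s h x = (half_conv s (\<lambda>y. h (- y)) (- x) - half_conv s h x) / 2"

lemma gk_conv_has_vector_derivative:
  assumes h: "continuous_on UNIV h" "\<And>y. norm (h y) \<le> B" and s: "Re s > 0"
  shows "((\<lambda>x. LINT y|lborel. gk s (x - y) * h y) has_vector_derivative gk_conv_deriv s h x) (at x)"
    and "(gk_conv_deriv s h has_vector_derivative s\<^sup>2 * (LINT y|lborel. gk s (x - y) * h y) - h x) (at x)"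
proof -
  have s0: "s \<noteq> 0" using s by auto
  have e: "exp_integrable (Re s) h"
    using h s by (intro exp_integrable_bounded borel_measurable_continuous_onI) auto
  let ?P = "half_conv s h" and ?N = "\<lambda>x. half_conv s (\<lambda>y. h (- y)) (- x)"
  have w: "(LINT y|lborel. gk s (x - y) * h y) = inverse (2 * s) * (?P x + ?N x)" for x
    using gk_conv_eq_half_conv[OF e less_imp_le[OF s] order_refl] by (simp add: field_simps)
  have P: "(?P has_vector_derivative - s * ?P x + h x) (at x)" for x
    by (rule half_conv_has_vector_derivative[OF h s])
  have hr: "continuous_on UNIV (\<lambda>y. h (- y))"
    by (rule continuous_on_compose2[OF h(1)]) (auto intro: continuous_intros)
  have N: "(?N has_vector_derivative s * ?N x - h x) (at x)" for x
  proof -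
    have 1: "((\<lambda>x::real. - x) has_vector_derivative - 1) (at x)" by (auto intro!: derivative_eq_intros)
    have "((half_conv s (\<lambda>y. h (- y)) \<circ> uminus) has_vector_derivative (-1) *\<^sub>R (- s * ?N x + h x)) (at x)"
      using half_conv_has_vector_derivative[OF hr h(2) s, of "- x"] by (intro vector_diff_chain_at[OF 1]) simp
    then show ?thesis by (simp add: o_def algebra_simps)
  qed
  show "((\<lambda>x. LINT y|lborel. gk s (x - y) * h y) has_vector_derivative gk_conv_deriv s h x) (at x)"
    unfolding w
  proof (rule has_vector_derivative_eq_rhs[OF has_vector_derivative_mult_right[OF has_vector_derivative_add[OF P N]]])
    show "inverse (2 * s) * (- s * ?P x + h x + (s * ?N x - h x)) = gk_conv_deriv s h x"
      using s0 by (simp add: gk_conv_deriv_def field_simps)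
  qed
  have "gk_conv_deriv s h = (\<lambda>x. inverse 2 * (?N x - ?P x))" by (simp add: gk_conv_deriv_def fun_eq_iff)
  then show "(gk_conv_deriv s h has_vector_derivative s\<^sup>2 * (LINT y|lborel. gk s (x - y) * h y) - h x) (at x)"
  proof (rule ssubst, intro has_vector_derivative_eq_rhs[OF has_vector_derivative_mult_right[OF has_vector_derivative_diff[OF N P]]])
    show "inverse 2 * (s * ?N x - h x - (- s * ?P x + h x)) = s\<^sup>2 * (LINT y|lborel. gk s (x - y) * h y) - h x"
      unfolding w using s0 by (simp add: field_simps power2_eq_square)
  qed
qed

lemma norm_gk_conv_deriv_le:
  assumes "exp_integrable \<sigma> h" "0 \<le> \<sigma>" "\<sigma> \<le> Re s"
  shows "norm (gk_conv_deriv s h x) \<le> (exp_conv \<sigma> h x)"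
proof -
  have "(LINT y|lborel. exp (- \<sigma> * \<bar>- x - y\<bar>) * norm (h (- y))) = (exp_conv \<sigma> h x)"
    by (subst lborel_integral_real_affine[where c = "-1" and t = 0]) (auto simp: abs_minus_commute)
  then have "norm (half_conv s (\<lambda>y. h (- y)) (- x)) \<le> (exp_conv \<sigma> h x)"
    using half_conv_integrable(2)[OF exp_integrable_reflect[OF assms(1)] assms(2,3), of "- x"] by simp
  moreover note half_conv_integrable(2)[OF assms, of x]
  moreover have "norm (gk_conv_deriv s h x) \<le> (norm (half_conv s (\<lambda>y. h (- y)) (- x)) + norm (half_conv s h x)) / 2"
    unfolding gk_conv_deriv_def norm_divide by (simp add: norm_triangle_ineq4)
  moreover have "a \<le> I" if "N \<le> I" "M \<le> I" "a \<le> (N + M) / 2" for a N M I :: real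
    using that by (simp add: field_simps)
  ultimately show ?thesis by blast
qed

lemma has_vector_derivative_of_zpm:
  assumes "(f has_vector_derivative f') (at x within S)" "(g has_vector_derivative g') (at x within S)"
  shows "((\<lambda>x. of_zpm (f x) (g x)) has_vector_derivative of_zpm f' g') (at x within S)"
  using bounded_linear.has_vector_derivative[OF bounded_linear_of_zpm has_vector_derivative_Pair[OF assms]] by simp

lemma diag_op_ode_bounded_unique:
  fixes w w1 :: "real \<Rightarrow> complex^2"
  assumes w: "\<And>x. (w has_vector_derivative w1 x) (at x)"
    and w1: "\<And>x. (w1 has_vector_derivative diag_op (s\<^sup>2) (t\<^sup>2) (w x)) (at x)"
    and B: "\<And>x. norm (w x) \<le> B" "\<And>x. norm (w1 x) \<le> B" and "Re s > 0" "Re t > 0"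
  shows "w x = 0"
proof -
  have B2: "norm (zplus (w x)) \<le> 2 * B" "norm (zplus (w1 x)) \<le> 2 * B" "norm (zminus (w x)) \<le> 2 * B" "norm (zminus (w1 x)) \<le> 2 * B" for x
    using norm_zplus_le[of "w x"] norm_zplus_le[of "w1 x"] norm_zminus_le[of "w x"] norm_zminus_le[of "w1 x"] B[of x] by linarith+
  have "zplus (w x) = 0"
    using bounded_linear.has_vector_derivative[OF bounded_linear_zplus w] bounded_linear.has_vector_derivative[OF bounded_linear_zplus w1]
    by (intro ode_second_order_bounded_unique[of "\<lambda>x. zplus (w x)" "\<lambda>x. zplus (w1 x)" s "2 * B"] B2 assms) auto
  moreover have "zminus (w x) = 0"
    using bounded_linear.has_vector_derivative[OF bounded_linear_zminus w] bounded_linear.has_vector_derivative[OF bounded_linear_zminus w1]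
    by (intro ode_second_order_bounded_unique[of "\<lambda>x. zminus (w x)" "\<lambda>x. zminus (w1 x)" t "2 * B"] B2 assms) auto
  ultimately show ?thesis by (intro vec2_eqI) simp_all
qed

locale diag_op_kernel =
  fixes s t :: complex
  assumes s: "Re s > 0" and t: "Re t > 0"
begin

definition "G x = diag_op (gk s x) (gk t x)"
text \<open>The slower of the two decay rates, so that one rate serves both coordinates.\<close>

definition "\<sigma> = min (Re s) (Re t)"

lemma \<sigma>_le: "\<sigma> \<le> Re s" "\<sigma> \<le> Re t" and \<sigma>_gt_0: "\<sigma> > 0"
  using s t by (auto simp: \<sigma>_def)

text \<open>Passing to the coordinates and back costs the factor 2 of
  \<open>norm_diag_op_le\<close>. It turns the prefactors \<open>1 / (2 * norm s)\<close> and
  \<open>1 / (2 * norm t)\<close> into the first constant, and the two Lipschitz constants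
  \<open>1 / 2\<close> into 2.\<close>

sublocale exp_kernel G "1 / norm s + 1 / norm t" \<sigma> 2
proof (rule exp_kernel.intro)
  have st: "norm s > 0" "norm t > 0" using s t by auto
  show "linear (G x)" for x unfolding G_def by (rule linear_diag_op)
  show "norm (G x v) \<le> (1 / norm s + 1 / norm t) * exp (- \<sigma> * \<bar>x\<bar>) * norm v" for x v
  proof -
    have "norm (gk s x) \<le> exp (- \<sigma> * \<bar>x\<bar>) / (2 * norm s)" "norm (gk t x) \<le> exp (- \<sigma> * \<bar>x\<bar>) / (2 * norm t)"
      using st \<sigma>_le by (auto simp: norm_gk intro!: divide_right_mono mult_right_mono)
    then have "2 * (norm (gk s x) + norm (gk t x)) \<le> (1 / norm s + 1 / norm t) * exp (- \<sigma> * \<bar>x\<bar>)"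
      by (simp add: algebra_simps)
    then show ?thesis
      using norm_diag_op_le[of "gk s x" "gk t x" v] mult_right_mono[of "2 * (norm (gk s x) + norm (gk t x))" _ "norm v"]
      unfolding G_def by (smt (verit) norm_ge_zero)
  qed
  show "norm (G x v - G y v) \<le> 2 * \<bar>x - y\<bar> * norm v" for x y v
  proof -
    have "2 * (norm (gk s x - gk s y) + norm (gk t x - gk t y)) \<le> 2 * \<bar>x - y\<bar>"
      using norm_gk_diff_le[OF s, of x y] norm_gk_diff_le[OF t, of x y] by simp
    then have "2 * (norm (gk s x - gk s y) + norm (gk t x - gk t y)) * norm v \<le> 2 * \<bar>x - y\<bar> * norm v"
      by (rule mult_right_mono) simp
    then show ?thesis
      unfolding G_def diag_op_diff using norm_diag_op_le order_trans by blast
  qed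
qed (use s t \<sigma>_gt_0 in auto)

definition conv_deriv :: "(real \<Rightarrow> complex^2) \<Rightarrow> real \<Rightarrow> complex^2" where
  "conv_deriv h x = of_zpm (gk_conv_deriv s (\<lambda>y. zplus (h y)) x) (gk_conv_deriv t (\<lambda>y. zminus (h y)) x)"

lemma conv_eq_of_zpm:
  assumes "exp_integrable \<sigma> h"
  shows "conv h x = of_zpm (LINT y|lborel. gk s (x - y) * zplus (h y)) (LINT y|lborel. gk t (x - y) * zminus (h y))"
  using integral_bounded_linear[OF bounded_linear_zplus integrable_conv[OF assms, of x]]
    integral_bounded_linear[OF bounded_linear_zminus integrable_conv[OF assms, of x]]
  by (intro vec2_eqI) (simp_all add: conv_def G_def)

lemma conv_has_vector_derivative:
  assumes h: "continuous_on UNIV h" and B: "\<And>y. norm (h y) \<le> B"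
  shows "(conv h has_vector_derivative conv_deriv h x) (at x)"
    and "(conv_deriv h has_vector_derivative diag_op (s\<^sup>2) (t\<^sup>2) (conv h x) - h x) (at x)"
proof -
  have e: "exp_integrable \<sigma> h"
    using h B by (intro exp_integrable_bounded borel_measurable_continuous_onI) (auto simp: \<sigma>_pos)
  have hp: "continuous_on UNIV (\<lambda>y. zplus (h y))" "continuous_on UNIV (\<lambda>y. zminus (h y))"
    by (intro bounded_linear.continuous_on[OF bounded_linear_zplus] bounded_linear.continuous_on[OF bounded_linear_zminus] h)+
  have hB: "norm (zplus (h y)) \<le> 2 * B" "norm (zminus (h y)) \<le> 2 * B" for y
    using norm_zplus_le[of "h y"] norm_zminus_le[of "h y"] B[of y] by linarith+
  note ds = gk_conv_has_vector_derivative[OF hp(1) hB(1) s] and dt = gk_conv_has_vector_derivative[OF hp(2) hB(2) t]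
  have c: "conv h = (\<lambda>x. of_zpm (LINT y|lborel. gk s (x - y) * zplus (h y)) (LINT y|lborel. gk t (x - y) * zminus (h y)))"
    using conv_eq_of_zpm[OF e] by blast
  show "(conv h has_vector_derivative conv_deriv h x) (at x)"
    unfolding c conv_deriv_def by (rule has_vector_derivative_of_zpm[OF ds(1) dt(1)])
  have "diag_op (s\<^sup>2) (t\<^sup>2) (conv h x) - h x =
    of_zpm (s\<^sup>2 * (LINT y|lborel. gk s (x - y) * zplus (h y)) - zplus (h x)) (t\<^sup>2 * (LINT y|lborel. gk t (x - y) * zminus (h y)) - zminus (h x))"
    by (intro vec2_eqI) (simp_all add: c)
  then show "(conv_deriv h has_vector_derivative diag_op (s\<^sup>2) (t\<^sup>2) (conv h x) - h x) (at x)"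
    using has_vector_derivative_of_zpm[OF ds(2) dt(2)] unfolding conv_deriv_def[abs_def] by simp
qed

lemma norm_conv_deriv_le:
  assumes h: "exp_integrable \<sigma> h"
  shows "norm (conv_deriv h x) \<le> 4 * (exp_conv \<sigma> h x)"
proof -
  have [measurable]: "h \<in> borel_measurable borel" using h by (simp add: exp_integrable_def)
  have *: "exp_integrable \<sigma> (\<lambda>y. f (h y)) \<and>
      (LINT y|lborel. exp (- \<sigma> * \<bar>x - y\<bar>) * norm (f (h y))) \<le> 2 * (exp_conv \<sigma> h x)"
    if f: "bounded_linear f" "\<And>v. norm (f v) \<le> 2 * norm v" for f :: "complex^2 \<Rightarrow> complex"
  proof
    have [measurable]: "(\<lambda>y. f (h y)) \<in> borel_measurable borel"
      using measurable_compose[OF _ borel_measurable_continuous_onI[OF linear_continuous_on[OF f(1)]]] by measurable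
    have "integrable lborel (\<lambda>y. 2 * (exp (- \<sigma> * \<bar>y\<bar>) * norm (h y)))" using h by (simp add: exp_integrable_def)
    then have "integrable lborel (\<lambda>y. exp (- \<sigma> * \<bar>y\<bar>) * norm (f (h y)))"
      by (rule Bochner_Integration.integrable_bound) (use f(2) in \<open>auto simp: abs_mult\<close>)
    then show e: "exp_integrable \<sigma> (\<lambda>y. f (h y))" by (simp add: exp_integrable_def)
    have "(LINT y|lborel. exp (- \<sigma> * \<bar>x - y\<bar>) * norm (f (h y))) \<le> (LINT y|lborel. 2 * (exp (- \<sigma> * \<bar>x - y\<bar>) * norm (h y)))"
      using f(2) \<sigma>_pos
      by (intro integral_mono integrable_mult_right exp_integrable_translate e h) auto
    then show "(LINT y|lborel. exp (- \<sigma> * \<bar>x - y\<bar>) * norm (f (h y))) \<le> 2 * (exp_conv \<sigma> h x)"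
      by simp
  qed
  note p = *[OF bounded_linear_zplus norm_zplus_le] and m = *[OF bounded_linear_zminus norm_zminus_le]
  have "norm (conv_deriv h x) \<le> norm (gk_conv_deriv s (\<lambda>y. zplus (h y)) x) + norm (gk_conv_deriv t (\<lambda>y. zminus (h y)) x)"
    unfolding conv_deriv_def by (rule norm_of_zpm_le)
  then show ?thesis
    using norm_gk_conv_deriv_le[OF conjunct1[OF p] less_imp_le[OF \<sigma>_pos] \<sigma>_le(1), of x]
      norm_gk_conv_deriv_le[OF conjunct1[OF m] less_imp_le[OF \<sigma>_pos] \<sigma>_le(2), of x] p m by linarith
qed

end

subsection \<open>Bump functions and mollification\<close>

text \<open>The functions \<open>p (1 / x) * exp (- 1 / x)\<close>, extended by 0, form a class
  closed under differentiation: \<open>p\<close> is replaced by \<open>y^2 * (p - p')\<close> in the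
  variable \<open>y = 1 / x\<close>. Smoothness of every order thus needs one derivative
  computation.\<close>

definition flat :: "real poly \<Rightarrow> real \<Rightarrow> real" where
  "flat p x = (if x > 0 then poly p (1 / x) * exp (- (1 / x)) else 0)"

lemma poly_times_exp_minus_tendsto_0: "((\<lambda>y::real. poly p y * exp (- y)) \<longlongrightarrow> 0) at_top"
proof -
  have "((\<lambda>y::real. \<Sum>i\<le>degree p. coeff p i * (y ^ i / exp y)) \<longlongrightarrow> (\<Sum>i\<le>degree p. coeff p i * 0)) at_top"
    by (intro tendsto_sum tendsto_mult tendsto_const tendsto_power_div_exp_0)
  then show ?thesis
    by (simp add: poly_altdef sum_distrib_right exp_minus divide_inverse mult.assoc)
qed

lemma flat_has_real_derivative:
  "(flat p has_real_derivative flat ([:0, 0, 1:] * (p - pderiv p)) x) (at x)"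
proof -
  consider "x > 0" | "x < 0" | "x = 0" by linarith
  then show ?thesis
  proof cases
    case 1
    have "((\<lambda>x. poly p (1 / x) * exp (- (1 / x))) has_real_derivative flat ([:0, 0, 1:] * (p - pderiv p)) x) (at x)"
      using 1 by (auto intro!: derivative_eq_intros DERIV_chain'[where g = "poly p"] poly_DERIV
          simp: flat_def power2_eq_square field_simps)
    then show ?thesis
      by (rule has_field_derivative_transform_within_open[where S = "{0<..}"]) (use 1 in \<open>auto simp: flat_def\<close>)
  next
    case 2
    have "((\<lambda>x. 0) has_real_derivative flat ([:0, 0, 1:] * (p - pderiv p)) x) (at x)"
      using 2 by (simp add: flat_def)
    then show ?thesis
      by (rule has_field_derivative_transform_within_open[where S = "{..<0}"]) (use 2 in \<open>auto simp: flat_def\<close>)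
  next
    case 3
    have "((\<lambda>y. flat p y / y) \<longlongrightarrow> 0) (at_left 0)"
      by (rule tendsto_eventually) (auto simp: eventually_at_left_field flat_def intro!: exI[of _ "-1"])
    moreover have "((\<lambda>y. flat p y / y) \<longlongrightarrow> 0) (at_right 0)"
    proof -
      have "((\<lambda>y. poly ([:0, 1:] * p) (inverse y) * exp (- inverse y)) \<longlongrightarrow> 0) (at_right (0::real))"
        by (rule filterlim_compose[OF poly_times_exp_minus_tendsto_0 filterlim_inverse_at_top_right])
      then show ?thesis
        by (rule Lim_transform_eventually)
          (auto simp: eventually_at_right_field flat_def field_simps intro!: exI[of _ 1])
    qed
    ultimately have "((\<lambda>y. flat p y / y) \<longlongrightarrow> 0) (at 0)" by (rule filterlim_split_at)
    then show ?thesis using 3 by (simp add: has_field_derivative_iff flat_def)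
  qed
qed

lemma flat_smult: "flat (Polynomial.smult c p) x = c * flat p x"
  by (simp add: flat_def)

text \<open>A class of functions vanishing outside the interval from \<open>a\<close> to
  \<open>b\<close> (for \<open>k > 0\<close>). The product rule makes sums of such products stable
  under differentiation, so every member is infinitely differentiable by induction. The scale
  \<open>k\<close> steepens the flanks.\<close>

inductive_set bumps :: "real \<Rightarrow> real \<Rightarrow> real \<Rightarrow> (real \<Rightarrow> real) set" for k a b where
  prod: "(\<lambda>x. flat p (k * (x - a)) * flat q (k * (b - x))) \<in> bumps k a b"
| add: "f \<in> bumps k a b \<Longrightarrow> g \<in> bumps k a b \<Longrightarrow> (\<lambda>x. f x + g x) \<in> bumps k a b"

lemma bumps_derivative:
  assumes "f \<in> bumps k a b"
  shows "\<exists>f'\<in>bumps k a b. \<forall>x. (f has_real_derivative f' x) (at x)"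
  using assms
proof induction
  case (prod p q)
  let ?d = "\<lambda>p. [:0, 0, 1:] * (p - pderiv p)"
  have "((\<lambda>x. flat p (k * (x - a)) * flat q (k * (b - x))) has_real_derivative
      flat (Polynomial.smult k (?d p)) (k * (x - a)) * flat q (k * (b - x))
      + flat p (k * (x - a)) * flat (Polynomial.smult (- k) (?d q)) (k * (b - x))) (at x)" for x
  proof -
    have 1: "((\<lambda>x. flat p (k * (x - a))) has_real_derivative flat (?d p) (k * (x - a)) * k) (at x)"
      by (rule DERIV_chain'[OF _ flat_has_real_derivative]) (auto intro!: derivative_eq_intros)
    have 2: "((\<lambda>x. flat q (k * (b - x))) has_real_derivative flat (?d q) (k * (b - x)) * (- k)) (at x)"
      by (rule DERIV_chain'[OF _ flat_has_real_derivative]) (auto intro!: derivative_eq_intros)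
    show ?thesis
      by (rule DERIV_cong[OF DERIV_mult[OF 1 2]]) (simp only: flat_smult, simp)
  qed
  then show ?case by (intro bexI allI) (assumption, intro bumps.intros)
next
  case (add f g)
  then show ?case by (metis (mono_tags, lifting) DERIV_add bumps.add)
qed

lemma bumps_eq_0: "f \<in> bumps k a b \<Longrightarrow> k > 0 \<Longrightarrow> x \<le> a \<or> b \<le> x \<Longrightarrow> f x = 0"
  by (induction rule: bumps.induct) (auto simp: flat_def zero_less_mult_iff)

lemma bumps_deriv: "f \<in> bumps k a b \<Longrightarrow> deriv f \<in> bumps k a b"
  and bumps_has_deriv: "f \<in> bumps k a b \<Longrightarrow> (f has_real_derivative deriv f x) (at x)"
proof -
  assume "f \<in> bumps k a b"
  then obtain f' where f': "f' \<in> bumps k a b" "\<And>x. (f has_real_derivative f' x) (at x)"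
    using bumps_derivative by blast
  then have "deriv f = f'" using DERIV_imp_deriv by blast
  then show "deriv f \<in> bumps k a b" "(f has_real_derivative deriv f x) (at x)" using f' by auto
qed

lemma bumps_measurable: "f \<in> bumps k a b \<Longrightarrow> f \<in> borel_measurable borel"
  by (rule borel_measurable_continuous_onI, rule DERIV_continuous_on, rule DERIV_subset, rule bumps_has_deriv) auto

lemma test_fun_bumps:
  assumes "f \<in> bumps k a b" "k > 0"
  shows "test_fun f"
  unfolding test_fun_def
proof
  have *: "(deriv ^^ n) f \<in> bumps k a b" for n
    by (induction n) (auto intro: bumps_deriv assms)
  show "\<forall>n x. (deriv ^^ n) f differentiable (at x)"
    using bumps_has_deriv[OF *] real_differentiable_def by blast
  show "\<exists>R. \<forall>x. R < \<bar>x\<bar> \<longrightarrow> f x = 0"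
    by (rule exI[of _ "\<bar>a\<bar> + \<bar>b\<bar>"]) (auto intro!: bumps_eq_0[OF assms])
qed

text \<open>Needed because mollification at \<open>x\<close> pairs a function with
  \<open>y \<mapsto> f (x - y)\<close>, which has to be a test function in \<open>y\<close>.\<close>

lemma bumps_reflect:
  assumes "f \<in> bumps k a b"
  shows "(\<lambda>y. f (x - y)) \<in> bumps k (x - b) (x - a)"
  using assms
proof induction
  case (prod p q)
  have "(\<lambda>y. flat p (k * (x - y - a)) * flat q (k * (b - (x - y)))) =
        (\<lambda>y. flat q (k * (y - (x - b))) * flat p (k * ((x - a) - y)))"
    by (simp add: fun_eq_iff algebra_simps)
  then show ?case by (simp only: bumps.prod)
next
  case (add f g)
  show ?case by (rule bumps.add[OF add.IH])
qed

lemma bumps_exp_bound: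
  assumes f: "f \<in> bumps k a b" "k > 0" and "\<sigma> > 0"
  obtains C where "C \<ge> 0" "\<And>x. \<bar>f x\<bar> \<le> C * exp (- \<sigma> * \<bar>x\<bar>)"
proof -
  have c: "continuous_on {a..b} (\<lambda>x. f x * exp (\<sigma> * \<bar>x\<bar>))"
    by (intro continuous_intros DERIV_continuous_on[of _ f "deriv f"] DERIV_subset[OF bumps_has_deriv[OF f(1)]]) auto
  have "bounded ((\<lambda>x. f x * exp (\<sigma> * \<bar>x\<bar>)) ` {a..b})"
    by (intro compact_imp_bounded compact_continuous_image c) simp
  then obtain C where "\<forall>z\<in>(\<lambda>x. f x * exp (\<sigma> * \<bar>x\<bar>)) ` {a..b}. norm z \<le> C"
    unfolding bounded_iff by blast
  then have C: "\<And>x. x \<in> {a..b} \<Longrightarrow> \<bar>f x * exp (\<sigma> * \<bar>x\<bar>)\<bar> \<le> C" by simp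
  have "\<bar>f x\<bar> \<le> max C 0 * exp (- \<sigma> * \<bar>x\<bar>)" for x
  proof (cases "x \<in> {a..b}")
    case True
    then have "\<bar>f x\<bar> * exp (\<sigma> * \<bar>x\<bar>) \<le> max C 0" using C[OF True] by (simp add: abs_mult)
    then show ?thesis by (simp add: exp_minus field_simps)
  next
    case False
    then show ?thesis using bumps_eq_0[OF f, of x] by auto
  qed
  then show thesis by (intro that[of "max C 0"]) auto
qed

lemma bumps_lipschitz:
  assumes f: "f \<in> bumps k a b" "k > 0"
  obtains L where "L \<ge> 0" "\<And>x y. \<bar>f x - f y\<bar> \<le> L * \<bar>x - y\<bar>"
proof -
  obtain L where L: "L \<ge> 0" "\<And>x. \<bar>deriv f x\<bar> \<le> L * exp (- 1 * \<bar>x\<bar>)"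
    using bumps_exp_bound[OF bumps_deriv[OF f(1)] f(2), of 1] by auto
  have "\<bar>deriv f x\<bar> \<le> L" for x
    by (rule order_trans[OF L(2)]) (use L(1) in \<open>auto intro: mult_left_le\<close>)
  then have "norm (f x - f y) \<le> L * norm (x - y)" for x y
    by (intro field_differentiable_bound[of UNIV f "deriv f"] bumps_has_deriv[OF f(1), THEN DERIV_subset]) auto
  then show thesis using that L(1) by auto
qed

definition mollify :: "(real \<Rightarrow> real) \<Rightarrow> (real \<Rightarrow> 'a::euclidean_space) \<Rightarrow> real \<Rightarrow> 'a" where
  "mollify \<rho> u x = (LINT y|lborel. \<rho> (x - y) *\<^sub>R u y)"

lemma exp_kernel_bumps:
  assumes f: "f \<in> bumps k a b" "k > 0" and "\<sigma> > 0"
  obtains C L where "exp_kernel (\<lambda>x v::'a::euclidean_space. f x *\<^sub>R v) C \<sigma> L"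
proof -
  obtain C where C: "C \<ge> 0" "\<And>x. \<bar>f x\<bar> \<le> C * exp (- \<sigma> * \<bar>x\<bar>)" using bumps_exp_bound[OF assms] by blast
  obtain L where L: "L \<ge> 0" "\<And>x y. \<bar>f x - f y\<bar> \<le> L * \<bar>x - y\<bar>" using bumps_lipschitz[OF f] by blast
  have "exp_kernel (\<lambda>x v::'a. f x *\<^sub>R v) C \<sigma> L"
  proof (rule exp_kernel.intro)
    show "linear (\<lambda>v::'a. f x *\<^sub>R v)" for x by (simp add: linear_iff scaleR_add_right)
  qed (use C L assms(3) in \<open>auto simp: scaleR_diff_left[symmetric] intro!: mult_right_mono\<close>)
  then show thesis using that by blast
qed

lemma mollify_facts:
  fixes u :: "real \<Rightarrow> 'a::euclidean_space"
  assumes f: "f \<in> bumps k a b" "k > 0" and u: "sq_int u"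
  shows "integrable lborel (\<lambda>y. f (x - y) *\<^sub>R u y)" "continuous_on UNIV (mollify f u)" "bounded (range (mollify f u))"
proof -
  obtain C L where "exp_kernel (\<lambda>x v::'a. f x *\<^sub>R v) C 1 L" using exp_kernel_bumps[OF f, of 1] by auto
  then interpret exp_kernel "\<lambda>x v::'a. f x *\<^sub>R v" C 1 L .
  have eq: "conv u = mollify f u" by (simp add: conv_def mollify_def fun_eq_iff)
  have e: "exp_integrable 1 u" using exp_integrable_sq_int(1)[OF u] by simp
  show "integrable lborel (\<lambda>y. f (x - y) *\<^sub>R u y)" by (rule integrable_conv[OF e])
  show "continuous_on UNIV (mollify f u)" "bounded (range (mollify f u))"
    using continuous_conv[OF e] bounded_conv_sq_int[OF u] by (simp_all add: eq)
qed

text \<open>Differentiation under the integral from a quadratic Taylor remainder for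
  \<open>f\<close> that carries an exponential weight, the weight being integrable against a square
  integrable \<open>u\<close>.\<close>

lemma mollify_has_vector_derivative:
  fixes u :: "real \<Rightarrow> 'a::euclidean_space"
  assumes f: "f \<in> bumps k a b" "k > 0" and u: "sq_int u"
  shows "(mollify f u has_vector_derivative mollify (deriv f) u x) (at x)"
proof -
  have d: "deriv f \<in> bumps k a b" by (rule bumps_deriv[OF f(1)])
  obtain L where L: "L \<ge> 0" "\<And>x y. \<bar>deriv f x - deriv f y\<bar> \<le> L * \<bar>x - y\<bar>"
    using bumps_lipschitz[OF d f(2)] by blast
  \<comment> \<open>The extra 1 keeps \<open>z + h\<close> outside the support too whenever
    \<open>\<bar>z\<bar> > R\<close> and \<open>\<bar>h\<bar> \<le> 1\<close>.\<close>
  define R where "R = \<bar>a\<bar> + \<bar>b\<bar> + 1"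
  have taylor: "\<bar>f (z + h) - f z - h * deriv f z\<bar> \<le> (L * h\<^sup>2 * exp R) * exp (- 1 * \<bar>z\<bar>)" if h: "\<bar>h\<bar> \<le> 1" for z h
  proof (cases "\<bar>z\<bar> \<le> R")
    case True
    have "\<exists>\<xi>. \<bar>\<xi> - z\<bar> \<le> \<bar>h\<bar> \<and> f (z + h) - f z = h * deriv f \<xi>"
    proof -
      consider "h = 0" | "h > 0" | "h < 0" by linarith
      then show ?thesis
      proof cases
        case 2
        then obtain \<xi> where "z < \<xi>" "\<xi> < z + h" "f (z + h) - f z = (z + h - z) * deriv f \<xi>"
          using MVT2[of z "z + h" f "deriv f"] bumps_has_deriv[OF f(1)] by auto
        then show ?thesis by (intro exI[of _ \<xi>]) auto
      next
        case 3
        then obtain \<xi> where "z + h < \<xi>" "\<xi> < z" "f z - f (z + h) = (z - (z + h)) * deriv f \<xi>"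
          using MVT2[of "z + h" z f "deriv f"] bumps_has_deriv[OF f(1)] by auto
        then show ?thesis by (intro exI[of _ \<xi>]) (auto simp: algebra_simps)
      qed auto
    qed
    then obtain \<xi> where \<xi>: "\<bar>\<xi> - z\<bar> \<le> \<bar>h\<bar>" "f (z + h) - f z = h * deriv f \<xi>" by blast
    have "\<bar>f (z + h) - f z - h * deriv f z\<bar> = \<bar>h\<bar> * \<bar>deriv f \<xi> - deriv f z\<bar>"
      by (simp add: \<xi>(2) abs_mult[symmetric] right_diff_distrib)
    also have "\<dots> \<le> \<bar>h\<bar> * (L * \<bar>h\<bar>)"
      using L(2)[of \<xi> z] mult_left_mono[OF \<xi>(1) L(1)] by (intro mult_left_mono) auto
    also have "\<dots> = L * h\<^sup>2" by (simp add: power2_eq_square)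
    also have "\<dots> \<le> L * h\<^sup>2 * (exp R * exp (- 1 * \<bar>z\<bar>))"
      using True L(1) mult_left_mono[of 1 "exp R * exp (- 1 * \<bar>z\<bar>)" "L * h\<^sup>2"]
      by (simp add: exp_add[symmetric])
    finally show ?thesis by (simp add: mult.assoc)
  next
    case False
    then have "z + h \<le> a \<or> b \<le> z + h" "z \<le> a \<or> b \<le> z" using h unfolding R_def by linarith+
    then have "f (z + h) = 0" "f z = 0" "deriv f z = 0"
      by (blast intro: bumps_eq_0[OF f] bumps_eq_0[OF d f(2)])+
    then show ?thesis using L by simp
  qed
  have e: "exp_integrable 1 u" using exp_integrable_sq_int(1)[OF u] by simp
  define I where "I = (exp_conv 1 u x)"
  have est: "norm (mollify f u (x + h) - mollify f u x - h *\<^sub>R mollify (deriv f) u x) \<le> L * h\<^sup>2 * exp R * I"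
    if h: "\<bar>h\<bar> \<le> 1" for h
  proof -
    have i: "integrable lborel (\<lambda>y. f (x + h - y) *\<^sub>R u y)" "integrable lborel (\<lambda>y. f (x - y) *\<^sub>R u y)"
      "integrable lborel (\<lambda>y. h *\<^sub>R (deriv f (x - y) *\<^sub>R u y))"
      by (intro mollify_facts(1)[OF f u] integrable_scaleR_right[OF mollify_facts(1)[OF d f(2) u]])+
    have eq: "mollify f u (x + h) - mollify f u x - h *\<^sub>R mollify (deriv f) u x =
       (LINT y|lborel. f (x + h - y) *\<^sub>R u y - f (x - y) *\<^sub>R u y - h *\<^sub>R (deriv f (x - y) *\<^sub>R u y))"
      unfolding mollify_def integral_scaleR_right[symmetric]
      by (simp only: Bochner_Integration.integral_diff[OF i(1,2)] Bochner_Integration.integral_diff[OF Bochner_Integration.integrable_diff[OF i(1,2)] i(3)])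
    have "norm (LINT y|lborel. f (x + h - y) *\<^sub>R u y - f (x - y) *\<^sub>R u y - h *\<^sub>R (deriv f (x - y) *\<^sub>R u y))
        \<le> (LINT y|lborel. (L * h\<^sup>2 * exp R) * (exp (- 1 * \<bar>x - y\<bar>) * norm (u y)))"
    proof (rule order_trans[OF integral_norm_bound integral_mono])
      fix y
      have "f (x + h - y) *\<^sub>R u y - f (x - y) *\<^sub>R u y - h *\<^sub>R (deriv f (x - y) *\<^sub>R u y) =
          (f ((x - y) + h) - f (x - y) - h * deriv f (x - y)) *\<^sub>R u y"
        by (simp add: algebra_simps)
      then show "norm (f (x + h - y) *\<^sub>R u y - f (x - y) *\<^sub>R u y - h *\<^sub>R (deriv f (x - y) *\<^sub>R u y))
          \<le> (L * h\<^sup>2 * exp R) * (exp (- 1 * \<bar>x - y\<bar>) * norm (u y))"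
        using mult_right_mono[OF taylor[OF h, of "x - y"], of "norm (u y)"] by (simp add: mult.assoc)
    qed (use i exp_integrable_translate[OF e] in auto)
    also have "\<dots> = L * h\<^sup>2 * exp R * I" unfolding I_def by (rule integral_mult_right_zero)
    finally show ?thesis unfolding eq .
  qed
  show ?thesis
    unfolding has_vector_derivative_def
  proof (rule has_derivativeI_sandwich[where e = 1 and H = "\<lambda>y. \<bar>y - x\<bar> * (L * exp R * I)"])
    show "bounded_linear (\<lambda>h. h *\<^sub>R mollify (deriv f) u x)" by (rule bounded_linear_scaleR_left)
    fix y assume y: "y \<noteq> x" "dist y x < 1"
    have *: "norm (mollify f u y - mollify f u x - (y - x) *\<^sub>R mollify (deriv f) u x) \<le> L * (y - x)\<^sup>2 * exp R * I"
      using est[of "y - x"] y by (simp add: dist_real_def)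
    then show "norm (mollify f u y - mollify f u x - (y - x) *\<^sub>R mollify (deriv f) u x) / norm (y - x) \<le> \<bar>y - x\<bar> * (L * exp R * I)"
    proof -
      have "(y - x)\<^sup>2 = \<bar>y - x\<bar> * \<bar>y - x\<bar>" by (simp add: power2_eq_square)
      then have eq: "L * (y - x)\<^sup>2 * exp R * I = \<bar>y - x\<bar> * (L * exp R * I) * norm (y - x)" by (simp only: ac_simps real_norm_def)
      have "0 < norm (y - x)" using y(1) by simp
      then show ?thesis using * unfolding eq by (simp only: pos_divide_le_eq)
    qed
  next
    have "((\<lambda>y. \<bar>y - x\<bar> * (L * exp R * I)) \<longlongrightarrow> \<bar>x - x\<bar> * (L * exp R * I)) (at x)"
      by (intro tendsto_intros)
    then show "((\<lambda>y. \<bar>y - x\<bar> * (L * exp R * I)) \<longlongrightarrow> 0) (at x)" by simp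
  qed simp
qed

text \<open>A Dynkin argument: open intervals are an intersection-stable generator of the Borel
  sets, and the sets over which \<open>f\<close> integrates to 0 are closed under complement and
  countable disjoint union. Complements use \<open>total\<close>, as the whole line is not a bounded
  interval.\<close>

lemma AE_0_of_interval_integrals_0:
  fixes f :: "real \<Rightarrow> 'a::euclidean_space"
  assumes f: "integrable lborel f"
    and 0: "\<And>a b. a < b \<Longrightarrow> (LINT y|lborel. indicator {a<..<b} y *\<^sub>R f y) = 0"
    and total: "(LINT y|lborel. f y) = 0"
  shows "AE y in lborel. f y = 0"
proof (rule sigma_finite_measure.density_zero[OF lborel.sigma_finite_measure_axioms f])
  fix A :: "real set" assume "A \<in> sets lborel"
  have sb: "sigma_sets UNIV (range (\<lambda>(a, b). {a <..< b::real})) = sets borel"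
    by (subst borel_eq_box) (simp add: case_prod_beta')
  have A: "A \<in> sigma_sets UNIV (range (\<lambda>(a, b). {a <..< b::real}))" using \<open>A \<in> sets lborel\<close> by (simp add: sb)
  have si: "set_integrable lborel A f" if "A \<in> sets lborel" for A
    using integrable_mult_indicator[OF that f] by (simp add: set_integrable_def)
  show "(LINT y:A|lborel. f y) = 0"
  proof (rule sigma_sets_induct_disjoint[where A = A and \<Omega> = UNIV and G = "range (\<lambda>(a, b). {a <..< b::real})"])
    show "Int_stable (range (\<lambda>(a, b). {a <..< b::real}))"
      by (auto simp: Int_stable_def greaterThanLessThan_def[symmetric] intro!: exI[of _ "max _ _"] exI[of _ "min _ _"])
  next
    fix S assume "S \<in> range (\<lambda>(a, b). {a <..< b::real})"
    then obtain a b where "S = {a<..<b}" by auto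
    then show "(LINT y:S|lborel. f y) = 0"
      using 0[of a b] by (cases "a < b") (auto simp: set_lebesgue_integral_def)
  next
    fix S assume "S \<in> sigma_sets UNIV (range (\<lambda>(a, b). {a <..< b::real}))" and S0: "(LINT y:S|lborel. f y) = 0"
    then have S: "S \<in> sets lborel" by (simp add: sb)
    have "(LINT y:S \<union> (UNIV - S)|lborel. f y) = (LINT y:S|lborel. f y) + (LINT y:UNIV - S|lborel. f y)"
      using S by (intro set_integral_Un si) auto
    then show "(LINT y:UNIV - S|lborel. f y) = 0"
      using S0 total by (simp add: set_lebesgue_integral_def)
  next
    fix S :: "nat \<Rightarrow> real set"
    assume d: "disjoint_family S" and r: "range S \<subseteq> sigma_sets UNIV (range (\<lambda>(a, b). {a <..< b::real}))"
      and S0: "\<And>i. (LINT y:S i|lborel. f y) = 0"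
    have S: "S i \<in> sets lborel" for i using r by (auto simp: sb)
    have "(LINT y:(\<Union>i. S i)|lborel. f y) = (\<Sum>i. (LINT y:S i|lborel. f y))"
      using S d by (intro lebesgue_integral_countable_add si) (auto simp: disjoint_family_on_def)
    then show "(LINT y:(\<Union>i. S i)|lborel. f y) = 0" by (simp add: S0)
  qed (use A in \<open>auto simp: set_lebesgue_integral_def\<close>)
qed

text \<open>Not normalised to mass 1: as \<open>k\<close> grows it approaches the indicator of an
  open interval, and no approximate identity is used in the proof.\<close>

definition bump :: "real \<Rightarrow> real \<Rightarrow> real \<Rightarrow> real \<Rightarrow> real" where
  "bump k a b x = flat 1 (k * (x - a)) * flat 1 (k * (b - x))"

lemma bump_in_bumps: "bump k a b \<in> bumps k a b"
  unfolding bump_def[abs_def] by (rule bumps.prod)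

lemma flat_1_bounds: "0 \<le> flat 1 x" "flat 1 x \<le> 1"
  by (auto simp: flat_def)

lemma flat_1_tendsto: "x > 0 \<Longrightarrow> (\<lambda>k. flat 1 (real (Suc k) * x)) \<longlonglongrightarrow> 1"
proof -
  assume x: "x > 0"
  have "(\<lambda>k. exp (- ((1 / x) / real (Suc k)))) \<longlonglongrightarrow> exp (- 0)"
    using LIMSEQ_Suc[OF lim_const_over_n[of "1 / x"]] by (intro tendsto_intros)
  then show ?thesis using x by (simp add: flat_def zero_less_mult_iff mult.commute)
qed

lemma bump_tendsto_indicator: "(\<lambda>k. bump (real (Suc k)) a b x) \<longlonglongrightarrow> indicator {a<..<b} x"
proof (cases "x \<in> {a<..<b}")
  case True
  then have "(\<lambda>k. bump (real (Suc k)) a b x) \<longlonglongrightarrow> 1 * 1"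
    unfolding bump_def by (intro tendsto_mult flat_1_tendsto) auto
  then show ?thesis using True by simp
next
  case False
  then have "bump (real (Suc k)) a b x = 0" for k
    by (intro bumps_eq_0[OF bump_in_bumps]) auto
  then show ?thesis using False by simp
qed

text \<open>The fundamental lemma of the calculus of variations for one explicit family: steep bumps
  converge to indicators of intervals, dominated by \<open>v\<close> on the closed interval.\<close>

lemma AE_0_of_bump_integrals_0:
  fixes v :: "real \<Rightarrow> 'a::euclidean_space"
  assumes v: "sq_int v"
    and 0: "\<And>k a b. k > 0 \<Longrightarrow> (LINT y|lborel. bump k a b y *\<^sub>R v y) = 0"
  shows "AE y in lborel. v y = 0"
proof -
  have [measurable]: "v \<in> borel_measurable borel" using v by (simp add: sq_int_def)
  have vint: "integrable lborel (\<lambda>y. indicator {a..b} y *\<^sub>R v y)" for a b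
  proof (rule Bochner_Integration.integrable_bound)
    show "integrable lborel (\<lambda>y. indicator {a..b} y *\<^sub>R 1 + (norm (v y))\<^sup>2)"
      using v by (intro Bochner_Integration.integrable_add integrable_scaleR_left integrable_real_indicator)
        (auto simp: sq_int_def emeasure_lborel_Icc_eq)
    have "norm (v y) \<le> 1 + (norm (v y))\<^sup>2" for y
      using sum_squares_bound[of 1 "norm (v y)"] by (simp add: add_increasing2) (smt (verit) norm_ge_zero)
    then show "AE y in lborel. norm (indicator {a..b} y *\<^sub>R v y) \<le> norm (indicator {a..b} y *\<^sub>R 1 + (norm (v y))\<^sup>2)"
      by (intro AE_I2) (auto simp: indicator_def)
  qed measurable
  have oo: "(LINT y|lborel. indicator {a<..<b} y *\<^sub>R v y) = 0" for a b
  proof -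
    have "(\<lambda>k. LINT y|lborel. bump (real (Suc k)) a b y *\<^sub>R v y) \<longlonglongrightarrow> (LINT y|lborel. indicator {a<..<b} y *\<^sub>R v y)"
    proof (rule integral_dominated_convergence[where w = "\<lambda>y. norm (indicator {a..b} y *\<^sub>R v y)"])
      have "bump k a b \<in> borel_measurable borel" for k by (rule bumps_measurable[OF bump_in_bumps])
      then show "(\<lambda>y. bump (real (Suc k)) a b y *\<^sub>R v y) \<in> borel_measurable lborel" for k by measurable
      show "AE y in lborel. (\<lambda>k. bump (real (Suc k)) a b y *\<^sub>R v y) \<longlonglongrightarrow> indicator {a<..<b} y *\<^sub>R v y"
        by (intro AE_I2 tendsto_scaleR tendsto_const bump_tendsto_indicator)
      show "AE y in lborel. norm (bump (real (Suc k)) a b y *\<^sub>R v y) \<le> norm (indicator {a..b} y *\<^sub>R v y)" for k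
      proof (rule AE_I2)
        fix y
        have "\<bar>bump (real (Suc k)) a b y\<bar> \<le> indicator {a..b} y"
        proof (cases "y \<in> {a..b}")
          case True
          then show ?thesis using flat_1_bounds by (simp add: bump_def abs_mult mult_le_one)
        next
          case False
          then have "bump (real (Suc k)) a b y = 0" by (intro bumps_eq_0[OF bump_in_bumps]) auto
          then show ?thesis by simp
        qed
        then show "norm (bump (real (Suc k)) a b y *\<^sub>R v y) \<le> norm (indicator {a..b} y *\<^sub>R v y)"
          by (simp add: mult_right_mono)
      qed
    qed (use integrable_norm[OF vint] vint in auto)
    then show ?thesis using 0[of "real (Suc _)"] by (simp add: LIMSEQ_const_iff)
  qed
  \<comment> \<open>A square integrable \<open>v\<close> is integrable only locally, so it is cut
    off before the criterion for integrable functions applies.\<close>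
  have "AE y in lborel. indicator {-real n<..<real n} y *\<^sub>R v y = 0" for n
  proof (rule AE_0_of_interval_integrals_0)
    show "integrable lborel (\<lambda>y. indicator {-real n<..<real n} y *\<^sub>R v y)"
      by (rule Bochner_Integration.integrable_bound[OF vint[of "-real n" "real n"]])
        (auto simp: indicator_def)
    show "(LINT y|lborel. indicator {a<..<b} y *\<^sub>R (indicator {-real n<..<real n} y *\<^sub>R v y)) = 0" for a b
    proof -
      have "indicator {a<..<b} y *\<^sub>R (indicator {-real n<..<real n} y *\<^sub>R v y) =
          indicator {max a (-real n)<..<min b (real n)} y *\<^sub>R v y" for y
        by (auto simp: indicator_def)
      then show ?thesis by (simp only: oo)
    qed
  qed (rule oo)
  then have "AE y in lborel. \<forall>n. indicator {-real n<..<real n} y *\<^sub>R v y = 0"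
    unfolding AE_all_countable by blast
  then show ?thesis
  proof eventually_elim
    case (elim y)
    obtain n where "\<bar>y\<bar> < real n" using reals_Archimedean2 by blast
    then have "y \<in> {-real n<..<real n}" by auto
    then show ?case using elim[rule_format, of n] by simp
  qed
qed

context diag_op_kernel
begin

text \<open>Substitution moves the translation from the kernel to \<open>h\<close>; both sides are
  then iterated integrals of the same \<open>\<Theta>\<close>, and Fubini exchanges them.\<close>

lemma mollify_conv_commute:
  assumes f: "f \<in> bumps k a b" "k > 0" and h: "sq_int h"
  shows "conv (mollify f h) x = mollify f (conv h) x"
proof -
  have [measurable]: "h \<in> borel_measurable borel" using h by (simp add: sq_int_def)
  have [measurable]: "f \<in> borel_measurable borel" by (rule bumps_measurable[OF f(1)])
  have e: "exp_integrable \<sigma> h" using exp_integrable_sq_int(1)[OF h \<sigma>_pos] .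
  obtain C' where C': "C' \<ge> 0" "\<And>x. \<bar>f x\<bar> \<le> C' * exp (- \<sigma> * \<bar>x\<bar>)" using bumps_exp_bound[OF f \<sigma>_pos] by blast
  define \<Theta> where "\<Theta> y z = f (x - y) *\<^sub>R G z (h (y - z))" for y z
  have G_int: "G z (LINT y|lborel. u y) = (LINT y|lborel. G z (u y))" if "integrable lborel u" for z and u :: "real \<Rightarrow> complex^2"
    using integral_bounded_linear[OF _ that, of "G z"] lin by (simp add: linear_conv_bounded_linear)
  have sub: "(LINT z|lborel. u z) = (LINT y|lborel. u (c - y))" for u :: "real \<Rightarrow> complex^2" and c
    by (subst lborel_integral_real_affine[where c = "-1" and t = c]) auto
  have conv_sub: "conv h y = (LINT z|lborel. G z (h (y - z)))" for y
    unfolding conv_def by (subst sub[where c = y]) simp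
  have "conv (mollify f h) x = (LINT z|lborel. G z (mollify f h (x - z)))"
    unfolding conv_def by (subst sub[where c = x]) simp
  also have "\<dots> = (LINT z|lborel. LINT y|lborel. \<Theta> y z)"
  proof (intro Bochner_Integration.integral_cong refl)
    fix z
    have 1: "mollify f h (x - z) = (LINT y|lborel. f (x - y) *\<^sub>R h (y - z))"
      unfolding mollify_def
      by (subst lborel_integral_real_affine[where c = 1 and t = "- z"]) (auto simp: algebra_simps)
    have "integrable lborel (\<lambda>y. f (x - z - (- z + 1 * y)) *\<^sub>R h (- z + 1 * y))"
      by (rule lborel_integrable_real_affine[OF mollify_facts(1)[OF f h]]) simp
    then have "integrable lborel (\<lambda>y. f (x - y) *\<^sub>R h (y - z))" by (simp add: algebra_simps)
    then show "G z (mollify f h (x - z)) = (LINT y|lborel. \<Theta> y z)"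
      unfolding 1 by (subst G_int) (auto simp: \<Theta>_def linear_scale[OF lin])
  qed
  also have "\<dots> = (LINT y|lborel. LINT z|lborel. \<Theta> y z)"
  proof (rule lborel_pair.Fubini_integral)
    have meas: "case_prod \<Theta> \<in> borel_measurable (lborel \<Otimes>\<^sub>M lborel)" unfolding \<Theta>_def by measurable
    let ?C = "1 / norm s + 1 / norm t"
    have iz: "integrable lborel (\<lambda>z. G z (h (y - z)))" for y
      using lborel_integrable_real_affine[OF integrable_conv[OF e, of y], of "-1" y] by simp
    \<comment> \<open>The inner integral is bounded uniformly apart from the decay of
      \<open>f\<close>, which makes the outer one finite.\<close>
    have inner: "(LINT z|lborel. norm (\<Theta> y z)) \<le> (C' * exp (- \<sigma> * \<bar>x - y\<bar>)) * (?C * (1 / \<sigma> + (LINT y|lborel. (norm (h y))\<^sup>2)))" for y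
    proof -
      have ih: "integrable lborel (\<lambda>z. exp (- \<sigma> * \<bar>y - z\<bar>) * norm (h z))" using exp_integrable_translate[OF e] \<sigma>_pos by simp
      have "(LINT z|lborel. norm (\<Theta> y z)) = \<bar>f (x - y)\<bar> * (LINT z|lborel. norm (G z (h (y - z))))"
        by (simp add: \<Theta>_def)
      also have "(LINT z|lborel. norm (G z (h (y - z)))) = (LINT z|lborel. norm (G (y - z) (h z)))"
        by (subst lborel_integral_real_affine[where c = "-1" and t = y]) auto
      also have "\<dots> \<le> (LINT z|lborel. ?C * (exp (- \<sigma> * \<bar>y - z\<bar>) * norm (h z)))"
        using bound by (intro integral_mono integrable_norm integrable_conv e integrable_mult_right ih) (simp add: mult.assoc)
      also have "\<dots> \<le> ?C * (1 / \<sigma> + (LINT y|lborel. (norm (h y))\<^sup>2))"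
        unfolding integral_mult_right_zero
        by (intro mult_left_mono exp_integrable_sq_int(2)[OF h \<sigma>_pos] C_nonneg)
      finally have "(LINT z|lborel. norm (\<Theta> y z)) \<le> \<bar>f (x - y)\<bar> * (?C * (1 / \<sigma> + (LINT y|lborel. (norm (h y))\<^sup>2)))"
        by (simp add: mult_left_mono)
      also have "\<dots> \<le> (C' * exp (- \<sigma> * \<bar>x - y\<bar>)) * (?C * (1 / \<sigma> + (LINT y|lborel. (norm (h y))\<^sup>2)))"
        using C' C_nonneg \<sigma>_pos by (intro mult_right_mono) auto
      finally show ?thesis .
    qed
    show "integrable (lborel \<Otimes>\<^sub>M lborel) (\<lambda>(y, z). \<Theta> y z)"
    proof (rule lborel_pair.Fubini_integrable)
      show "integrable lborel (\<lambda>y. LINT z|lborel. norm (case (y, z) of (y, z) \<Rightarrow> \<Theta> y z))"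
      proof (rule Bochner_Integration.integrable_bound)
        show "integrable lborel (\<lambda>y. (C' * exp (- \<sigma> * \<bar>x - y\<bar>)) * (?C * (1 / \<sigma> + (LINT y|lborel. (norm (h y))\<^sup>2))))"
          by (intro integrable_mult_left integrable_mult_right integrable_exp_abs \<sigma>_pos)
        show "(\<lambda>y. LINT z|lborel. norm (case (y, z) of (y, z) \<Rightarrow> \<Theta> y z)) \<in> borel_measurable lborel"
          using meas by measurable
        show "AE y in lborel. norm (LINT z|lborel. norm (case (y, z) of (y, z) \<Rightarrow> \<Theta> y z))
            \<le> norm ((C' * exp (- \<sigma> * \<bar>x - y\<bar>)) * (?C * (1 / \<sigma> + (LINT y|lborel. (norm (h y))\<^sup>2))))"
        proof (rule AE_I2)
          fix y
          have "norm (LINT z|lborel. norm (case (y, z) of (y, z) \<Rightarrow> \<Theta> y z)) = (LINT z|lborel. norm (\<Theta> y z))" by simp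
          also note inner[of y]
          also note abs_ge_self
          finally show "norm (LINT z|lborel. norm (case (y, z) of (y, z) \<Rightarrow> \<Theta> y z))
            \<le> norm ((C' * exp (- \<sigma> * \<bar>x - y\<bar>)) * (?C * (1 / \<sigma> + (LINT y|lborel. (norm (h y))\<^sup>2))))"
            by (simp only: real_norm_def)
        qed
      qed
      show "AE y in lborel. integrable lborel (\<lambda>z. case (y, z) of (y, z) \<Rightarrow> \<Theta> y z)"
        using iz by (auto simp: \<Theta>_def)
    qed (rule meas)
  qed
  also have "\<dots> = mollify f (conv h) x"
    unfolding mollify_def conv_sub \<Theta>_def by simp
  finally show ?thesis .
qed

text \<open>For every bump \<open>f\<close> the mollified \<open>u\<close> solves the equation
  classically with source \<open>mollify f h\<close>. No limit in \<open>f\<close> is taken: as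
  mollification commutes with \<open>conv\<close>, the difference \<open>u - conv h\<close>
  integrates to 0 against all bumps.\<close>

lemma weak_solution_eq_conv:
  assumes u: "sq_int u" "sq_int u1" "sq_int u2" and wd: "weak_deriv u u1" "weak_deriv u1 u2"
    and h: "sq_int h" and eq: "AE x in lborel. u2 x = diag_op (s\<^sup>2) (t\<^sup>2) (u x) - h x"
  shows "AE x in lborel. u x = conv h x"
proof -
  have [measurable]: "u \<in> borel_measurable borel" "h \<in> borel_measurable borel" "u2 \<in> borel_measurable borel"
    using u h by (auto simp: sq_int_def)
  have dgm [measurable]: "diag_op c d \<in> borel_measurable borel" for c d
    by (intro borel_measurable_continuous_onI linear_continuous_on bounded_linear_diag_op)
  have moll: "mollify f u x = conv (mollify f h) x" if f: "f \<in> bumps k a b" "k > 0" for f k a b x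
  proof -
    have d: "deriv f \<in> bumps k a b" by (rule bumps_deriv[OF f(1)])
    \<comment> \<open>Reflecting the argument flips the sign of the derivative, which cancels the
      sign in the definition of the weak derivative.\<close>
    have weak: "mollify (deriv f) v x = mollify f v1 x" if "weak_deriv v v1" for v v1 x
    proof -
      have dr: "deriv (\<lambda>y. f (x - y)) y = - deriv f (x - y)" for y
        by (rule DERIV_imp_deriv)
          (rule DERIV_cong[OF DERIV_chain'[OF _ bumps_has_deriv[OF f(1)]]], auto intro!: derivative_eq_intros)
      have "test_fun (\<lambda>y. f (x - y))" by (rule test_fun_bumps[OF bumps_reflect[OF f(1)] f(2)])
      then have "(LINT y|lborel. deriv (\<lambda>y. f (x - y)) y *\<^sub>R v y) = - (LINT y|lborel. f (x - y) *\<^sub>R v1 y)"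
        using that unfolding weak_deriv_def by blast
      then show ?thesis by (simp add: dr mollify_def)
    qed
    have U: "(mollify f u has_vector_derivative mollify f u1 x) (at x)" for x
      using mollify_has_vector_derivative[OF f u(1), of x] weak[OF wd(1)] by simp
    have U1: "(mollify f u1 has_vector_derivative mollify f u2 x) (at x)" for x
      using mollify_has_vector_derivative[OF f u(2), of x] weak[OF wd(2)] by simp
    have U2: "mollify f u2 x = diag_op (s\<^sup>2) (t\<^sup>2) (mollify f u x) - mollify f h x" for x
    proof -
      note bl = bounded_linear_diag_op[of "s\<^sup>2" "t\<^sup>2"]
      have iu: "integrable lborel (\<lambda>y. diag_op (s\<^sup>2) (t\<^sup>2) (f (x - y) *\<^sub>R u y))"
        by (rule integrable_bounded_linear[OF bl mollify_facts(1)[OF f u(1)]])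
      have [measurable]: "f \<in> borel_measurable borel" by (rule bumps_measurable[OF f(1)])
      have "mollify f u2 x = (LINT y|lborel. diag_op (s\<^sup>2) (t\<^sup>2) (f (x - y) *\<^sub>R u y) - f (x - y) *\<^sub>R h y)"
        unfolding mollify_def
      proof (rule integral_cong_AE)
        show "AE y in lborel. f (x - y) *\<^sub>R u2 y = diag_op (s\<^sup>2) (t\<^sup>2) (f (x - y) *\<^sub>R u y) - f (x - y) *\<^sub>R h y"
          using eq by eventually_elim (simp add: linear_scale[OF linear_diag_op] scaleR_diff_right)
      qed measurable
      also have "\<dots> = diag_op (s\<^sup>2) (t\<^sup>2) (mollify f u x) - mollify f h x"
        unfolding Bochner_Integration.integral_diff[OF iu mollify_facts(1)[OF f h]] mollify_def
        by (simp only: integral_bounded_linear[OF bl mollify_facts(1)[OF f u(1)]])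
      finally show ?thesis .
    qed
    define H where "H = mollify f h"
    have H: "continuous_on UNIV H" "bounded (range H)" unfolding H_def by (rule mollify_facts[OF f h])+
    then obtain B where B: "\<And>y. norm (H y) \<le> B" by (auto simp: bounded_iff)
    have He: "exp_integrable \<sigma> H"
      using H B by (intro exp_integrable_bounded borel_measurable_continuous_onI) (auto simp: \<sigma>_pos)
    obtain B1 B2 where B12: "\<And>y. norm (mollify f u y) \<le> B1" "\<And>y. norm (mollify f u1 y) \<le> B2"
      using mollify_facts(3)[OF f u(1)] mollify_facts(3)[OF f u(2)] by (auto simp: bounded_iff)
    have B3: "norm (conv H y) \<le> (1 / norm s + 1 / norm t) * (B * (2 / \<sigma>))" for y
      using H B by (intro norm_conv_bounded borel_measurable_continuous_onI) auto
    have B4: "norm (conv_deriv H y) \<le> 4 * (B * (2 / \<sigma>))" for y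
      using norm_conv_deriv_le[OF He, of y]
        exp_integrable_bounded(2)[OF borel_measurable_continuous_onI[OF H(1)] B \<sigma>_pos, of y] by linarith
    define B' where "B' = max (B1 + (1 / norm s + 1 / norm t) * (B * (2 / \<sigma>))) (B2 + 4 * (B * (2 / \<sigma>)))"
    \<comment> \<open>Both functions are bounded with bounded derivatives and solve the equation
      with source \<open>H\<close>, so their difference is a bounded solution of the homogeneous
      one.\<close>
    have "mollify f u x - conv H x = 0"
    proof (rule diag_op_ode_bounded_unique[OF _ _ _ _ s t])
      show "((\<lambda>x. mollify f u x - conv H x) has_vector_derivative mollify f u1 x - conv_deriv H x) (at x)" for x
        by (intro has_vector_derivative_diff U conv_has_vector_derivative(1)[OF H(1) B])
      have "mollify f u2 x - (diag_op (s\<^sup>2) (t\<^sup>2) (conv H x) - H x) = diag_op (s\<^sup>2) (t\<^sup>2) (mollify f u x - conv H x)" for x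
        by (simp add: U2 H_def linear_diff[OF linear_diag_op])
      then show "((\<lambda>x. mollify f u1 x - conv_deriv H x) has_vector_derivative diag_op (s\<^sup>2) (t\<^sup>2) (mollify f u x - conv H x)) (at x)" for x
        using has_vector_derivative_diff[OF U1 conv_has_vector_derivative(2)[OF H(1) B]] by simp
      show "norm (mollify f u x - conv H x) \<le> B'" for x
        using B12(1)[of x] B3[of x] norm_triangle_ineq4[of "mollify f u x" "conv H x"] by (simp add: B'_def)
      show "norm (mollify f u1 x - conv_deriv H x) \<le> B'" for x
        using B12(2)[of x] B4[of x] norm_triangle_ineq4[of "mollify f u1 x" "conv_deriv H x"] by (simp add: B'_def)
    qed
    then show ?thesis by (simp add: H_def)
  qed
  have ch: "sq_int (conv h)" by (rule sq_int_conv[OF h])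
  have "AE x in lborel. u x - conv h x = 0"
  proof (rule AE_0_of_bump_integrals_0)
    have "sq_int (\<lambda>x. - conv h x)" using ch by (auto simp: sq_int_def)
    then show "sq_int (\<lambda>x. u x - conv h x)" using sq_int_add[OF u(1)] by fastforce
    fix k a b :: real assume k: "k > 0"
    \<comment> \<open>Reflected so that mollifying at 0 is integration against
      \<open>bump k a b\<close>.\<close>
    define f where "f = bump k (- b) (- a)"
    have f: "f \<in> bumps k (- b) (- a)" unfolding f_def by (rule bump_in_bumps)
    have fb: "f (0 - y) = bump k a b y" for y by (simp add: f_def bump_def algebra_simps)
    have "mollify f u 0 = mollify f (conv h) 0"
      using moll[OF f k] mollify_conv_commute[OF f k h] by simp
    then have "(LINT y|lborel. f (0 - y) *\<^sub>R u y) - (LINT y|lborel. f (0 - y) *\<^sub>R conv h y) = 0"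
      by (simp add: mollify_def)
    then show "(LINT y|lborel. bump k a b y *\<^sub>R (u y - conv h y)) = 0"
      using Bochner_Integration.integral_diff[OF mollify_facts(1)[OF f k u(1), of 0] mollify_facts(1)[OF f k ch, of 0]]
      by (simp only: fb scaleR_diff_right)
  qed
  then show ?thesis by simp
qed

end

lemma weak_deriv_of_has_vector_derivative:
  assumes w: "\<And>x. (w has_vector_derivative w1 x) (at x)" and c: "continuous_on UNIV w1"
  shows "weak_deriv w w1"
  unfolding weak_deriv_def
proof (intro allI impI)
  fix \<phi> assume \<phi>: "test_fun \<phi>"
  then obtain R0 where R0: "\<And>x. R0 < \<bar>x\<bar> \<Longrightarrow> \<phi> x = 0" by (auto simp: test_fun_def)
  \<comment> \<open>The test function is known to vanish only for \<open>R0 < \<bar>x\<bar>\<close>;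
    going strictly beyond makes the boundary terms at \<open>R\<close> and \<open>-R\<close>
    zero.\<close>
  define R where "R = \<bar>R0\<bar> + 1"
  have "((deriv ^^ n) \<phi>) differentiable (at x)" for n x using \<phi> by (auto simp: test_fun_def)
  from this[of 0] this[of "Suc 0"]
  have d: "(\<phi> has_real_derivative deriv \<phi> x) (at x)" and d2: "deriv \<phi> differentiable (at x)" for x
    by (simp_all add: DERIV_deriv_iff_real_differentiable)
  have c\<phi>: "continuous_on UNIV \<phi>" by (rule DERIV_continuous_on, rule DERIV_subset[OF d], simp)
  have cd: "continuous_on UNIV (deriv \<phi>)"
    using d2 by (intro differentiable_imp_continuous_on) (auto simp: differentiable_on_def intro: differentiable_at_withinI)
  have cw: "continuous_on UNIV w"
    by (rule continuous_on_vector_derivative) (use w in \<open>auto intro: has_vector_derivative_at_within\<close>)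
  have 0: "\<phi> x = 0" "deriv \<phi> x = 0" if "x \<notin> {-R..R}" for x
  proof -
    show "\<phi> x = 0" using that by (intro R0) (auto simp: R_def)
    have "(\<phi> has_real_derivative 0) (at x)"
      by (rule has_field_derivative_transform_within_open[where f = "\<lambda>_. 0" and S = "{x. R0 < \<bar>x\<bar>}"])
        (use that in \<open>auto simp: R_def R0 intro!: open_Collect_less continuous_intros\<close>)
    then show "deriv \<phi> x = 0" by (rule DERIV_imp_deriv)
  qed
  have i: "integrable lborel (\<lambda>x. indicator {-R..R} x *\<^sub>R (deriv \<phi> x *\<^sub>R w x))"
      "integrable lborel (\<lambda>x. indicator {-R..R} x *\<^sub>R (\<phi> x *\<^sub>R w1 x))"
    by (intro borel_integrable_compact continuous_intros continuous_on_subset[OF cd] continuous_on_subset[OF cw]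
        continuous_on_subset[OF c\<phi>] continuous_on_subset[OF c]; simp)+
  have e: "indicator {-R..R} x *\<^sub>R (deriv \<phi> x *\<^sub>R w x) = deriv \<phi> x *\<^sub>R w x"
     "indicator {-R..R} x *\<^sub>R (\<phi> x *\<^sub>R w1 x) = \<phi> x *\<^sub>R w1 x" for x
    using 0[of x] by (auto simp: indicator_def)
  have "(LINT x|lborel. indicator {-R..R} x *\<^sub>R (\<phi> x *\<^sub>R w1 x + deriv \<phi> x *\<^sub>R w x)) = \<phi> R *\<^sub>R w R - \<phi> (-R) *\<^sub>R w (-R)"
  proof (rule integral_FTC_Icc)
    show "-R \<le> R" by (simp add: R_def)
    show "((\<lambda>x. \<phi> x *\<^sub>R w x) has_vector_derivative \<phi> x *\<^sub>R w1 x + deriv \<phi> x *\<^sub>R w x) (at x within {-R..R})" for x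
      by (rule has_vector_derivative_scaleR[OF DERIV_subset[OF d] has_vector_derivative_at_within[OF w]]) simp
    show "continuous_on {-R..R} (\<lambda>x. \<phi> x *\<^sub>R w1 x + deriv \<phi> x *\<^sub>R w x)"
      by (intro continuous_intros continuous_on_subset[OF cd] continuous_on_subset[OF cw]
        continuous_on_subset[OF c\<phi>] continuous_on_subset[OF c]) auto
  qed
  also have "\<phi> R = 0" by (rule R0) (simp add: R_def)
  also have "\<phi> (-R) = 0" by (rule R0) (simp add: R_def)
  finally have "(LINT x|lborel. deriv \<phi> x *\<^sub>R w x) + (LINT x|lborel. \<phi> x *\<^sub>R w1 x) = 0"
    using Bochner_Integration.integral_add[OF i(2,1)] by (simp only: scaleR_add_right e scaleR_zero_left diff_0_right add.commute)
  then show "(LINT x|lborel. deriv \<phi> x *\<^sub>R w x) = - (LINT x|lborel. \<phi> x *\<^sub>R w1 x)" by (simp add: eq_neg_iff_add_eq_0)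
qed

subsection \<open>Square roots of positive semidefinite 2x2 matrices\<close>

lemma mat22_eq_iff: "(A::complex^2^2) = B \<longleftrightarrow> A$1$1 = B$1$1 \<and> A$1$2 = B$1$2 \<and> A$2$1 = B$2$1 \<and> A$2$2 = B$2$2"
  by (auto simp: vec_eq_iff forall_2)

lemma matrix_mult_22: "((A::complex^2^2) ** B) $ i $ j = A$i$1 * B$1$j + A$i$2 * B$2$j"
  by (simp add: matrix_matrix_mult_def sum_2)

lemma matrix_vector_22: "((A::complex^2^2) *v v) $ i = A$i$1 * v$1 + A$i$2 * v$2"
  by (simp add: matrix_vector_mult_def sum_2)

lemma cadj_nth [simp]: "cadj A $ i $ j = cnj (A $ j $ i)"
  by (simp add: cadj_def)

lemma mat1_22: "(mat 1 :: complex^2^2) $ i $ j = (if i = j then 1 else 0)"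
  by (simp add: mat_def)

lemma quadratic_form_22:
  "(\<Sum>i\<in>UNIV. cnj (v $ i) * ((S::complex^2^2) *v v) $ i) =
    S$1$1 * (cnj (v$1) * v$1) + S$1$2 * (cnj (v$1) * v$2) + S$2$1 * (cnj (v$2) * v$1) + S$2$2 * (cnj (v$2) * v$2)"
  by (simp add: sum_2 matrix_vector_22 algebra_simps)

definition herm :: "real \<Rightarrow> complex \<Rightarrow> real \<Rightarrow> complex^2^2" where
  "herm p b q = vector [vector [of_real p, b], vector [cnj b, of_real q]]"

lemma herm_nth [simp]: "herm p b q $ 1 $ 1 = of_real p" "herm p b q $ 1 $ 2 = b"
  "herm p b q $ 2 $ 1 = cnj b" "herm p b q $ 2 $ 2 = of_real q"
  by (simp_all add: herm_def)

lemma quadratic_form_herm: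
  "Re (\<Sum>i\<in>UNIV. cnj (v $ i) * (herm p b q *v v) $ i) = p * (cmod (v$1))\<^sup>2 + q * (cmod (v$2))\<^sup>2 + 2 * Re (b * (cnj (v$1) * v$2))"
  unfolding quadratic_form_22 cmod_power2
  by (simp add: power2_eq_square algebra_simps)

lemma hermitian_psd_herm:
  assumes "p \<ge> 0" "q \<ge> 0" "(cmod b)\<^sup>2 \<le> p * q"
  shows "hermitian_psd (herm p b q)"
  unfolding hermitian_psd_def quadratic_form_herm
proof (intro conjI allI)
  show "cadj (herm p b q) = herm p b q" by (simp add: mat22_eq_iff)
  fix v :: "complex^2"
  have "cmod b \<le> sqrt (p * q)" using assms by (simp add: real_le_rsqrt)
  then have "cmod b * (cmod (v$1) * cmod (v$2)) \<le> sqrt p * sqrt q * (cmod (v$1) * cmod (v$2))"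
    by (simp add: real_sqrt_mult mult_right_mono)
  moreover have "- (cmod b * (cmod (v$1) * cmod (v$2))) \<le> Re (b * (cnj (v$1) * v$2))"
    using complex_Re_le_cmod[of "- (b * (cnj (v$1) * v$2))"] by (simp add: norm_mult)
  moreover have "0 \<le> (sqrt p * cmod (v$1) - sqrt q * cmod (v$2))\<^sup>2" by simp
  then have "2 * (sqrt p * sqrt q * (cmod (v$1) * cmod (v$2))) \<le> p * (cmod (v$1))\<^sup>2 + q * (cmod (v$2))\<^sup>2"
    using assms by (simp add: power2_diff power_mult_distrib mult_ac)
  ultimately show "0 \<le> p * (cmod (v$1))\<^sup>2 + q * (cmod (v$2))\<^sup>2 + 2 * Re (b * (cnj (v$1) * v$2))" by linarith
qed

text \<open>The form at \<open>(1, 0)\<close> and \<open>(0, 1)\<close> gives the diagonal entries;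
  at \<open>(- b, p)\<close> and \<open>(q, - cnj b)\<close> it gives \<open>p\<close> and
  \<open>q\<close> times the determinant, which settles the last inequality unless both
  vanish.\<close>

lemma hermitian_psdE:
  assumes "hermitian_psd S"
  obtains p b q where "S = herm p b q" "p \<ge> 0" "q \<ge> 0" "(cmod b)\<^sup>2 \<le> p * q"
proof -
  define p q b where "p = Re (S$1$1)" and "q = Re (S$2$2)" and "b = S$1$2"
  have adj: "cadj S = S" using assms by (simp add: hermitian_psd_def)
  then have "cnj (S$1$1) = S$1$1" "cnj (S$2$2) = S$2$2" "cnj (S$1$2) = S$2$1"
    by (metis cadj_nth)+
  then have S: "S = herm p b q"
    by (auto simp: mat22_eq_iff p_def q_def b_def complex_eq_iff)
  have Q: "0 \<le> p * (cmod x)\<^sup>2 + q * (cmod y)\<^sup>2 + 2 * Re (b * (cnj x * y))" for x y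
  proof -
    have "0 \<le> Re (\<Sum>i\<in>UNIV. cnj (vector [x, y] $ i) * (S *v vector [x, y]) $ i)"
      using assms by (simp only: hermitian_psd_def)
    then show ?thesis unfolding S quadratic_form_herm by simp
  qed
  have p: "0 \<le> p" using Q[of 1 0] by simp
  have q: "0 \<le> q" using Q[of 0 1] by simp
  have 1: "0 \<le> p * (p * q - (cmod b)\<^sup>2)"
  proof -
    have "0 \<le> p * (cmod b)\<^sup>2 + q * p\<^sup>2 - 2 * (p * (cmod b)\<^sup>2)"
    proof -
      have "Re (b * (cnj (- b) * of_real p)) = - (p * (cmod b)\<^sup>2)"
        unfolding cmod_power2 by (simp add: power2_eq_square algebra_simps)
      then show ?thesis using Q[of "- b" "of_real p"] by simp
    qed
    then show ?thesis by (simp add: power2_eq_square algebra_simps)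
  qed
  have 2: "0 \<le> q * (p * q - (cmod b)\<^sup>2)"
  proof -
    have "0 \<le> p * q\<^sup>2 + q * (cmod b)\<^sup>2 - 2 * (q * (cmod b)\<^sup>2)"
    proof -
      have "Re (b * (cnj (of_real q) * - cnj b)) = - (q * (cmod b)\<^sup>2)"
        unfolding cmod_power2 by (simp add: power2_eq_square algebra_simps)
      then show ?thesis using Q[of "of_real q" "- cnj b"] by simp
    qed
    then show ?thesis by (simp add: power2_eq_square algebra_simps)
  qed
  have "(cmod b)\<^sup>2 \<le> p * q"
  \<comment> \<open>With zero diagonal the form at \<open>(- b, 1)\<close> is
    \<open>- 2 * (cmod b)^2\<close>, so \<open>b = 0\<close>.\<close>
  proof (cases "p = 0 \<and> q = 0")
    case True
    have "Re (b * (cnj (- b) * 1)) = - (cmod b)\<^sup>2"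
      unfolding cmod_power2 by (simp add: power2_eq_square)
    then show ?thesis using Q[of "- b" 1] True by simp
  next
    case False
    then show ?thesis using 1 2 p q by (auto simp: zero_le_mult_iff)
  qed
  then show thesis using that S p q by blast
qed

definition det_root :: "complex^2^2 \<Rightarrow> real" where
  "det_root A = sqrt (Re (A$1$1 * A$2$2 - A$1$2 * A$2$1))"

text \<open>By Cayley-Hamilton, \<open>S ** S = A\<close> gives \<open>trace S *\<^sub>R S = A + det S *\<^sub>R mat 1\<close> with
  \<open>det S = det_root A\<close>, and \<open>trace_root A\<close> is the trace of \<open>S\<close>; it vanishes only for \<open>A = 0\<close>.\<close>

definition trace_root :: "complex^2^2 \<Rightarrow> real" where
  "trace_root A = sqrt (Re (A$1$1 + A$2$2) + 2 * det_root A)"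

lemma herm_square: "herm p b q ** herm p b q = herm (p\<^sup>2 + (cmod b)\<^sup>2) (of_real (p + q) * b) (q\<^sup>2 + (cmod b)\<^sup>2)"
  by (simp add: mat22_eq_iff matrix_mult_22 complex_norm_square power2_eq_square algebra_simps del: of_real_power)
     (simp add: complex_norm_square[symmetric] power2_eq_square mult.commute flip: of_real_mult)

lemma det_root_herm: "det_root (herm p b q) = sqrt (p * q - (cmod b)\<^sup>2)"
  unfolding det_root_def herm_nth cmod_power2 by (simp add: power2_eq_square)

lemma herm_scale_add:
  "c *\<^sub>R (herm p b q + d *\<^sub>R mat 1) = herm (c * (p + d)) (of_real c * b) (c * (q + d))"
  by (simp add: mat22_eq_iff mat1_22 scaleR_conv_of_real[where 'a = complex])

lemma hermitian_psd_sqrt_unique: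
  assumes "hermitian_psd S" "S ** S = A"
  shows "S = inverse (trace_root A) *\<^sub>R (A + det_root A *\<^sub>R mat 1)"
proof -
  obtain p b q where S: "S = herm p b q" and pq: "p \<ge> 0" "q \<ge> 0" and b: "(cmod b)\<^sup>2 \<le> p * q"
    using assms(1) by (rule hermitian_psdE)
  define \<beta> where "\<beta> = (cmod b)\<^sup>2"
  have A: "A = herm (p\<^sup>2 + \<beta>) (of_real (p + q) * b) (q\<^sup>2 + \<beta>)"
    using assms(2) by (simp add: S herm_square \<beta>_def)
  have "(p\<^sup>2 + \<beta>) * (q\<^sup>2 + \<beta>) - (cmod (of_real (p + q) * b))\<^sup>2 = (p * q - \<beta>)\<^sup>2"
    unfolding norm_mult power_mult_distrib \<beta>_def[symmetric] norm_of_real power2_abs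
    by (simp add: power2_eq_square algebra_simps)
  then have d: "det_root A = p * q - \<beta>" using b by (simp add: A det_root_herm \<beta>_def)
  have "Re (A$1$1 + A$2$2) + 2 * det_root A = (p + q)\<^sup>2"
    by (simp add: d) (simp add: A power2_eq_square algebra_simps)
  then have t: "trace_root A = p + q" using pq by (simp add: trace_root_def)
  show ?thesis
  proof (cases "p + q = 0")
    \<comment> \<open>Here \<open>trace_root A\<close> is 0 and \<open>inverse 0 = 0\<close>, so the
      formula returns 0; this is correct because a zero diagonal and the bound on \<open>b\<close>
      force \<open>S = 0\<close>.\<close>
    case True
    then have "p = 0" "q = 0" using pq by auto
    then show ?thesis using b t by (simp add: S mat22_eq_iff)
  next
    case False
    then have "inverse (p + q) * (p\<^sup>2 + \<beta> + (p * q - \<beta>)) = p" "inverse (p + q) * (q\<^sup>2 + \<beta> + (p * q - \<beta>)) = q"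
      "of_real (inverse (p + q)) * (of_real (p + q) * b) = b"
      by (simp_all add: field_simps power2_eq_square del: of_real_add)
    then show ?thesis
      unfolding t d unfolding A herm_scale_add by (simp only: S)
  qed
qed

lemma hermitian_psd_sqrt_exists:
  assumes "hermitian_psd A"
  shows "\<exists>S. hermitian_psd S \<and> S ** S = A"
proof -
  obtain P B Q where A: "A = herm P B Q" and PQ: "P \<ge> 0" "Q \<ge> 0" and B: "(cmod B)\<^sup>2 \<le> P * Q"
    using assms by (rule hermitian_psdE)
  \<comment> \<open>A root must have determinant \<open>d\<close> and trace \<open>t\<close>, so it
    can only be \<open>(A + d * I) / t\<close>; \<open>t = 0\<close> means that \<open>A\<close> is
    zero.\<close>
  define d where "d = sqrt (P * Q - (cmod B)\<^sup>2)"
  have d: "d \<ge> 0" "d\<^sup>2 = P * Q - (cmod B)\<^sup>2" using B by (simp_all add: d_def)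
  define t where "t = sqrt (P + Q + 2 * d)"
  have t: "t \<ge> 0" "t\<^sup>2 = P + Q + 2 * d" using PQ d by (simp_all add: t_def)
  show ?thesis
  proof (cases "t = 0")
    case True
    then have "P = 0" "Q = 0" using t PQ d by auto
    then have "A = herm 0 0 0" using B by (simp add: A)
    moreover have "herm 0 0 0 ** herm 0 0 0 = herm 0 0 0" by (simp add: herm_square)
    ultimately show ?thesis using assms by metis
  next
    case False
    define S where "S = herm ((P + d) / t) (B / of_real t) ((Q + d) / t)"
    have B2: "(cmod (B / of_real t))\<^sup>2 = (cmod B)\<^sup>2 / t\<^sup>2" by (simp add: norm_divide power_divide)
    have "hermitian_psd S" unfolding S_def
    proof (rule hermitian_psd_herm)
      have "(cmod B)\<^sup>2 \<le> (P + d) * (Q + d)" using B PQ d(1) by (simp add: algebra_simps add_increasing2)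
      then show "(cmod (B / of_real t))\<^sup>2 \<le> (P + d) / t * ((Q + d) / t)"
        unfolding B2 by (simp add: power2_eq_square divide_right_mono)
    qed (use PQ d t in auto)
    moreover have "S ** S = A"
    proof -
      have "((P + d) / t)\<^sup>2 + (cmod B)\<^sup>2 / t\<^sup>2 = ((P + d)\<^sup>2 + (cmod B)\<^sup>2) / t\<^sup>2"
        by (simp only: power_divide add_divide_distrib[symmetric])
      also have "(P + d)\<^sup>2 + (cmod B)\<^sup>2 = P * t\<^sup>2"
        using d(2) by (simp add: t(2) power2_sum) (simp add: power2_eq_square algebra_simps)
      finally have 1: "((P + d) / t)\<^sup>2 + (cmod B)\<^sup>2 / t\<^sup>2 = P" using False by simp
      have "((Q + d) / t)\<^sup>2 + (cmod B)\<^sup>2 / t\<^sup>2 = ((Q + d)\<^sup>2 + (cmod B)\<^sup>2) / t\<^sup>2"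
        by (simp only: power_divide add_divide_distrib[symmetric])
      also have "(Q + d)\<^sup>2 + (cmod B)\<^sup>2 = Q * t\<^sup>2"
        using d(2) by (simp add: t(2) power2_sum) (simp add: power2_eq_square algebra_simps)
      finally have 2: "((Q + d) / t)\<^sup>2 + (cmod B)\<^sup>2 / t\<^sup>2 = Q" using False by simp
      have "(P + d) / t + (Q + d) / t = t\<^sup>2 / t" unfolding t(2) by (simp add: add_divide_distrib)
      then have "(P + d) / t + (Q + d) / t = t" by (simp add: power2_eq_square)
      then have 3: "of_real ((P + d) / t + (Q + d) / t) * (B / of_real t) = B" using False by simp
      show ?thesis unfolding S_def herm_square B2 1 2 3 A ..
    qed
    ultimately show ?thesis by blast
  qed
qed

lemma
  assumes "hermitian_psd A"
  shows hermitian_psd_msqrt: "hermitian_psd (msqrt A)"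
    and msqrt_square: "msqrt A ** msqrt A = A"
    and msqrt_eq: "msqrt A = inverse (trace_root A) *\<^sub>R (A + det_root A *\<^sub>R mat 1)"
proof -
  have "\<exists>!S. hermitian_psd S \<and> S ** S = A"
    using hermitian_psd_sqrt_exists[OF assms] hermitian_psd_sqrt_unique by metis
  from theI'[OF this] show "hermitian_psd (msqrt A)" "msqrt A ** msqrt A = A"
    unfolding msqrt_def by blast+
  then show "msqrt A = inverse (trace_root A) *\<^sub>R (A + det_root A *\<^sub>R mat 1)"
    by (rule hermitian_psd_sqrt_unique)
qed

lemma hermitian_psd_cadj_mult: "hermitian_psd (cadj M ** M)"
  unfolding hermitian_psd_def
proof (intro conjI allI)
  show "cadj (cadj M ** M) = cadj M ** M" by (simp add: mat22_eq_iff matrix_mult_22 mult.commute)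
  fix v :: "complex^2"
  have "(\<Sum>i\<in>UNIV. cnj (v $ i) * ((cadj M ** M) *v v) $ i) = cnj ((M *v v) $ 1) * (M *v v) $ 1 + cnj ((M *v v) $ 2) * (M *v v) $ 2"
    by (simp add: sum_2 matrix_vector_22 matrix_mult_22 algebra_simps)
  also have "Re \<dots> = (cmod ((M *v v) $ 1))\<^sup>2 + (cmod ((M *v v) $ 2))\<^sup>2"
    unfolding cmod_power2 by (simp add: power2_eq_square)
  finally show "0 \<le> Re (\<Sum>i\<in>UNIV. cnj (v $ i) * ((cadj M ** M) *v v) $ i)" by simp
qed

lemma hermitian_psd_mabs: "hermitian_psd (mabs M)"
  unfolding mabs_def by (rule hermitian_psd_msqrt[OF hermitian_psd_cadj_mult])

text \<open>For self-adjoint \<open>S\<close> the diagonal entry of the square is the squared norm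
  of a column. Entry bounds thus pass from a matrix to its square root.\<close>

lemma norm_hermitian_sqrt_entry:
  assumes "hermitian_psd S"
  shows "(cmod (S $ k $ j))\<^sup>2 \<le> cmod ((S ** S) $ j $ j)"
proof -
  have adj: "S $ j $ i = cnj (S $ i $ j)" for i
    using assms unfolding hermitian_psd_def by (metis cadj_nth)
  have "(S ** S) $ j $ j = of_real ((cmod (S$1$j))\<^sup>2 + (cmod (S$2$j))\<^sup>2)"
    unfolding matrix_mult_22 adj[of 1] adj[of 2] of_real_add complex_norm_square
    by (simp add: mult.commute)
  then have "cmod ((S ** S) $ j $ j) = (cmod (S$1$j))\<^sup>2 + (cmod (S$2$j))\<^sup>2"
    by (simp only: norm_of_real) simp
  then show ?thesis using exhaust_2[of k] by auto
qed

text \<open>A description by \<open>THE\<close> says nothing on measurability; the closed formula in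
  terms of entries does.\<close>

lemma msqrt_measurable:
  assumes "\<And>x. hermitian_psd (A x)" and [measurable]: "\<And>i j. (\<lambda>x. A x $ i $ j) \<in> borel_measurable M"
  shows "(\<lambda>x. msqrt (A x) $ i $ j) \<in> borel_measurable M"
  unfolding msqrt_eq[OF assms(1)] trace_root_def det_root_def
  by (simp add: mat1_22) measurable

lemma mabs_measurable:
  assumes [measurable]: "\<And>i j. (\<lambda>x. N x $ i $ j) \<in> borel_measurable M"
  shows "(\<lambda>x. mabs (N x) $ i $ j) \<in> borel_measurable M"
  unfolding mabs_def
proof (rule msqrt_measurable[OF hermitian_psd_cadj_mult])
  have [measurable]: "(\<lambda>x. cnj (f x)) \<in> borel_measurable M" if "f \<in> borel_measurable M" for f
    using that by (rule measurable_compose) (intro borel_measurable_continuous_onI continuous_intros)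
  show "(\<lambda>x. (cadj (N x) ** N x) $ i $ j) \<in> borel_measurable M" for i j
    by (simp add: matrix_mult_22) measurable
qed

text \<open>The unitary factor \<open>V\<close> need not be measurable where \<open>N\<close> is singular, but \<open>V ** msqrt (mabs N)\<close>
  is determined by \<open>N\<close>: \<open>det_root (mabs N) *\<^sub>R V\<close> equals \<open>N\<close> times the adjugate of \<open>mabs N\<close>, divided by
  \<open>det_root (mabs N)\<close> (both sides are \<open>0\<close> if the latter vanishes).\<close>

definition adjugate22 :: "complex^2^2 \<Rightarrow> complex^2^2" where
  "adjugate22 A = vector [vector [A$2$2, - A$1$2], vector [- A$2$1, A$1$1]]"

lemma unitary_msqrt_eq:
  assumes "N = V ** mabs N"
  shows "V ** msqrt (mabs N) =
    inverse (trace_root (mabs N)) *\<^sub>R (N + inverse (det_root (mabs N)) *\<^sub>R (N ** adjugate22 (mabs N)))"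
proof -
  define P where "P = mabs N"
  have P: "hermitian_psd P" unfolding P_def by (rule hermitian_psd_mabs)
  then obtain p b q where pbq: "P = herm p b q" "p \<ge> 0" "q \<ge> 0" "(cmod b)\<^sup>2 \<le> p * q" by (rule hermitian_psdE)
  have N: "N = V ** P" using assms by (simp add: P_def)
  have d: "of_real ((det_root P)\<^sup>2) = P$1$1 * P$2$2 - P$1$2 * P$2$1"
    using pbq by (simp add: det_root_herm complex_norm_square del: of_real_power)
  have "N ** adjugate22 P = (det_root P)\<^sup>2 *\<^sub>R V"
    unfolding N
    by (simp add: mat22_eq_iff matrix_mult_22 adjugate22_def scaleR_conv_of_real[where 'a = complex] d algebra_simps del: of_real_power)
  then have adj: "inverse (det_root P) *\<^sub>R (N ** adjugate22 P) = det_root P *\<^sub>R V"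
    by (cases "det_root P = 0") (simp_all add: power2_eq_square)
  have "V ** msqrt P = inverse (trace_root P) *\<^sub>R (N + det_root P *\<^sub>R V)"
    unfolding msqrt_eq[OF P] N
    by (simp add: mat22_eq_iff matrix_mult_22 mat1_22 algebra_simps)
  then show ?thesis using adj by (simp add: P_def)
qed

lemma unitary_msqrt_measurable:
  assumes "\<And>x. N x = V x ** mabs (N x)" and [measurable]: "\<And>i j. (\<lambda>x. N x $ i $ j) \<in> borel_measurable M"
  shows "(\<lambda>x. (V x ** msqrt (mabs (N x))) $ i $ j) \<in> borel_measurable M"
proof -
  note [measurable] = mabs_measurable[OF assms(2)]
  have [measurable]: "(\<lambda>x. adjugate22 (mabs (N x)) $ i $ j) \<in> borel_measurable M" for i j
    using exhaust_2[of i] exhaust_2[of j] by (auto simp: adjugate22_def)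
  show ?thesis
    unfolding unitary_msqrt_eq[OF assms(1)] trace_root_def det_root_def
    by (simp add: matrix_mult_22) measurable
qed

lemma norm_unitary2_entry: "unitary2 V \<Longrightarrow> cmod (V $ k $ j) \<le> 1"
proof -
  assume "unitary2 V"
  then have "(cadj V ** V) $ j $ j = 1" by (simp add: unitary2_def mat1_22)
  then have "of_real ((cmod (V$1$j))\<^sup>2 + (cmod (V$2$j))\<^sup>2) = (1::complex)"
    unfolding of_real_add complex_norm_square by (simp add: matrix_mult_22 mult.commute)
  then have "(cmod (V$1$j))\<^sup>2 + (cmod (V$2$j))\<^sup>2 = 1" by (simp only: of_real_eq_1_iff)
  then have "(cmod (V$1$j))\<^sup>2 \<le> 1" "(cmod (V$2$j))\<^sup>2 \<le> 1"
    using zero_le_power2[of "cmod (V$1$j)"] zero_le_power2[of "cmod (V$2$j)"] by linarith+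
  then have "(cmod (V $ k $ j))\<^sup>2 \<le> 1" using exhaust_2[of k] by auto
  then show ?thesis by (simp add: abs_square_le_1)
qed

lemma norm_matrix_vector_22_le:
  assumes "\<And>i j. cmod (A $ i $ j) \<le> K"
  shows "norm ((A::complex^2^2) *v v) \<le> 4 * K * norm v"
proof -
  have "cmod ((A *v v) $ i) \<le> 2 * K * norm v" for i
  proof -
    have "cmod ((A *v v) $ i) \<le> cmod (A$i$1) * cmod (v$1) + cmod (A$i$2) * cmod (v$2)"
      unfolding matrix_vector_22 by (rule order_trans[OF norm_triangle_ineq]) (simp add: norm_mult)
    also have "\<dots> \<le> K * norm v + K * norm v"
      by (intro add_mono mult_mono assms Finite_Cartesian_Product.norm_nth_le order_trans[OF norm_ge_zero assms[of 1 1]]) auto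
    finally show ?thesis by simp
  qed
  from this[of 1] this[of 2] show ?thesis using norm_vec2_le[of "A *v v"] by linarith
qed

subsection \<open>The asymptotic matrix and its Green function\<close>

lemma mat2_mult_eq_diag_op: "mat2 a (- b) b a *v v = diag_op (Complex a b) (Complex a (- b)) v"
  by (intro vec2_eqI; simp only: zplus_diag_op zminus_diag_op)
    (simp_all add: zplus_def zminus_def matrix_vector_22 mat2_def complex_eq_iff algebra_simps)

lemma Bm_mult: "Bm D \<beta> *v v = diag_op (Complex \<beta> (D / 2)) (Complex \<beta> (- D / 2)) v"
  using mat2_mult_eq_diag_op[of \<beta> "D / 2" v] by (simp add: Bm_def)

lemma Nm_mult: "Nm a b *v v = diag_op (Complex a b) (Complex a (- b)) v"
  using mat2_mult_eq_diag_op[of a b v] by (simp add: Nm_def)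

text \<open>\<open>matrix_inv\<close> is a choice, so an explicit inverse is exhibited only to show
  that it is a genuine inverse; its action then follows by cancelling \<open>Bm D \<beta>\<close> in
  diagonal coordinates.\<close>

lemma matrix_inv_Bm_mult:
  assumes "(D, \<beta>) \<noteq> (0, 0)"
  shows "matrix_inv (Bm D \<beta>) *v v = diag_op (1 / Complex \<beta> (D / 2)) (1 / Complex \<beta> (- D / 2)) v"
proof -
  define n where "n = \<beta>\<^sup>2 + (D / 2)\<^sup>2"
  have n: "n \<noteq> 0" using assms by (auto simp: n_def sum_power2_eq_zero_iff)
  have nz: "Complex \<beta> (D / 2) \<noteq> 0" "Complex \<beta> (- D / 2) \<noteq> 0" using assms by (auto simp: complex_eq_iff)
  have n': "\<beta> * \<beta> / n + D / 2 * (D / 2) / n = 1"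
  proof -
    have "\<beta> * \<beta> + D / 2 * (D / 2) = n" by (simp add: n_def power2_eq_square)
    then show ?thesis using n by (simp only: add_divide_distrib[symmetric]) simp
  qed
  have "invertible (Bm D \<beta>)"
    unfolding invertible_def
  proof (intro exI conjI)
    show "Bm D \<beta> ** mat2 (\<beta> / n) (D / 2 / n) (- (D / 2 / n)) (\<beta> / n) = mat 1"
      "mat2 (\<beta> / n) (D / 2 / n) (- (D / 2 / n)) (\<beta> / n) ** Bm D \<beta> = mat 1"
      using n' by (auto simp: mat22_eq_iff matrix_mult_22 mat1_22 Bm_def mat2_def complex_eq_iff mult.commute)
  qed
  then have "Bm D \<beta> ** matrix_inv (Bm D \<beta>) = mat 1"
    unfolding invertible_def matrix_inv_def by (rule someI2_ex) blast
  then have "Bm D \<beta> *v (matrix_inv (Bm D \<beta>) *v v) = v"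
    by (simp add: matrix_vector_mul_assoc)
  then have "diag_op (1 / Complex \<beta> (D / 2)) (1 / Complex \<beta> (- D / 2)) (Bm D \<beta> *v (matrix_inv (Bm D \<beta>) *v v)) =
      diag_op (1 / Complex \<beta> (D / 2)) (1 / Complex \<beta> (- D / 2)) v" by simp
  then show ?thesis using nz by (simp add: Bm_mult)
qed

lemma minus_diag_op: "- diag_op c d v = diag_op (- c) (- d) v"
  by (intro vec2_eqI) simp_all

lemma smult_eq_diag_op: "c *s v = diag_op c c v"
  by (intro vec2_eqI) simp_all

lemma Ainf_eq:
  assumes "(D, \<beta>) \<noteq> (0, 0)"
  shows "Ainf D \<beta> \<delta> \<alpha> lam v = (snd v, diag_op ((lam - Complex \<delta> \<alpha>) / Complex \<beta> (D / 2)) ((lam - Complex \<delta> (- \<alpha>)) / Complex \<beta> (- D / 2)) (fst v))"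
  unfolding Ainf_def matrix_inv_Bm_mult[OF assms] Nm_mult smult_eq_diag_op diag_op_diff diag_op_diag_op by simp

text \<open>The principal root has nonnegative real part, and it is purely imaginary only for
  arguments of the form \<open>- r^2\<close> with real \<open>r\<close>. Those are the values taken
  on the two curves of the essential spectrum.\<close>

lemma ess_spectrum_square_root:
  assumes "(D, \<beta>) \<noteq> (0, 0)" "lam \<notin> ess_spectrum D \<beta> \<delta> \<alpha>"
  obtains s t where "Re s > 0" "Re t > 0" "s\<^sup>2 = (lam - Complex \<delta> \<alpha>) / Complex \<beta> (D / 2)"
    "t\<^sup>2 = (lam - Complex \<delta> (- \<alpha>)) / Complex \<beta> (- D / 2)"
proof -
  have pos: "Re (csqrt z) > 0" if "\<And>r::real. z \<noteq> - of_real (r\<^sup>2)" for z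
  proof (rule ccontr)
    assume "\<not> 0 < Re (csqrt z)"
    then have "Re (csqrt z) = 0" using csqrt_principal[of z] by (auto simp: not_less le_less)
    then have "csqrt z = \<i> * of_real (Im (csqrt z))" by (simp add: complex_eq_iff)
    then have "(csqrt z)\<^sup>2 = (\<i> * of_real (Im (csqrt z)))\<^sup>2" by (rule arg_cong)
    then show False using that[of "Im (csqrt z)"] by (simp add: power_mult_distrib)
  qed
  have nz: "Complex \<beta> (D / 2) \<noteq> 0" "Complex \<beta> (- D / 2) \<noteq> 0" using assms by (auto simp: complex_eq_iff)
  have c: "Complex a b = of_real a + \<i> * of_real b" "Complex a (- b) = of_real a - \<i> * of_real b"
    "Complex a (b / 2) = of_real a + \<i> * of_real b / 2" "Complex a (- b / 2) = of_real a - \<i> * of_real b / 2" for a b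
    by (simp_all add: complex_eq_iff)
  have 1: "(lam - Complex \<delta> \<alpha>) / Complex \<beta> (D / 2) \<noteq> - of_real (r\<^sup>2)" for r
  proof
    assume "(lam - Complex \<delta> \<alpha>) / Complex \<beta> (D / 2) = - of_real (r\<^sup>2)"
    then have "lam = Complex \<delta> \<alpha> - of_real (r\<^sup>2) * Complex \<beta> (D / 2)" using nz(1) by (simp add: field_simps)
    then show False using assms(2) unfolding ess_spectrum_def c by auto
  qed
  have 2: "(lam - Complex \<delta> (- \<alpha>)) / Complex \<beta> (- D / 2) \<noteq> - of_real (r\<^sup>2)" for r
  proof
    assume "(lam - Complex \<delta> (- \<alpha>)) / Complex \<beta> (- D / 2) = - of_real (r\<^sup>2)"
    then have "lam = Complex \<delta> (- \<alpha>) - of_real (r\<^sup>2) * Complex \<beta> (- D / 2)" using nz(2) by (simp add: field_simps)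
    then show False using assms(2) unfolding ess_spectrum_def c by auto
  qed
  show thesis by (rule that[OF pos[OF 1] pos[OF 2]]) simp_all
qed

context diag_op_kernel
begin

definition A :: "(complex^2) \<times> (complex^2) \<Rightarrow> (complex^2) \<times> (complex^2)" where
  "A v = (snd v, diag_op (s\<^sup>2) (t\<^sup>2) (fst v))"

text \<open>With \<open>S\<close> the diagonal operator of \<open>s\<close> and \<open>t\<close>,
  the stable space is \<open>v2 = - S v1\<close> and the unstable one \<open>v2 = S v1\<close>. This
  is the projection onto the former along the latter: half of \<open>v1 - S^(-1) v2\<close>,
  followed by \<open>- S\<close> times it.\<close>

definition Q :: "(complex^2) \<times> (complex^2) \<Rightarrow> (complex^2) \<times> (complex^2)" where
  "Q v = (diag_op (1/2) (1/2) (fst v) - diag_op (1 / (2 * s)) (1 / (2 * t)) (snd v), diag_op (1/2) (1/2) (snd v) - diag_op (s/2) (t/2) (fst v))"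

lemma s_nz: "s \<noteq> 0" and t_nz: "t \<noteq> 0"
  using s t by auto

lemma pair_eqI: "zplus (fst v) = zplus (fst w) \<Longrightarrow> zminus (fst v) = zminus (fst w) \<Longrightarrow> zplus (snd v) = zplus (snd w) \<Longrightarrow> zminus (snd v) = zminus (snd w) \<Longrightarrow> v = w"
  by (intro prod_eqI vec2_eqI)

lemma linear_Q: "linear Q"
  by (intro linearI pair_eqI) (simp_all add: Q_def scaleR_conv_of_real[where 'a = complex] algebra_simps add_divide_distrib)

text \<open>A left eigenvector for the eigenvalue \<kappa> annihilates generalised eigenvectors for
  every other eigenvalue. The combinations \<open>v2 + s * v1\<close> and \<open>v2 - s * v1\<close>
  in each coordinate are such functionals, for \<open>s\<close> and \<open>- s\<close>, so Jordan
  forms and dimension counts are avoided.\<close>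

lemma gen_eigvec_functional:
  fixes \<phi> :: "(complex^2) \<times> (complex^2) \<Rightarrow> complex"
  assumes "gen_eigvec A \<mu> v" "\<And>w. \<phi> (A w - cscale4 \<mu> w) = (\<kappa> - \<mu>) * \<phi> w" "\<phi> 0 = 0" "\<kappa> \<noteq> \<mu>"
  shows "\<phi> v = 0"
proof -
  obtain k where k: "((\<lambda>w. A w - cscale4 \<mu> w) ^^ k) v = 0" using assms(1) by (auto simp: gen_eigvec_def)
  have "\<phi> (((\<lambda>w. A w - cscale4 \<mu> w) ^^ k) v) = (\<kappa> - \<mu>) ^ k * \<phi> v"
    by (induction k) (simp_all add: assms(2))
  then show ?thesis using k assms by simp
qed

lemma gen_eigvec_stable:
  assumes "gen_eigvec A \<mu> v" "Re \<mu> < 0"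
  shows "snd v = - diag_op s t (fst v)"
proof -
  have "zplus (snd v) + s * zplus (fst v) = 0"
    by (rule gen_eigvec_functional[OF assms(1), of "\<lambda>v. zplus (snd v) + s * zplus (fst v)" s])
      (use s assms in \<open>auto simp: A_def cscale4_def power2_eq_square algebra_simps\<close>)
  moreover have "zminus (snd v) + t * zminus (fst v) = 0"
    by (rule gen_eigvec_functional[OF assms(1), of "\<lambda>v. zminus (snd v) + t * zminus (fst v)" t])
      (use t assms in \<open>auto simp: A_def cscale4_def power2_eq_square algebra_simps\<close>)
  ultimately show ?thesis by (intro vec2_eqI) (simp_all add: add_eq_0_iff2)
qed

lemma gen_eigvec_unstable:
  assumes "gen_eigvec A \<mu> v" "Re \<mu> > 0"
  shows "snd v = diag_op s t (fst v)"
proof -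
  have "zplus (snd v) - s * zplus (fst v) = 0"
    by (rule gen_eigvec_functional[OF assms(1), of "\<lambda>v. zplus (snd v) - s * zplus (fst v)" "- s"])
      (use s assms in \<open>auto simp: A_def cscale4_def power2_eq_square algebra_simps\<close>)
  moreover have "zminus (snd v) - t * zminus (fst v) = 0"
    by (rule gen_eigvec_functional[OF assms(1), of "\<lambda>v. zminus (snd v) - t * zminus (fst v)" "- t"])
      (use t assms in \<open>auto simp: A_def cscale4_def power2_eq_square algebra_simps\<close>)
  ultimately show ?thesis by (intro vec2_eqI) simp_all
qed

lemma Q_stable: "snd v = - diag_op s t (fst v) \<Longrightarrow> Q v = v"
  using s_nz t_nz by (intro pair_eqI) (simp_all add: Q_def field_simps)

lemma Q_unstable: "snd v = diag_op s t (fst v) \<Longrightarrow> Q v = 0"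
  using s_nz t_nz by (intro pair_eqI) (simp_all add: Q_def field_simps)

lemma Q_on_stable_sub: "v \<in> stable_sub A \<Longrightarrow> Q v = v"
proof -
  assume "v \<in> stable_sub A"
  moreover have "subspace {v. Q v = v}"
    by (auto simp: subspace_def linear_add[OF linear_Q] linear_scale[OF linear_Q] linear_0[OF linear_Q])
  then have "stable_sub A \<subseteq> {v. Q v = v}"
    unfolding stable_sub_def by (intro span_minimal) (blast intro: Q_stable gen_eigvec_stable)
  ultimately show ?thesis by blast
qed

lemma Q_on_unstable_sub: "v \<in> unstable_sub A \<Longrightarrow> Q v = 0"
proof -
  assume "v \<in> unstable_sub A"
  moreover have "subspace {v. Q v = 0}"
    by (auto simp: subspace_def linear_add[OF linear_Q] linear_scale[OF linear_Q] linear_0[OF linear_Q])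
  then have "unstable_sub A \<subseteq> {v. Q v = 0}"
    unfolding unstable_sub_def by (intro span_minimal) (blast intro: Q_unstable gen_eigvec_unstable)
  ultimately show ?thesis by blast
qed

lemma gen_eigvec_zplus: "\<kappa>\<^sup>2 = s\<^sup>2 \<Longrightarrow> gen_eigvec A \<kappa> (of_zpm c 0, of_zpm (\<kappa> * c) 0)"
  and gen_eigvec_zminus: "\<kappa>\<^sup>2 = t\<^sup>2 \<Longrightarrow> gen_eigvec A \<kappa> (of_zpm 0 c, of_zpm 0 (\<kappa> * c))"
  unfolding gen_eigvec_def
  by (intro exI[of _ 1] pair_eqI; simp add: A_def cscale4_def mult.assoc[symmetric] flip: power2_eq_square)+

text \<open>\<open>span\<close> is the real span; this does no harm since the generating
  eigenvectors already come with an arbitrary complex factor.\<close>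

lemma stable_subI:
  assumes "snd v = - diag_op s t (fst v)"
  shows "v \<in> stable_sub A"
proof -
  have eq: "v = (of_zpm (zplus (fst v)) 0, of_zpm ((- s) * zplus (fst v)) 0) + (of_zpm 0 (zminus (fst v)), of_zpm 0 ((- t) * zminus (fst v)))"
    by (intro pair_eqI) (simp_all add: assms)
 have "(of_zpm (zplus (fst v)) 0, of_zpm ((- s) * zplus (fst v)) 0) \<in> stable_sub A"
    unfolding stable_sub_def using s gen_eigvec_zplus[of "- s" "zplus (fst v)"]
    by (intro span_base) (auto intro!: exI[of _ "- s"])
  moreover have "(of_zpm 0 (zminus (fst v)), of_zpm 0 ((- t) * zminus (fst v))) \<in> stable_sub A"
    unfolding stable_sub_def using t gen_eigvec_zminus[of "- t" "zminus (fst v)"]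
    by (intro span_base) (auto intro!: exI[of _ "- t"])
  ultimately show ?thesis unfolding stable_sub_def by (subst eq) (intro span_add)
qed

lemma unstable_subI:
  assumes "snd v = diag_op s t (fst v)"
  shows "v \<in> unstable_sub A"
proof -
  have eq: "v = (of_zpm (zplus (fst v)) 0, of_zpm (s * zplus (fst v)) 0) + (of_zpm 0 (zminus (fst v)), of_zpm 0 (t * zminus (fst v)))"
    by (intro pair_eqI) (simp_all add: assms)
 have "(of_zpm (zplus (fst v)) 0, of_zpm (s * zplus (fst v)) 0) \<in> unstable_sub A"
    unfolding unstable_sub_def using s gen_eigvec_zplus[of s "zplus (fst v)"]
    by (intro span_base) (auto intro!: exI[of _ s])
  moreover have "(of_zpm 0 (zminus (fst v)), of_zpm 0 (t * zminus (fst v))) \<in> unstable_sub A"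
    unfolding unstable_sub_def using t gen_eigvec_zminus[of t "zminus (fst v)"]
    by (intro span_base) (auto intro!: exI[of _ t])
  ultimately show ?thesis unfolding unstable_sub_def by (subst eq) (intro span_add)
qed

lemma snd_Q: "snd (Q v) = - diag_op s t (fst (Q v))"
  and snd_diff_Q: "snd (v - Q v) = diag_op s t (fst (v - Q v))"
  using s_nz t_nz by (intro vec2_eqI; simp add: Q_def field_simps)+

lemma stable_proj_eq: "stable_proj A = Q"
  unfolding stable_proj_def
proof (rule the_equality)
  show "linear Q \<and> (\<forall>v\<in>stable_sub A. Q v = v) \<and> (\<forall>v\<in>unstable_sub A. Q v = 0)"
    using linear_Q Q_on_stable_sub Q_on_unstable_sub by blast
  fix P assume P: "linear P \<and> (\<forall>v\<in>stable_sub A. P v = v) \<and> (\<forall>v\<in>unstable_sub A. P v = 0)"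
  show "P = Q"
  proof
    fix v
    have "P v = P (Q v) + P (v - Q v)" using P by (simp add: linear_add[symmetric])
    also have "\<dots> = Q v" using P stable_subI[OF snd_Q] unstable_subI[OF snd_diff_Q] by simp
    finally show "P v = Q v" .
  qed
qed

text \<open>On the invariant subspace \<open>v2 = diag_op \<kappa> \<kappa>' v1\<close> the map
  \<open>\<Phi>\<close> turns \<open>A\<close> into multiplication by \<kappa> and \<kappa>' in two
  scalar coordinates, where the series is the usual exponential. Signs are left open to serve both
  subspaces.\<close>

lemma mexp_eigen:
  assumes \<kappa>: "\<kappa>\<^sup>2 = s\<^sup>2" "\<kappa>'\<^sup>2 = t\<^sup>2" and v: "snd v = diag_op \<kappa> \<kappa>' (fst v)"
  shows "mexp A x v = (diag_op (exp (\<kappa> * x)) (exp (\<kappa>' * x)) (fst v), diag_op (\<kappa> * exp (\<kappa> * x)) (\<kappa>' * exp (\<kappa>' * x)) (fst v))"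
proof -
  define \<Phi> :: "complex \<times> complex \<Rightarrow> (complex^2) \<times> (complex^2)" where
    "\<Phi> p = (of_zpm (fst p) (snd p), of_zpm (\<kappa> * fst p) (\<kappa>' * snd p))" for p
  have bl: "bounded_linear \<Phi>"
    by (subst linear_conv_bounded_linear[symmetric]) (intro linearI pair_eqI; simp add: \<Phi>_def algebra_simps)
  have pow: "(A ^^ n) v = \<Phi> (\<kappa> ^ n * zplus (fst v), \<kappa>' ^ n * zminus (fst v))" for n
  proof (induction n)
    case 0
    show ?case by (intro pair_eqI) (simp_all add: \<Phi>_def v)
  next
    case (Suc n)
    have "(A ^^ Suc n) v = A (\<Phi> (\<kappa> ^ n * zplus (fst v), \<kappa>' ^ n * zminus (fst v)))" by (simp add: Suc)
    also have "\<dots> = \<Phi> (\<kappa> ^ Suc n * zplus (fst v), \<kappa>' ^ Suc n * zminus (fst v))"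
    proof -
      have "s\<^sup>2 = \<kappa> * \<kappa>" "t\<^sup>2 = \<kappa>' * \<kappa>'" using \<kappa> by (simp_all add: power2_eq_square)
      then show ?thesis by (intro pair_eqI) (simp_all add: A_def \<Phi>_def mult.assoc)
    qed
    finally show ?case .
  qed
  have trm: "(x ^ n / fact n) *\<^sub>R (A ^^ n) v = \<Phi> ((\<kappa> * x) ^ n /\<^sub>R fact n * zplus (fst v), (\<kappa>' * x) ^ n /\<^sub>R fact n * zminus (fst v))" for n
    unfolding pow linear_scale[OF bounded_linear.linear[OF bl], symmetric]
    by (rule arg_cong[of _ _ \<Phi>]) (simp add: scaleR_conv_of_real power_mult_distrib field_simps)
  have "(\<lambda>n. (\<kappa> * x) ^ n /\<^sub>R fact n * zplus (fst v)) sums (exp (\<kappa> * x) * zplus (fst v))"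
    "(\<lambda>n. (\<kappa>' * x) ^ n /\<^sub>R fact n * zminus (fst v)) sums (exp (\<kappa>' * x) * zminus (fst v))"
    by (intro sums_mult2 exp_converges)+
  then have "(\<lambda>n. ((\<kappa> * x) ^ n /\<^sub>R fact n * zplus (fst v), (\<kappa>' * x) ^ n /\<^sub>R fact n * zminus (fst v))) sums
      (exp (\<kappa> * x) * zplus (fst v), exp (\<kappa>' * x) * zminus (fst v))"
    unfolding sums_def sum_prod by (intro tendsto_Pair)
  from bounded_linear.sums[OF bl this] have "mexp A x v = \<Phi> (exp (\<kappa> * x) * zplus (fst v), exp (\<kappa>' * x) * zminus (fst v))"
    unfolding mexp_def trm by (rule sums_unique[symmetric])
  also have "\<dots> = (diag_op (exp (\<kappa> * x)) (exp (\<kappa>' * x)) (fst v), diag_op (\<kappa> * exp (\<kappa> * x)) (\<kappa>' * exp (\<kappa>' * x)) (fst v))"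
    by (intro pair_eqI) (simp_all add: \<Phi>_def)
  finally show ?thesis .
qed

text \<open>The lower right block of the Green kernel: the derivative of \<open>G\<close> away from
  0, with a jump at 0 that takes the value from the right.\<close>

definition G' :: "real \<Rightarrow> complex^2 \<Rightarrow> complex^2" where
  "G' x = diag_op ((if 0 \<le> x then - s else s) * gk s x) ((if 0 \<le> x then - t else t) * gk t x)"

lemma GA_eq:
  assumes "Ainf D \<beta> \<delta> \<alpha> lam = A"
  shows "GA D \<beta> \<delta> \<alpha> lam x (0, w) = (G x w, G' x w)"
proof (cases "0 \<le> x")
  case True
  have "mexp A x (Q (0, w)) = (diag_op (exp (- s * x)) (exp (- t * x)) (fst (Q (0, w))), diag_op (- s * exp (- s * x)) (- t * exp (- t * x)) (fst (Q (0, w))))"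
    using snd_Q[of "(0, w)"] by (intro mexp_eigen) (simp_all only: minus_diag_op power2_minus)
  then show ?thesis
    using True s_nz t_nz unfolding GA_def assms stable_proj_eq Let_def
    by (intro pair_eqI) (simp_all add: G_def G'_def gk_def Q_def field_simps)
next
  case False
  have "mexp A x ((0, w) - Q (0, w)) = (diag_op (exp (s * x)) (exp (t * x)) (fst ((0, w) - Q (0, w))), diag_op (s * exp (s * x)) (t * exp (t * x)) (fst ((0, w) - Q (0, w))))"
    by (rule mexp_eigen[OF refl refl snd_diff_Q])
  then show ?thesis
    using False s_nz t_nz unfolding GA_def assms stable_proj_eq Let_def
    by (intro pair_eqI) (simp_all add: G_def G'_def gk_def Q_def field_simps)
qed

lemma fst_integral_GA:
  assumes "Ainf D \<beta> \<delta> \<alpha> lam = A" and h: "exp_integrable \<sigma> h"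
  shows "fst (LINT y|lborel. GA D \<beta> \<delta> \<alpha> lam (x - y) (0, h y)) = conv h x"
proof -
  have [measurable]: "h \<in> borel_measurable borel" using h by (simp add: exp_integrable_def)
  have [measurable]: "(\<lambda>y. zplus (h y)) \<in> borel_measurable borel" "(\<lambda>y. zminus (h y)) \<in> borel_measurable borel"
    by (fact measurable_compose[OF \<open>h \<in> borel_measurable borel\<close> borel_measurable_continuous_onI[OF linear_continuous_on[OF bounded_linear_zplus]]]
        measurable_compose[OF \<open>h \<in> borel_measurable borel\<close> borel_measurable_continuous_onI[OF linear_continuous_on[OF bounded_linear_zminus]]])+
  \<comment> \<open>Without integrability of the second component the integral over pairs would
    default to 0, and \<open>fst\<close> could not be moved inside.\<close>
  have "integrable lborel (\<lambda>y. G' (x - y) (h y))"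
  proof (rule Bochner_Integration.integrable_bound)
    show "integrable lborel (\<lambda>y. 2 * (exp (- \<sigma> * \<bar>x - y\<bar>) * norm (h y)))"
      using exp_integrable_translate[OF h] \<sigma>_pos by simp
    have "(\<lambda>y. (((if 0 \<le> x - y then - s else s) * gk s (x - y)) * zplus (h y), ((if 0 \<le> x - y then - t else t) * gk t (x - y)) * zminus (h y)))
        \<in> borel_measurable borel"
      unfolding gk_def by measurable
    from measurable_compose[OF this borel_measurable_continuous_onI[OF linear_continuous_on[OF bounded_linear_of_zpm]]]
    show "(\<lambda>y. G' (x - y) (h y)) \<in> borel_measurable lborel" by (simp add: G'_def diag_op_def)
    show "AE y in lborel. norm (G' (x - y) (h y)) \<le> norm (2 * (exp (- \<sigma> * \<bar>x - y\<bar>) * norm (h y)))"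
    proof (rule AE_I2)
      fix y
      have e: "norm ((if 0 \<le> x - y then - r else r) * gk r (x - y)) \<le> exp (- \<sigma> * \<bar>x - y\<bar>) / 2" if "r \<noteq> 0" "\<sigma> \<le> Re r" for r
        using that by (auto simp: norm_mult norm_gk intro!: mult_right_mono)
      have "norm (G' (x - y) (h y)) \<le> 2 * (exp (- \<sigma> * \<bar>x - y\<bar>) / 2 + exp (- \<sigma> * \<bar>x - y\<bar>) / 2) * norm (h y)"
        unfolding G'_def
        by (intro order_trans[OF norm_diag_op_le] mult_right_mono mult_left_mono add_mono e s_nz t_nz \<sigma>_le) auto
      then show "norm (G' (x - y) (h y)) \<le> norm (2 * (exp (- \<sigma> * \<bar>x - y\<bar>) * norm (h y)))" by simp
    qed
  qed
  then have "integrable lborel (\<lambda>y. (G (x - y) (h y), 0) + (0, G' (x - y) (h y)))"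
    by (intro Bochner_Integration.integrable_add integrable_bounded_linear[OF bounded_linear_Pair[OF bounded_linear_ident bounded_linear_zero]]
        integrable_bounded_linear[OF bounded_linear_Pair[OF bounded_linear_zero bounded_linear_ident]] integrable_conv h)
  then have "integrable lborel (\<lambda>y. (G (x - y) (h y), G' (x - y) (h y)))" by simp
  then show ?thesis unfolding GA_eq[OF assms(1)] conv_def
    by (subst integral_bounded_linear[OF bounded_linear_fst, symmetric]) simp_all
qed

end

subsection \<open>The Birman-Schwinger operator\<close>

lemma vector_nth_measurable:
  assumes "f \<in> borel_measurable M"
  shows "(\<lambda>x. (f x :: complex^2) $ i) \<in> borel_measurable M"
  by (rule measurable_compose[OF assms borel_measurable_continuous_onI]) (intro continuous_intros)

lemma vec2_measurable:
  fixes f :: "'a \<Rightarrow> complex^2"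
  assumes [measurable]: "\<And>i. (\<lambda>x. f x $ i) \<in> borel_measurable M"
  shows "f \<in> borel_measurable M"
proof -
  have "(\<lambda>x. (zplus (f x), zminus (f x))) \<in> borel_measurable M" unfolding zplus_def zminus_def by measurable
  from measurable_compose[OF this borel_measurable_continuous_onI[OF linear_continuous_on[OF bounded_linear_of_zpm]]]
  show ?thesis by simp
qed

lemma matrix_vector_22_measurable:
  assumes [measurable]: "\<And>i j. (\<lambda>x. (A x :: complex^2^2) $ i $ j) \<in> borel_measurable M" and f: "f \<in> borel_measurable M"
  shows "(\<lambda>x. A x *v f x) \<in> borel_measurable M"
proof (rule vec2_measurable)
  note [measurable] = vector_nth_measurable[OF f]
  show "(\<lambda>x. (A x *v f x) $ i) \<in> borel_measurable M" for i unfolding matrix_vector_22 by measurable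
qed

lemma sq_int_fst: "sq_int f \<Longrightarrow> sq_int (\<lambda>x. fst (f x))"
  and sq_int_snd: "sq_int f \<Longrightarrow> sq_int (\<lambda>x. snd (f x))"
  for f :: "real \<Rightarrow> 'a::euclidean_space \<times> 'b::euclidean_space"
proof -
  assume f: "sq_int f"
  then have m: "f \<in> borel_measurable borel" by (simp add: sq_int_def)
  have norm_fst: "norm (fst z) \<le> norm z" and norm_snd: "norm (snd z) \<le> norm z" for z :: "'a \<times> 'b"
    by (cases z; simp add: norm_fst_le norm_snd_le)+
  show "sq_int (\<lambda>x. fst (f x))"
    by (rule sq_int_bound[OF f measurable_compose[OF m borel_measurable_continuous_onI], of fst 1])
      (auto intro: continuous_intros simp: norm_fst)
  show "sq_int (\<lambda>x. snd (f x))"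
    by (rule sq_int_bound[OF f measurable_compose[OF m borel_measurable_continuous_onI], of snd 1])
      (auto intro: continuous_intros simp: norm_snd)
qed

lemma sq_int_Pair:
  fixes f :: "real \<Rightarrow> 'a::euclidean_space" and g :: "real \<Rightarrow> 'b::euclidean_space"
  assumes f: "sq_int f" and g: "sq_int g"
  shows "sq_int (\<lambda>x. (f x, g x))"
proof -
  have [measurable]: "f \<in> borel_measurable borel" "g \<in> borel_measurable borel"
    using assms by (auto simp: sq_int_def)
  have "integrable lborel (\<lambda>x. (norm (f x))\<^sup>2 + (norm (g x))\<^sup>2)" using assms by (auto simp: sq_int_def)
  then show ?thesis by (simp add: sq_int_def norm_Pair)
qed

lemma Mpot_entry:
  "Mpot \<epsilon> \<gamma> \<mu> \<nu> \<psi> x $ i $ j = (cmod (\<psi> x))\<^sup>2 *\<^sub>R Nm \<epsilon> \<gamma> $ i $ j + ((cmod (\<psi> x))\<^sup>2)\<^sup>2 *\<^sub>R Nm \<mu> \<nu> $ i $ j +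
    (2 *\<^sub>R Nm \<epsilon> \<gamma> $ i $ 1 + (4 * (cmod (\<psi> x))\<^sup>2) *\<^sub>R Nm \<mu> \<nu> $ i $ 1) *
      (of_real (Re (\<psi> x)) * (if j = 1 then of_real (Re (\<psi> x)) else of_real (Im (\<psi> x)))) +
    (2 *\<^sub>R Nm \<epsilon> \<gamma> $ i $ 2 + (4 * (cmod (\<psi> x))\<^sup>2) *\<^sub>R Nm \<mu> \<nu> $ i $ 2) *
      (of_real (Im (\<psi> x)) * (if j = 1 then of_real (Re (\<psi> x)) else of_real (Im (\<psi> x))))"
  using exhaust_2[of j] by (auto simp: Mpot_def Let_def matrix_mult_22)

lemma continuous_Mpot_entry:
  assumes "continuous_on UNIV \<psi>"
  shows "continuous_on UNIV (\<lambda>x. Mpot \<epsilon> \<gamma> \<mu> \<nu> \<psi> x $ i $ j)"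
  unfolding Mpot_entry by (cases "j = 1") (simp_all, (intro continuous_intros assms)+)

lemma tendsto_Mpot_entry:
  assumes "((\<lambda>x. cmod (\<psi> x)) \<longlongrightarrow> 0) F"
  shows "((\<lambda>x. Mpot \<epsilon> \<gamma> \<mu> \<nu> \<psi> x $ i $ j) \<longlongrightarrow> 0) F"
proof -
  have \<psi>: "(\<psi> \<longlongrightarrow> 0) F" using assms by (simp add: tendsto_norm_zero_iff)
  \<comment> \<open>The limit is written as an entry of the potential of the zero profile; it then
    matches the entry formula term by term and evaluates to 0.\<close>
  define z where "z = (\<lambda>_::real. 0 :: complex)"
  have "((\<lambda>x. Mpot \<epsilon> \<gamma> \<mu> \<nu> \<psi> x $ i $ j) \<longlongrightarrow> Mpot \<epsilon> \<gamma> \<mu> \<nu> z 0 $ i $ j) F"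
    unfolding Mpot_entry z_def by (cases "j = 1"; simp only: if_True if_False simp_thms; intro tendsto_intros \<psi>)
  then show ?thesis by (simp add: Mpot_entry z_def)
qed

lemma linear_equation_iff:
  fixes b :: "'a::field"
  assumes "b \<noteq> 0"
  shows "b * x + c * y + z = l * y \<longleftrightarrow> x = (l - c) / b * y - 1 / b * z"
proof -
  have 1: "b * x + c * y + z = l * y \<longleftrightarrow> b * x = (l - c) * y - z"
    by (simp only: left_diff_distrib eq_diff_eq add_ac)
  have 2: "(l - c) / b * y - 1 / b * z = ((l - c) * y - z) / b" by (simp add: diff_divide_distrib left_diff_distrib)
  show ?thesis unfolding 1 2 nonzero_eq_divide_eq[OF assms] by (simp only: mult.commute[of x b])
qed

theorem theorem5p2:
  fixes D \<beta> \<delta> \<alpha> \<epsilon> \<gamma> \<mu> \<nu> :: real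
    and \<psi> \<psi>' \<psi>'' :: "real \<Rightarrow> complex"
    and V :: "real \<Rightarrow> complex^2^2"
    and lam :: complex
  assumes beta: "\<beta> \<ge> 0"
    and nondeg: "(D, \<beta>) \<noteq> (0, 0)"
    and d1: "\<And>x. (\<psi> has_vector_derivative \<psi>' x) (at x)"
    and d2: "\<And>x. (\<psi>' has_vector_derivative \<psi>'' x) (at x)"
    and pulse: "\<And>x. \<alpha> * \<psi> x + (D / 2) * \<psi>'' x + \<gamma> * (cmod (\<psi> x))\<^sup>2 * \<psi> x
                      + \<nu> * (cmod (\<psi> x))^4 * \<psi> x
                    = \<i> * \<delta> * \<psi> x + \<i> * \<epsilon> * (cmod (\<psi> x))\<^sup>2 * \<psi> x + \<i> * \<beta> * \<psi>'' x
                      + \<i> * \<mu> * (cmod (\<psi> x))^4 * \<psi> x"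
    and decay: "((\<lambda>x. cmod (\<psi> x)) \<longlongrightarrow> 0) at_infinity"
    and polar: "\<And>x. unitary2 (V x) \<and>
                  Mpot \<epsilon> \<gamma> \<mu> \<nu> \<psi> x = V x ** mabs (Mpot \<epsilon> \<gamma> \<mu> \<nu> \<psi> x)"
    and lam: "lam \<notin> ess_spectrum D \<beta> \<delta> \<alpha>"
  shows "in_point_spectrum D \<beta> \<delta> \<alpha> (Mpot \<epsilon> \<gamma> \<mu> \<nu> \<psi>) lam \<longleftrightarrow>
         \<not> L2_invertible (\<lambda>f x. f x + BS_op D \<beta> \<delta> \<alpha> (Mpot \<epsilon> \<gamma> \<mu> \<nu> \<psi>) V lam f x)"
proof -
  define M where "M = Mpot \<epsilon> \<gamma> \<mu> \<nu> \<psi>"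
  have unitary: "unitary2 (V x)" and MV: "M x = V x ** mabs (M x)" for x
    using polar[of x] by (simp_all add: M_def)
  have "continuous_on UNIV \<psi>"
    by (rule continuous_on_vector_derivative) (use d1 in auto)
  then have M_cont: "continuous_on UNIV (\<lambda>x. M x $ i $ j)" for i j
    unfolding M_def by (rule continuous_Mpot_entry)
  then have M_meas [measurable]: "(\<lambda>x. M x $ i $ j) \<in> borel_measurable borel" for i j
    by (rule borel_measurable_continuous_onI)
  have M_lim: "((\<lambda>x. M x $ i $ j) \<longlongrightarrow> 0) at_infinity" for i j
    unfolding M_def by (rule tendsto_Mpot_entry[OF decay])
  define m where "m x = cmod (M x $ 1 $ 1) + cmod (M x $ 1 $ 2) + cmod (M x $ 2 $ 1) + cmod (M x $ 2 $ 2)" for x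
  have m_entry: "cmod (M x $ i $ j) \<le> m x" for x i j
    using exhaust_2[of i] exhaust_2[of j] by (auto simp: m_def)
  have m_lim: "(m \<longlongrightarrow> 0) at_infinity"
    unfolding m_def[abs_def] using tendsto_norm_zero[OF M_lim]
    by (auto intro!: tendsto_add_zero)
  have m_decay: "\<exists>R. \<forall>x. R < \<bar>x\<bar> \<longrightarrow> m x \<le> \<kappa>" if "\<kappa> > 0" for \<kappa>
  proof -
    have "eventually (\<lambda>x. m x < \<kappa>) at_infinity" using order_tendstoD(2)[OF m_lim that] .
    then show ?thesis unfolding eventually_at_infinity real_norm_def by (meson less_imp_le)
  qed
  obtain K where K: "\<And>x. m x \<le> K"
  proof -
    obtain R where R: "\<And>x. R < \<bar>x\<bar> \<Longrightarrow> m x \<le> 1" using m_decay[of 1] by auto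
    have "continuous_on {-R..R} m"
      unfolding m_def[abs_def] by (intro continuous_intros continuous_on_subset[OF M_cont]) auto
    then have "bounded (m ` {-R..R})" by (intro compact_imp_bounded compact_continuous_image) auto
    then obtain K where K: "\<forall>z\<in>m ` {-R..R}. norm z \<le> K" unfolding bounded_iff by blast
    have "m x \<le> max 1 K" for x
    proof (cases "\<bar>x\<bar> \<le> R")
      case True
      then have "norm (m x) \<le> K" using K by (auto simp: abs_le_iff)
      then show ?thesis by simp
    next
      case False
      then show ?thesis using R[of x] by simp
    qed
    then show thesis using that by blast
  qed
  define b b' where "b = Complex \<beta> (D / 2)" and "b' = Complex \<beta> (- D / 2)"
  have b: "b \<noteq> 0" "b' \<noteq> 0" using nondeg by (auto simp: b_def b'_def complex_eq_iff)
  define J where "J = diag_op (1 / b) (1 / b')"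
  have linJ: "linear J" unfolding J_def by (rule linear_diag_op)
  have blJ: "bounded_linear J" using linJ by (simp add: linear_conv_bounded_linear)
  have J_meas [measurable]: "(\<lambda>x. J (f x)) \<in> borel_measurable N" if "f \<in> borel_measurable N" for f and N :: "real measure"
    by (rule measurable_compose[OF that borel_measurable_continuous_onI[OF linear_continuous_on[OF blJ]]])
  define cJ where "cJ = 2 * (norm (1 / b) + norm (1 / b'))"
  have cJ: "cJ \<ge> 0" "\<And>v. norm (J v) \<le> cJ * norm v"
    unfolding cJ_def J_def by (simp, rule norm_diag_op_le)
  have J_inv: "matrix_inv (Bm D \<beta>) *v v = J v" for v
    unfolding J_def b_def b'_def by (rule matrix_inv_Bm_mult[OF nondeg])
  obtain s t where st: "Re s > 0" "Re t > 0" and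
    s2: "s\<^sup>2 = (lam - Complex \<delta> \<alpha>) / b" and t2: "t\<^sup>2 = (lam - Complex \<delta> (- \<alpha>)) / b'"
    using ess_spectrum_square_root[OF nondeg lam] unfolding b_def b'_def by metis
  interpret diag_op_kernel s t by unfold_locales (rule st)+
  have Ainf: "Ainf D \<beta> \<delta> \<alpha> lam = A"
    by (rule ext) (simp add: Ainf_eq[OF nondeg] A_def s2 t2 b_def b'_def)
  \<comment> \<open>Multiplying by the inverse of \<open>Bm D \<beta>\<close> brings the eigenvalue
    equation into the form \<open>u'' = S^2 u - h\<close> handled by the resolvent kernel.\<close>
  have eigen_eq_iff: "Bm D \<beta> *v u2 + Nm \<delta> \<alpha> *v u + M x *v u = lam *s u \<longleftrightarrow> u2 = diag_op (s\<^sup>2) (t\<^sup>2) u - J (M x *v u)" for u u2 x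
  proof -
    have "Bm D \<beta> *v u2 + Nm \<delta> \<alpha> *v u + M x *v u = lam *s u \<longleftrightarrow>
        b * zplus u2 + Complex \<delta> \<alpha> * zplus u + zplus (M x *v u) = lam * zplus u \<and>
        b' * zminus u2 + Complex \<delta> (- \<alpha>) * zminus u + zminus (M x *v u) = lam * zminus u"
      unfolding Bm_mult Nm_mult b_def b'_def by (simp only: vec2_eq_iff zplus_simps zminus_simps zplus_diag_op zminus_diag_op zplus_smult zminus_smult)
    also have "\<dots> \<longleftrightarrow> zplus u2 = (lam - Complex \<delta> \<alpha>) / b * zplus u - 1 / b * zplus (M x *v u) \<and>
        zminus u2 = (lam - Complex \<delta> (- \<alpha>)) / b' * zminus u - 1 / b' * zminus (M x *v u)"
      by (simp only: linear_equation_iff[OF b(1)] linear_equation_iff[OF b(2)])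
    also have "\<dots> \<longleftrightarrow> u2 = diag_op (s\<^sup>2) (t\<^sup>2) u - J (M x *v u)"
      unfolding s2 t2 J_def by (simp only: vec2_eq_iff zplus_simps zminus_simps zplus_diag_op zminus_diag_op)
    finally show ?thesis .
  qed
  define H where "H x = msqrt (mabs (M x))" for x
  define W where "W x = V x ** H x" for x
  \<comment> \<open>This factorisation of \<open>M\<close> is the link between the symmetrised
    operator and the potential.\<close>
  have WH: "W x *v (H x *v v) = M x *v v" for x v
    unfolding W_def H_def matrix_vector_mul_assoc
    by (simp add: matrix_mul_assoc[symmetric] msqrt_square[OF hermitian_psd_mabs] MV[symmetric])
  have H_meas: "(\<lambda>x. H x $ i $ j) \<in> borel_measurable borel" for i j
    unfolding H_def by (rule msqrt_measurable[OF hermitian_psd_mabs mabs_measurable[OF M_meas]])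
  have W_meas: "(\<lambda>x. W x $ i $ j) \<in> borel_measurable borel" for i j
    unfolding W_def H_def by (rule unitary_msqrt_measurable[OF MV M_meas])
  \<comment> \<open>The entry bound for roots is used twice, passing from the adjoint square of
    \<open>M\<close> to |M| and then to its square root.\<close>
  obtain KH where KH: "\<And>x i j. cmod (H x $ i $ j) \<le> KH"
  proof -
    have K0: "0 \<le> K" using order_trans[OF order_trans[OF norm_ge_zero m_entry] K] .
    have MM: "cmod ((cadj (M x) ** M x) $ j $ j) \<le> 2 * (K * K)" for x j
    proof -
      have "cmod ((cadj (M x) ** M x) $ j $ j) \<le> cmod (M x $ 1 $ j) * cmod (M x $ 1 $ j) + cmod (M x $ 2 $ j) * cmod (M x $ 2 $ j)"
        unfolding matrix_mult_22 cadj_nth by (rule order_trans[OF norm_triangle_ineq]) (simp add: norm_mult)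
      also have "\<dots> \<le> K * K + K * K"
        by (intro add_mono mult_mono order_trans[OF m_entry K] K0) auto
      finally show ?thesis by simp
    qed
    have mabs_bound: "cmod (mabs (M x) $ i $ j) \<le> sqrt (2 * (K * K))" for x i j
      using norm_hermitian_sqrt_entry[OF hermitian_psd_mabs, of "M x" i j]
        msqrt_square[OF hermitian_psd_cadj_mult[of "M x"]] MM[of x j]
      by (intro real_le_rsqrt) (simp add: mabs_def)
    have "(cmod (H x $ i $ j))\<^sup>2 \<le> sqrt (2 * (K * K))" for x i j
      using norm_hermitian_sqrt_entry[OF hermitian_psd_msqrt[OF hermitian_psd_mabs], of "M x" i j] mabs_bound[of x j j]
      unfolding msqrt_square[OF hermitian_psd_mabs] H_def by linarith
    then have "cmod (H x $ i $ j) \<le> sqrt (sqrt (2 * (K * K)))" for x i j by (rule real_le_rsqrt)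
    then show thesis using that by blast
  qed
  have W_bound: "cmod (W x $ i $ j) \<le> 2 * KH" for x i j
  proof -
    have "cmod (W x $ i $ j) \<le> cmod (V x $ i $ 1) * cmod (H x $ 1 $ j) + cmod (V x $ i $ 2) * cmod (H x $ 2 $ j)"
      unfolding W_def matrix_mult_22 by (rule order_trans[OF norm_triangle_ineq]) (simp add: norm_mult)
    also have "\<dots> \<le> 1 * KH + 1 * KH"
      by (intro add_mono mult_mono KH norm_unitary2_entry unitary) auto
    finally show ?thesis by simp
  qed
  have sq_int_H: "sq_int (\<lambda>x. H x *v f x)" if f: "sq_int f" for f
    by (rule sq_int_bound[OF f matrix_vector_22_measurable[OF H_meas] norm_matrix_vector_22_le[OF KH]])
      (use f in \<open>simp add: sq_int_def\<close>)
  \<comment> \<open>The source that \<open>f\<close> feeds into the resolvent kernel; on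
    \<open>f = H w\<close> it reduces to the potential term \<open>P w\<close>.\<close>
  define q where "q f x = J (W x *v f x)" for f x
  have q_sq_int: "sq_int (q f)" if f: "sq_int f" for f
  proof -
    have fm: "f \<in> borel_measurable borel" using f by (simp add: sq_int_def)
    show ?thesis unfolding q_def
    proof (rule sq_int_bound[OF f J_meas[OF matrix_vector_22_measurable[OF W_meas fm]]])
      show "norm (J (W x *v f x)) \<le> cJ * (4 * (2 * KH)) * norm (f x)" for x
        using cJ(2)[of "W x *v f x"] mult_left_mono[OF norm_matrix_vector_22_le[OF W_bound, of x "f x"] cJ(1)]
        by (simp add: mult.assoc)
    qed
  qed
  define P where "P x v = J (M x *v v)" for x v
  have qH: "q (\<lambda>x. H x *v w x) y = P y (w y)" for w y
    by (simp add: q_def P_def WH)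
  have m_bound: "norm (M x *v v) \<le> 4 * m x * norm v" for x v
    by (rule norm_matrix_vector_22_le[OF m_entry])
  have P_bound: "norm (P x v) \<le> cJ * (4 * m x) * norm v" for x v
    using cJ(2)[of "M x *v v"] mult_left_mono[OF m_bound cJ(1), of x v] by (simp add: P_def mult.assoc)
  interpret exp_kernel_potential G "1 / norm s + 1 / norm t" \<sigma> 2 P "cJ * (4 * K)"
  proof (intro exp_kernel_potential.intro exp_kernel_potential_axioms.intro)
    show "exp_kernel G (1 / norm s + 1 / norm t) \<sigma> 2" by (rule exp_kernel_axioms)
    show "linear (P y)" for y
      unfolding P_def using linear_compose[OF matrix_vector_mul_linear linJ] by (simp add: o_def)
    show "continuous_on UNIV (\<lambda>p. P (fst p) (snd p))"
      unfolding P_def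
    proof (rule bounded_linear.continuous_on[OF blJ])
      have "continuous_on UNIV (\<lambda>p. M (fst p) $ i $ j)" for i j
        by (rule continuous_on_compose2[OF M_cont]) (auto intro: continuous_intros)
      moreover have "continuous_on UNIV (\<lambda>p::real \<times> (complex^2). snd p $ j)" for j by (intro continuous_intros)
      ultimately show "continuous_on UNIV (\<lambda>p. M (fst p) *v snd p)"
        unfolding matrix_vector_mult_def by (intro continuous_on_vec_lambda continuous_on_sum continuous_on_mult)
    qed
    show "norm (P y v) \<le> cJ * (4 * K) * norm v" for y v
      by (rule order_trans[OF P_bound]) (intro mult_right_mono mult_left_mono K cJ(1); simp)
    show "\<exists>R. \<forall>y v. R < \<bar>y\<bar> \<longrightarrow> norm (P y v) \<le> \<kappa> * norm v" if \<kappa>: "\<kappa> > 0" for \<kappa>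
    proof -
      \<comment> \<open>The added 1 makes the division safe without knowing that \<open>cJ\<close>
        is positive.\<close>
      have "\<kappa> / (4 * cJ + 1) > 0" using \<kappa> cJ(1) by simp
      then obtain R where R: "\<And>x. R < \<bar>x\<bar> \<Longrightarrow> m x \<le> \<kappa> / (4 * cJ + 1)" using m_decay by blast
      have "cJ * (4 * m y) \<le> \<kappa>" if "R < \<bar>y\<bar>" for y
      proof -
        have "cJ * (4 * m y) \<le> (4 * cJ) * (\<kappa> / (4 * cJ + 1))"
          using mult_left_mono[OF R[OF that], of "4 * cJ"] cJ(1) by simp
        also have "\<dots> \<le> \<kappa>" using \<kappa> cJ(1) by (simp add: field_simps)
        finally show ?thesis .
      qed
      then show ?thesis
        using order_trans[OF P_bound mult_right_mono[OF _ norm_ge_zero]] by blast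
    qed
  qed
  define T where "T f x = f x + BS_op D \<beta> \<delta> \<alpha> M V lam f x" for f x
  \<comment> \<open>The block form of I + K: the identity on second components, and on first
    components \<open>I - H conv q\<close>, the minus sign coming from \<open>Rl\<close>.\<close>
  have T: "T f x = (fst (f x) - H x *v conv (q (\<lambda>y. fst (f y))) x, snd (f x))" if f: "sq_int f" for f x
  proof -
    let ?q = "q (\<lambda>y. fst (f y))"
    have q: "sq_int ?q" by (rule q_sq_int[OF sq_int_fst[OF f]])
    then have e: "exp_integrable \<sigma> ?q" by (rule exp_integrable_sq_int(1)[OF _ \<sigma>_pos])
    then have e': "exp_integrable \<sigma> (\<lambda>y. (-1) *\<^sub>R ?q y)" by (auto simp: exp_integrable_def)
    have "Rl D \<beta> V M y (f y) = (0, (-1) *\<^sub>R ?q y)" for y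
      unfolding Rl_def q_def W_def H_def J_inv[symmetric] by (simp add: matrix_vector_mul_assoc matrix_mul_assoc)
    then have "BS_op D \<beta> \<delta> \<alpha> M V lam f x = (H x *v conv (\<lambda>y. (-1) *\<^sub>R ?q y) x, 0)"
      unfolding BS_op_def Rr_def H_def by (simp only: fst_integral_GA[OF Ainf e'])
    also have "\<dots> = (- (H x *v conv ?q x), 0)"
      unfolding conv_scaleR by (simp add: linear_neg[OF matrix_vector_mul_linear])
    finally show ?thesis by (simp add: T_def prod_eq_iff)
  qed
  have measP: "(\<lambda>y. P y (w y)) \<in> borel_measurable borel" if "w \<in> borel_measurable borel" for w
    using that by measurable
  have sq_int_P: "sq_int (\<lambda>y. P y (w y))" if "sq_int w" for w
    by (rule sq_int_bound[OF that measP bound_P]) (use that in \<open>simp add: sq_int_def\<close>)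
  have conv_zero: "conv (\<lambda>_. 0) x = 0" for x
    by (simp add: conv_def linear_0[OF lin])
  show ?thesis
  proof
    assume "in_point_spectrum D \<beta> \<delta> \<alpha> (Mpot \<epsilon> \<gamma> \<mu> \<nu> \<psi>) lam"
    then obtain u u1 u2 where u: "sq_int u" "sq_int u1" "sq_int u2" "weak_deriv u u1" "weak_deriv u1 u2"
      and nz: "\<not> (AE x in lborel. u x = 0)"
      and eq: "AE x in lborel. Bm D \<beta> *v u2 x + Nm \<delta> \<alpha> *v u x + M x *v u x = lam *s u x"
      unfolding in_point_spectrum_def M_def by blast
    have um: "u \<in> borel_measurable borel" using u by (simp add: sq_int_def)
    have uc: "AE x in lborel. u x = conv (\<lambda>y. P y (u y)) x"
      using eq unfolding eigen_eq_iff P_def[symmetric] by (rule weak_solution_eq_conv[OF u sq_int_P[OF u(1)]])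
    define f :: "real \<Rightarrow> (complex^2) \<times> (complex^2)" where "f x = (H x *v u x, 0)" for x
    have f: "sq_int f"
      unfolding f_def by (intro sq_int_Pair sq_int_H u) (simp add: sq_int_def)
    have "AE x in lborel. T f x = 0"
      using uc by eventually_elim (simp add: T[OF f] f_def qH[abs_def] zero_prod_def)
    \<comment> \<open>If \<open>H u\<close> vanished almost everywhere, so would
      \<open>M u = W H u\<close>, and \<open>u\<close> would be the convolution of 0.\<close>
    moreover have "\<not> (AE x in lborel. f x = 0)"
    proof
      assume "AE x in lborel. f x = 0"
      then have "AE x in lborel. P x (u x) = 0"
        by eventually_elim (simp add: f_def P_def WH[symmetric] zero_prod_def linear_0[OF linJ])
      then have "conv (\<lambda>y. P y (u y)) x = conv (\<lambda>_. 0) x" for x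
        by (intro conv_cong_AE measP um) auto
      then show False using uc nz by (simp add: conv_zero)
    qed
    ultimately show "\<not> L2_invertible (\<lambda>f x. f x + BS_op D \<beta> \<delta> \<alpha> (Mpot \<epsilon> \<gamma> \<mu> \<nu> \<psi>) V lam f x)"
      using f unfolding L2_invertible_def M_def[symmetric] T_def[symmetric] by blast
  next
    assume ninv: "\<not> L2_invertible (\<lambda>f x. f x + BS_op D \<beta> \<delta> \<alpha> (Mpot \<epsilon> \<gamma> \<mu> \<nu> \<psi>) V lam f x)"
    show "in_point_spectrum D \<beta> \<delta> \<alpha> (Mpot \<epsilon> \<gamma> \<mu> \<nu> \<psi>) lam"
    proof (rule ccontr)
      assume nspec: "\<not> in_point_spectrum D \<beta> \<delta> \<alpha> (Mpot \<epsilon> \<gamma> \<mu> \<nu> \<psi>) lam"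
      \<comment> \<open>A bounded continuous fixed point is square integrable, and the convolution
        formula supplies two derivatives in L^2: it is an eigenfunction unless it is zero.\<close>
      have inj: "w = (\<lambda>_. 0)"
        if w: "continuous_on UNIV w" "bounded (range w)" and fp: "\<And>x. w x = conv (\<lambda>y. P y (w y)) x" for w
      proof -
        have wm: "w \<in> borel_measurable borel" using w(1) by (rule borel_measurable_continuous_onI)
        obtain B where B: "\<And>x. norm (w x) \<le> B" using w(2) by (auto simp: bounded_iff)
        have wsq: "sq_int w"
          by (rule sq_int_of_fixed_point[OF wm B, of "\<lambda>_. 0"]) (simp_all add: sq_int_def fp[symmetric])
        define h where "h y = P y (w y)" for y
        have hsq: "sq_int h" unfolding h_def by (rule sq_int_P[OF wsq])
        have hc: "continuous_on UNIV h"
          unfolding h_def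
          by (rule continuous_on_compose2[OF continuous_P, of UNIV "\<lambda>y. (y, w y)", simplified]) (intro continuous_intros w)
        have hB: "norm (h y) \<le> cJ * (4 * K) * B" for y
          unfolding h_def by (rule order_trans[OF bound_P mult_left_mono[OF B K_nonneg]])
        have wh: "w = conv h" unfolding h_def[abs_def] by (rule ext) (rule fp)
        note der = conv_has_vector_derivative[OF hc hB, folded wh]
        define w2 where "w2 x = diag_op (s\<^sup>2) (t\<^sup>2) (w x) - h x" for x
        have w2c: "continuous_on UNIV w2"
          unfolding w2_def by (intro continuous_intros hc bounded_linear.continuous_on[OF bounded_linear_diag_op w(1)])
        have w1c: "continuous_on UNIV (conv_deriv h)"
          by (rule continuous_on_vector_derivative) (rule der(2)[THEN has_vector_derivative_at_within])
        have "sq_int (conv_deriv h)"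
          by (rule sq_int_exp_kernel_bound[OF hsq \<sigma>_pos borel_measurable_continuous_onI[OF w1c]
                norm_conv_deriv_le[OF exp_integrable_sq_int(1)[OF hsq \<sigma>_pos]]])
        moreover have "sq_int w2"
        proof -
          note bl = bounded_linear_diag_op[of "s\<^sup>2" "t\<^sup>2"]
          have "sq_int (\<lambda>x. diag_op (s\<^sup>2) (t\<^sup>2) (w x))"
            by (rule sq_int_bound[OF wsq borel_measurable_continuous_onI[OF bounded_linear.continuous_on[OF bl w(1)]] norm_diag_op_le])
          moreover have "sq_int (\<lambda>x. - h x)" using hsq by (auto simp: sq_int_def)
          ultimately have "sq_int (\<lambda>x. diag_op (s\<^sup>2) (t\<^sup>2) (w x) + - h x)" by (rule sq_int_add)
          then show ?thesis by (simp add: w2_def[abs_def])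
        qed
        moreover have "weak_deriv w (conv_deriv h)"
          by (rule weak_deriv_of_has_vector_derivative[OF der(1) w1c])
        moreover have "weak_deriv (conv_deriv h) w2"
          by (rule weak_deriv_of_has_vector_derivative[OF der(2)[folded w2_def] w2c])
        moreover have "AE x in lborel. Bm D \<beta> *v w2 x + Nm \<delta> \<alpha> *v w x + M x *v w x = lam *s w x"
          unfolding eigen_eq_iff by (simp add: w2_def h_def P_def)
        ultimately have "AE x in lborel. w x = 0"
          using nspec wsq unfolding in_point_spectrum_def M_def[symmetric] by blast
        then have "AE x in lborel. P x (w x) = 0"
          by eventually_elim (simp add: linear_0[OF lin_P])
        \<comment> \<open>The spectrum only yields \<open>w = 0\<close> almost everywhere; inserting
          this in the fixed point equation gives it at every point.\<close>
        then have c0: "conv (\<lambda>y. P y (w y)) x = conv (\<lambda>_. 0) x" for x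
          by (intro conv_cong_AE measP wm) auto
        show ?thesis by (rule ext) (rule trans[OF fp trans[OF c0 conv_zero]])
      qed
      have conv_facts: "continuous_on UNIV (conv (q f))" "bounded (range (conv (q f)))" "sq_int (conv (q f))"
        "q f \<in> borel_measurable borel" "exp_integrable \<sigma> (q f)" if "sq_int f" for f
        using q_sq_int[OF that] exp_integrable_sq_int(1)[OF q_sq_int[OF that] \<sigma>_pos]
        by (auto intro: continuous_conv bounded_conv_sq_int sq_int_conv simp: exp_integrable_def)
      have "L2_invertible T"
        unfolding L2_invertible_def
      proof (intro conjI allI impI)
        fix f :: "real \<Rightarrow> (complex^2) \<times> (complex^2)" assume f: "sq_int f" and T0: "AE x in lborel. T f x = 0"
        let ?f1 = "\<lambda>x. fst (f x)"
        have f1: "sq_int ?f1" by (rule sq_int_fst[OF f])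
        \<comment> \<open>Injectivity is transferred to \<open>w\<close>: the kernel equation reads
          \<open>f1 = H w\<close>, and applying \<open>q\<close> and \<open>conv\<close> turns it
          into the fixed point equation.\<close>
        define w where "w = conv (q ?f1)"
        have Hw: "AE x in lborel. ?f1 x = H x *v w x \<and> snd (f x) = 0"
          using T0 by eventually_elim (simp add: T[OF f] w_def zero_prod_def)
        have "w x = conv (\<lambda>y. P y (w y)) x" for x
          unfolding w_def
        proof (rule conv_cong_AE)
          show "AE y in lborel. q ?f1 y = P y (conv (q ?f1) y)"
            using Hw by eventually_elim (simp add: q_def P_def WH w_def)
          show "(\<lambda>y. P y (conv (q ?f1) y)) \<in> borel_measurable borel"
            by (intro measP borel_measurable_continuous_onI conv_facts f1)
        qed (rule conv_facts[OF f1])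
        then have w0: "w = (\<lambda>_. 0)" unfolding w_def by (intro inj conv_facts f1)
        show "AE x in lborel. f x = 0"
          using Hw unfolding w0 by eventually_elim (simp add: prod_eq_iff)
      next
        fix g :: "real \<Rightarrow> (complex^2) \<times> (complex^2)" assume g: "sq_int g"
        let ?g1 = "\<lambda>x. fst (g x)"
        have g1: "sq_int ?g1" by (rule sq_int_fst[OF g])
        \<comment> \<open>Surjectivity is solved for \<open>w\<close> first, in the space where the
          alternative is available; \<open>f\<close> is then defined from \<open>w\<close>.\<close>
        have "\<exists>w. continuous_on UNIV w \<and> bounded (range w) \<and> (\<forall>x. w x = conv (q ?g1) x + conv (\<lambda>y. P y (w y)) x)"
        proof (rule fredholm_alternative_bounded_continuous[OF _ conv_facts(1,2)[OF g1]])
          fix w :: "real \<Rightarrow> complex^2"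
          assume "continuous_on UNIV w" "bounded (range w)" "\<And>x. w x = conv (\<lambda>y. P y (w y)) x"
          then show "w = (\<lambda>_. 0)" by (rule inj)
        qed
        then obtain w where w: "continuous_on UNIV w" "bounded (range w)"
          and weq: "\<And>x. w x = conv (q ?g1) x + conv (\<lambda>y. P y (w y)) x"
          by blast
        have wm: "w \<in> borel_measurable borel" using w(1) by (rule borel_measurable_continuous_onI)
        obtain B where B: "\<And>x. norm (w x) \<le> B" using w(2) by (auto simp: bounded_iff)
        have wsq: "sq_int w" by (rule sq_int_of_fixed_point[OF wm B conv_facts(3)[OF g1] weq])
        define f where "f x = (?g1 x + H x *v w x, snd (g x))" for x
        have f: "sq_int f"
          unfolding f_def by (intro sq_int_Pair sq_int_add g1 sq_int_H wsq sq_int_snd[OF g])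
        have qf: "q (\<lambda>y. fst (f y)) = (\<lambda>y. q ?g1 y + P y (w y))"
          by (simp add: fun_eq_iff f_def q_def P_def matrix_vector_right_distrib WH linear_add[OF linJ])
        \<comment> \<open>Closes the circle: \<open>w\<close>, obtained from the alternative, is
          indeed the convolution produced by \<open>f\<close>.\<close>
        have "conv (q (\<lambda>y. fst (f y))) x = w x" for x
          unfolding qf by (rule trans[OF conv_add[OF conv_facts(5)[OF g1] exp_integrable_P[OF wm B]] weq[symmetric]])
        then have "T f x = g x" for x by (simp add: T[OF f] f_def)
        then show "\<exists>f. sq_int f \<and> (AE x in lborel. T f x = g x)" using f by auto
      qed
      then show False using ninv unfolding M_def[symmetric] T_def[symmetric] by blast
    qed
  qed
qed

end
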